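(* Let $T$ be a self-similar interval exchange map with associated substitution $\sigma$ on the alphabet $\mathcal A$ and matrix $M$. Assume that $M$ has an eigenvalue $\beta\in\mathbb C$ with $|\beta|>1$ such that $\beta/|\beta|$ is not a root of unity, and that there exists an eigenvector $\Gamma\in\mathbb C^{\mathcal A}$ of $M$ for $\beta$ such that $T$ has the unique representation property for $\beta$ and $\Gamma$. Then, for almost every $\gamma$ in the complex subspace $\mathbb C\Gamma$ generated by $\Gamma$ (with respect to Lebesgue measure on $\mathbb C\Gamma\cong\mathbb C$), the vector $\exp(-\operatorname{Re}(\gamma))=(\exp(-\operatorname{Re}(\gamma_a)))_{a\in\mathcal A}$ can be realized as the slope vector of an affine interval exchange map which is semi-conjugate with $T$ and has wandering intervals.
   Context: Interval exchange maps. An interval exchange map (i.e.m.) is a bijection $T:[0,1)\to[0,1)$ with a finite partition $(I_a)_{a\in\mathcal A}$ of $[0,1)$ into intervals (closed on the left, open on the right) such that $T(t)=t+\delta_a$ for $t\in I_a$. $T$ is self-similar if for some $0<\alpha<1$ the first return map $T^{(1)}$ of $T$ to $[0,\alpha)$ equals $T$ up to rescaling: $T^{(1)}(\alpha t)=\alpha T(t)$ for $t\in[0,1)$. Put $I_a^{(1)}=\alpha I_a$. It is understood that the first return time $r_a$ to $[0,\alpha)$ is constant on $I_a^{(1)}$ and that for each $0\le m\le r_a-1$ the set $T^m(I_a^{(1)})$ is contained in a single interval $I_{w_m}$. The associated substitution $\sigma:\mathcal A\to\mathcal A^+$ is $\sigma(a)=w_0\cdots w_{r_a-1}$, extended to words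 by concatenation, and $M_{a,b}$ is the number of occurrences of $b$ in $\sigma(a)$ (so $M$ is the transpose of the renormalization matrix). Standing facts: $T$ is minimal and uniquely ergodic, $\sigma$ is primitive, and $\alpha^{-1}$ is the Perron-Frobenius eigenvalue of $M$. Affine i.e.m. An affine i.e.m. is a bijective piecewise affine map $f:[0,1)\to[0,1)$ with positive slopes; if $(J_a)_{a\in\mathcal A}$ are its continuity intervals and $f$ has slope $\ell_a>0$ on $J_a$, then $(\ell_a)_{a\in\mathcal A}$ is its slope vector. $f$ is semi-conjugate with $T$ if there is a continuous, surjective, nondecreasing $h:[0,1)\to[0,1)$ with $h\circ f=T\circ h$. A wandering interval of $f$ is a nondegenerate interval $J$ whose iterates $f^n(J)$, $n\in\mathbb Z$, are pairwise disjoint. Fractals and unique representation property. Let $\gamma$ be an eigenvector of $M$ for $\beta$. For a word $w=w_0\cdots w_{n-1}$ put $\gamma(w)=\gamma_{w_0}+\dots+\gamma_{w_{n-1}}$ ($\gamma(\varepsilon)=0$ for the empty word $\varepsilon$). For $a\in\mathcal A$ let $\mathcal S_a$ be the set of sequences $x=(p_m^x,c_m^x,s_m^x)_{m\ge1}$ in $\mathcal A^*\times\mathcal A\times\mathcal A^*$ with $\sigma(a)=p_1^xc_1^xs_1^x$ and $\sigma(c_m^x)=p_{m+1}^xc_{m+1}^xs_{m+1}^x$ for all $m\ge1$. Put $\zeta_a(x)=\sum_{m\ge1}\beta^{-m}\gamma(p_m^x)$ and $\mathfrak F_a=\zeta_a(\mathcal S_a)\subset\mathbb C$; $x\in\mathcal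 S_a$ is a representation of $z\in\mathfrak F_a$ if $z=\zeta_a(x)$. For $\tau$ in the unit circle $\mathbb S^1\subset\mathbb C$, the extreme points of $\mathfrak F_a$ for the direction $\tau$ are the $z\in\mathfrak F_a$ with $\operatorname{Re}(\tau z)=\min_{z'\in\mathfrak F_a}\operatorname{Re}(\tau z')$. $T$ has the unique representation property for $\beta$ and $\gamma$ if for every $a\in\mathcal A$ and $\tau\in\mathbb S^1$ every extreme point of $\mathfrak F_a$ for the direction $\tau$ has exactly one representation in $\mathcal S_a$. *)

theory Defs
  imports "HOL-Analysis.Analysis"
begin

text \<open>Maps of \<open>[0,1)\<close> are total functions on \<^typ>\<open>real\<close>; every definition below only constrains
  their values on \<^term>\<open>{0..<1::real}\<close>. The alphabet is a finite type.\<close>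

definition interval_partition :: "('a::finite \<Rightarrow> real set) \<Rightarrow> bool" where
  "interval_partition I \<longleftrightarrow>
     (\<forall>a. \<exists>u v. u < v \<and> I a = {u..<v}) \<and> disjoint_family I \<and> (\<Union>a. I a) = {0..<1}"

definition interval_exchange :: "(real \<Rightarrow> real) \<Rightarrow> ('a::finite \<Rightarrow> real set) \<Rightarrow> bool" where
  "interval_exchange T I \<longleftrightarrow>
     bij_betw T {0..<1} {0..<1} \<and> interval_partition I \<and>
     (\<forall>a. \<exists>\<delta>. \<forall>t\<in>I a. T t = t + \<delta>)"

definition first_return_time :: "(real \<Rightarrow> real) \<Rightarrow> real \<Rightarrow> real \<Rightarrow> nat" where
  "first_return_time T \<alpha> t = (LEAST n. 0 < n \<and> (T ^^ n) t \<in> {0..<\<alpha>})"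

definition first_return_map :: "(real \<Rightarrow> real) \<Rightarrow> real \<Rightarrow> real \<Rightarrow> real" where
  "first_return_map T \<alpha> t = (T ^^ first_return_time T \<alpha> t) t"

text \<open>The second conjunct makes the \<open>LEAST\<close> in \<^const>\<open>first_return_time\<close> meaningful.\<close>

definition self_similar :: "(real \<Rightarrow> real) \<Rightarrow> real \<Rightarrow> bool" where
  "self_similar T \<alpha> \<longleftrightarrow>
     0 < \<alpha> \<and> \<alpha> < 1 \<and>
     (\<forall>t\<in>{0..<\<alpha>}. \<exists>n>0. (T ^^ n) t \<in> {0..<\<alpha>}) \<and>
     (\<forall>t\<in>{0..<1}. first_return_map T \<alpha> (\<alpha> * t) = \<alpha> * T t)"

definition associated_substitution ::
    "(real \<Rightarrow> real) \<Rightarrow> ('a \<Rightarrow> real set) \<Rightarrow> real \<Rightarrow> ('a \<Rightarrow> 'a list) \<Rightarrow> bool" where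
  "associated_substitution T I \<alpha> \<sigma> \<longleftrightarrow>
     (\<forall>a. (\<forall>t\<in>(*) \<alpha> ` I a. first_return_time T \<alpha> t = length (\<sigma> a)) \<and>
          (\<forall>m<length (\<sigma> a). (T ^^ m) ` (*) \<alpha> ` I a \<subseteq> I (\<sigma> a ! m)))"

definition substitution_matrix :: "('a \<Rightarrow> 'a list) \<Rightarrow> complex^'a^'a" where
  "substitution_matrix \<sigma> = (\<chi> a b. of_nat (count_list (\<sigma> a) b))"

definition is_eigenvector :: "complex^'a^'a \<Rightarrow> complex^'a \<Rightarrow> complex \<Rightarrow> bool" where
  "is_eigenvector M \<gamma> \<beta> \<longleftrightarrow> \<gamma> \<noteq> 0 \<and> M *v \<gamma> = \<beta> *s \<gamma>"

definition affine_interval_exchange ::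
    "(real \<Rightarrow> real) \<Rightarrow> ('a::finite \<Rightarrow> real set) \<Rightarrow> real^'a \<Rightarrow> bool" where
  "affine_interval_exchange f J l \<longleftrightarrow>
     bij_betw f {0..<1} {0..<1} \<and> interval_partition J \<and>
     (\<forall>a. 0 < l $ a \<and> (\<exists>c. \<forall>t\<in>J a. f t = l $ a * t + c))"

definition semi_conjugacy :: "(real \<Rightarrow> real) \<Rightarrow> (real \<Rightarrow> real) \<Rightarrow> (real \<Rightarrow> real) \<Rightarrow> bool" where
  "semi_conjugacy h f T \<longleftrightarrow>
     continuous_on {0..<1} h \<and> h ` {0..<1} = {0..<1} \<and> mono_on {0..<1} h \<and>
     (\<forall>t\<in>{0..<1}. h (f t) = T (h t))"

definition int_iterate :: "(real \<Rightarrow> real) \<Rightarrow> int \<Rightarrow> real \<Rightarrow> real" where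
  "int_iterate f n =
     (if 0 \<le> n then f ^^ nat n else inv_into {0..<1} f ^^ nat (- n))"

definition wandering_interval :: "(real \<Rightarrow> real) \<Rightarrow> real set \<Rightarrow> bool" where
  "wandering_interval f J \<longleftrightarrow>
     J \<subseteq> {0..<1} \<and> is_interval J \<and> interior J \<noteq> {} \<and>
     disjoint_family (\<lambda>n. int_iterate f n ` J)"

definition word_value :: "complex^'a \<Rightarrow> 'a list \<Rightarrow> complex" where
  "word_value \<gamma> w = (\<Sum>b\<leftarrow>w. \<gamma> $ b)"

text \<open>Sequences indexed by \<open>m \<ge> 1\<close> are shifted: \<open>x k\<close> is the triple
  \<open>(p\<^sub>m, c\<^sub>m, s\<^sub>m)\<close> with \<open>m = k + 1\<close>. Otherwise an irrelevant value at index \<open>0\<close> would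
  destroy uniqueness of representations.\<close>

definition prefix_suffix_seqs ::
    "('a \<Rightarrow> 'a list) \<Rightarrow> 'a \<Rightarrow> (nat \<Rightarrow> 'a list \<times> 'a \<times> 'a list) set" where
  "prefix_suffix_seqs \<sigma> a = {x.
     (case x 0 of (p, c, s) \<Rightarrow> \<sigma> a = p @ [c] @ s) \<and>
     (\<forall>k. \<sigma> (fst (snd (x k))) = (case x (Suc k) of (p, c, s) \<Rightarrow> p @ [c] @ s))}"

definition zeta :: "complex \<Rightarrow> complex^'a \<Rightarrow> (nat \<Rightarrow> 'a list \<times> 'a \<times> 'a list) \<Rightarrow> complex" where
  "zeta \<beta> \<gamma> x = (\<Sum>k. word_value \<gamma> (fst (x k)) / \<beta> ^ Suc k)"

definition fractal :: "('a \<Rightarrow> 'a list) \<Rightarrow> complex \<Rightarrow> complex^'a \<Rightarrow> 'a \<Rightarrow> complex set" where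
  "fractal \<sigma> \<beta> \<gamma> a = zeta \<beta> \<gamma> ` prefix_suffix_seqs \<sigma> a"

definition extreme_points_dir :: "complex set \<Rightarrow> complex \<Rightarrow> complex set" where
  "extreme_points_dir F \<tau> = {z \<in> F. \<forall>z'\<in>F. Re (\<tau> * z) \<le> Re (\<tau> * z')}"

definition unique_representation_property ::
    "('a \<Rightarrow> 'a list) \<Rightarrow> complex \<Rightarrow> complex^'a \<Rightarrow> bool" where
  "unique_representation_property \<sigma> \<beta> \<gamma> \<longleftrightarrow>
     (\<forall>a \<tau>. cmod \<tau> = 1 \<longrightarrow>
        (\<forall>z\<in>extreme_points_dir (fractal \<sigma> \<beta> \<gamma> a) \<tau>.
           \<exists>!x. x \<in> prefix_suffix_seqs \<sigma> a \<and> zeta \<beta> \<gamma> x = z))"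

end

theory Submission
  imports Defs "HOL-Probability.Probability" "HOL-Library.Diagonal_Subsequence"
begin

text \<open>Fix \<open>z\<close>. If some \<open>t0\<close> has Birkhoff sums \<open>\<gamma>_n\<close> of \<open>\<gamma> = z \<Gamma>\<close> along its two-sided \<open>T\<close>-orbit with
  \<open>exp (- Re \<gamma>_n)\<close> summable, then blowing up the orbit point \<open>T^n t0\<close> to an interval of
  length proportional to \<open>exp (- Re \<gamma>_n)\<close> gives the affine map; the orbit is dense because
  \<open>T\<close> is minimal. To find \<open>t0\<close>, choose in each word \<open>\<sigma>^k(a)\<close> the prefix minimizing \<open>Re \<gamma>\<close> and
  pass to the limit. The values of prefixes of \<open>\<sigma>^k(a)\<close> are, up to a bounded error, \<open>z \<beta>^k\<close> times points of the
  fractal, so minimal prefixes are extreme points for the direction of \<open>z \<beta>^k\<close>.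
  Unique representation forces two nearly extreme points with different first digits to be
  far apart; the directions where this happens have small measure, and by Borel-Cantelli
  they are avoided for large \<open>k\<close> by almost every \<open>z\<close>. Hence \<open>Re \<gamma>_n\<close> exceeds a large
  multiple of \<open>k\<close> outside the block of level \<open>k\<close>, whose size is exponential in \<open>k\<close>.
  That \<open>\<beta>/|\<beta>|\<close> is not a root of unity excludes eventually periodic paths of minimal
  prefixes, for which the limit might not be the itinerary of a point of \<open>[0,1)\<close>.\<close>

text \<open>Minimality is derived from self-similarity; it takes one letter \<open>a\<close> with
  unbounded lengths of \<open>\<sigma>^n(a)\<close>, and the eigenvalue provides one. A gap
  \<open>\<kappa> k\<close> between prefix values of level \<open>k\<close> has size
  \<open>\<kappa> k / |\<beta>|^k\<close> in the scale of the fractal, so the directions violating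
  it have measure of order \<open>k / |\<beta>|^k\<close>. This is summable for every
  \<open>\<kappa>\<close>, which leaves \<open>\<kappa>\<close> free to exceed the exponential
  growth rate of the blocks. Minimal prefixes of different levels fit together because the tail of a
  minimizer is a minimizer for the previous power of \<open>\<beta>\<close>; compactness gives one
  path optimal at all levels. The path determines nested intervals that are closed on the left only.
  They could shrink to a missing right end point, but as there are finitely many letters the path
  would then be periodic. Along a periodic path the prefix values are geometric sums with ratio
  \<open>\<beta>^q\<close>; bounded above in the direction \<open>z\<close>, they repeat,
  contradicting the growing gap unless all late splittings are trivial, and that would give
  \<open>T 0 = 0\<close>. The same argument makes the blocks grow on both sides.\<close>

section \<open>Interval exchange maps\<close>

text \<open>Meant for sets \<open>U\<close> that contain a right neighbourhood of each of their
  points. Then the right end of a maximal interval never lies in \<open>U\<close>, while the left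
  end may; in that case points outside \<open>U\<close> accumulate at it from the left. The last
  conjunct covers both cases.\<close>

definition component :: "real set \<Rightarrow> real \<Rightarrow> real \<Rightarrow> bool" where
  "component U p q \<longleftrightarrow> p < q \<and> {p<..<q} \<subseteq> U \<and> q \<notin> U \<and> (\<forall>e>0. \<exists>v. p - e < v \<and> v \<le> p \<and> v \<notin> U)"

lemma component_eqI:
  assumes "component U p q" "component U p' q'" "r \<in> {p<..<q}" "r \<in> {p'<..<q'}"
  shows "p = p'" "q = q'"
proof -
  have *: "p' \<le> p" "q' \<ge> q" if c: "component U p q" "component U p' q'" "r \<in> {p<..<q}" "r \<in> {p'<..<q'}"
    for p q p' q'
  proof -
    show "q' \<ge> q"
    proof (rule ccontr)
      assume "\<not> q' \<ge> q"
      hence "q' \<in> {p<..<q}" using c(3,4) by auto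
      thus False using c unfolding component_def by blast
    qed
    show "p' \<le> p"
    proof (rule ccontr)
      assume "\<not> p' \<le> p"
      then obtain v where "p' - (p' - p) < v" "v \<le> p'" "v \<notin> U"
        using c(2) unfolding component_def by (metis diff_gt_0_iff_gt not_le)
      hence "v \<in> {p<..<q}" using c(3,4) by auto
      thus False using c \<open>v \<notin> U\<close> unfolding component_def by blast
    qed
  qed
  show "p = p'" "q = q'" using *[OF assms] *[OF assms(2,1,4,3)] by auto
qed

text \<open>A point lies in the closure of at most two components, one on each side. As a filter
  statement, the bounds for several points can be intersected.\<close>

lemma component_at_point_length:
  "\<forall>\<^sub>F l in at_right 0. \<forall>p q. component U p q \<and> c \<in> {p..q} \<longrightarrow> l \<le> q - p"
proof -
  have *: "\<forall>\<^sub>F l in at_right 0. \<forall>p q. component U p q \<and> R p q \<longrightarrow> l \<le> q - p"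
    if R: "\<And>p q p' q'. component U p q \<Longrightarrow> R p q \<Longrightarrow> component U p' q' \<Longrightarrow> R p' q' \<Longrightarrow> p = p' \<and> q = q'"
    for R
  proof (cases "\<exists>p q. component U p q \<and> R p q")
    case True
    then obtain p q where pq: "component U p q" "R p q" by blast
    hence "0 < q - p" unfolding component_def by auto
    hence "\<forall>\<^sub>F l in at_right 0. l \<in> {0<..<q - p}" by (rule eventually_at_right_real)
    thus ?thesis
    proof eventually_elim
      case (elim l)
      show ?case
      proof (intro allI impI)
        fix p' q' assume "component U p' q' \<and> R p' q'"
        hence "p = p' \<and> q = q'" using R pq by blast
        thus "l \<le> q' - p'" using elim by simp
      qed
    qed
  qed (auto intro!: always_eventually)
  have right: "p = p' \<and> q = q'" if "component U p q" "p < c \<and> c \<le> q" "component U p' q'" "p' < c \<and> c \<le> q'"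
    for p q p' q'
  proof -
    have "max p p' < c" using that by auto
    then obtain r where r: "max p p' < r" "r < c" using dense by blast
    thus ?thesis using component_eqI[OF that(1,3), of r] that r by auto
  qed
  have left: "p = p' \<and> q = q'" if "component U p q" "p \<le> c \<and> c < q" "component U p' q'" "p' \<le> c \<and> c < q'"
    for p q p' q'
  proof -
    have "c < min q q'" using that by auto
    then obtain r where r: "c < r" "r < min q q'" using dense by blast
    thus ?thesis using component_eqI[OF that(1,3), of r] that r by auto
  qed
  have "\<forall>\<^sub>F l in at_right 0. (\<forall>p q. component U p q \<and> (p < c \<and> c \<le> q) \<longrightarrow> l \<le> q - p) \<and>
      (\<forall>p q. component U p q \<and> (p \<le> c \<and> c < q) \<longrightarrow> l \<le> q - p)"
    using *[of "\<lambda>p q. p < c \<and> c \<le> q"] *[of "\<lambda>p q. p \<le> c \<and> c < q"] right left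
    by (intro eventually_conj) metis+
  thus ?thesis
  proof eventually_elim
    case (elim l)
    show ?case
    proof (intro allI impI)
      fix p q assume c: "component U p q \<and> c \<in> {p..q}"
      hence "p < q" unfolding component_def by auto
      hence "(p < c \<and> c \<le> q) \<or> (p \<le> c \<and> c < q)" using c by auto
      thus "l \<le> q - p" using elim c by blast
    qed
  qed
qed

lemma component_contains:
  assumes "component U p q" "{x..<y} \<subseteq> U" "r \<in> {p<..<q}" "r \<in> {x..<y}"
  shows "y - x \<le> q - p"
proof -
  have "q \<ge> y"
  proof (rule ccontr)
    assume "\<not> y \<le> q" hence "q \<in> {x..<y}" using assms(3,4) by auto
    thus False using assms(1,2) unfolding component_def by blast
  qed
  moreover have "p \<le> x"
  proof (rule ccontr)
    assume "\<not> p \<le> x"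
    then obtain v where "p - (p - x) < v" "v \<le> p" "v \<notin> U"
      using assms(1) unfolding component_def by (metis diff_gt_0_iff_gt not_le)
    moreover have "v \<in> {x..<y}" using calculation assms(3,4) by auto
    ultimately show False using assms(2) by blast
  qed
  ultimately show ?thesis by auto
qed

text \<open>Between two points outside \<open>U\<close>, both close to 0, lies a point of
  \<open>U\<close>; the component around it is trapped between them.\<close>

lemma small_component:
  assumes U: "\<And>t. t \<in> U \<Longrightarrow> \<exists>e>0. {t..<t+e} \<subseteq> U" and "e > 0"
    and U0: "\<And>e. e > 0 \<Longrightarrow> \<exists>s\<in>{0<..<e}. s \<in> U"
    and V0: "\<And>e. e > 0 \<Longrightarrow> \<exists>v\<in>{0<..<e}. v \<notin> U"
  shows "\<exists>p q. component U p q \<and> q - p < e"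
proof -
  obtain v2 where v2: "v2 \<in> {0<..<e}" "v2 \<notin> U" using V0 \<open>e > 0\<close> by blast
  obtain s where s: "s \<in> {0<..<v2}" "s \<in> U" using U0[of v2] v2 by auto
  obtain v1 where v1: "v1 \<in> {0<..<s}" "v1 \<notin> U" using V0[of s] s by auto
  define Q where "Q = {v. v > s \<and> v \<notin> U}"
  define P where "P = {v. v < s \<and> v \<notin> U}"
  define q where "q = Inf Q"
  define p where "p = Sup P"
  have Q: "v2 \<in> Q" "bdd_below Q" using v2 s unfolding Q_def by (auto intro: bdd_belowI[of _ s])
  have P: "v1 \<in> P" "bdd_above P" using v1 unfolding P_def by (auto intro: bdd_aboveI[of _ s])
  have "q \<le> v2" unfolding q_def using Q by (intro cInf_lower)
  have "v1 \<le> p" unfolding p_def using P by (intro cSup_upper)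
  have "p \<le> s" unfolding p_def using P by (intro cSup_least) (auto simp: P_def)
  have "s \<le> q" unfolding q_def using Q by (intro cInf_greatest) (auto simp: Q_def)
  have qU: "q \<notin> U"
  proof
    assume "q \<in> U"
    then obtain d where d: "d > 0" "{q..<q+d} \<subseteq> U" using U by blast
    have "\<exists>v\<in>Q. v < q + d" unfolding q_def using Q d cInf_lessD[of Q "Inf Q + d"] by auto
    then obtain v where "v \<in> Q" "v < q + d" by blast
    moreover have "q \<le> v" unfolding q_def using Q \<open>v \<in> Q\<close> by (intro cInf_lower)
    ultimately show False using d unfolding Q_def by auto
  qed
  hence "s < q" using \<open>s \<le> q\<close> s by (cases "s = q") auto
  have sub: "t \<in> U" if "t \<in> {p<..<q}" for t
  proof (rule ccontr)
    assume t: "t \<notin> U"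
    hence "t \<noteq> s" using s by auto
    hence "t \<in> P \<or> t \<in> Q" using t unfolding P_def Q_def by auto
    thus False using that cSup_upper[of t P] cInf_lower[of t Q] P Q unfolding p_def q_def by auto
  qed
  have "component U p q" unfolding component_def
  proof (intro conjI allI impI)
    fix d :: real assume "d > 0"
    hence "\<exists>v\<in>P. p - d < v" unfolding p_def using P less_cSup_iff[of P "Sup P - d"] by auto
    then obtain v where "v \<in> P" "p - d < v" by blast
    moreover have "v \<le> p" unfolding p_def using P \<open>v \<in> P\<close> by (intro cSup_upper)
    ultimately show "\<exists>v. p - d < v \<and> v \<le> p \<and> v \<notin> U" unfolding P_def by blast
  qed (use qU sub \<open>p \<le> s\<close> \<open>s < q\<close> in auto)
  thus ?thesis using \<open>q \<le> v2\<close> \<open>v1 \<le> p\<close> v1 v2 by (intro exI[of _ p] exI[of _ q]) auto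
qed

locale iet =
  fixes T :: "real \<Rightarrow> real" and I :: "'a::finite \<Rightarrow> real set"
  assumes iet: "interval_exchange T I"
begin

definition lend :: "'a \<Rightarrow> real" where "lend a = Inf (I a)"
definition rend :: "'a \<Rightarrow> real" where "rend a = Sup (I a)"
definition shift :: "'a \<Rightarrow> real" where "shift a = T (lend a) - lend a"
definition letter :: "real \<Rightarrow> 'a" where "letter t = (THE a. t \<in> I a)"
definition Tinv :: "real \<Rightarrow> real" where "Tinv = inv_into {0..<1} T"
text \<open>Every right end point belongs to this set (\<open>rend_special\<close>), so a closed
  interval in \<open>[0,1)\<close> that avoids it lies in the interior of one \<open>I a\<close>,
  where \<open>T\<close> is a translation.\<close>

definition special :: "real set" where "special = insert 1 (range lend)"
definition itinerary :: "nat \<Rightarrow> real \<Rightarrow> 'a list" where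
  "itinerary n t = map (\<lambda>i. letter ((T ^^ i) t)) [0..<n]"

lemma bij_T: "bij_betw T {0..<1} {0..<1}"
  and partition_I: "interval_partition I"
  and piecewise_T: "\<exists>\<delta>. \<forall>t\<in>I a. T t = t + \<delta>"
  using iet unfolding interval_exchange_def by auto

lemma lend_less_rend: "lend a < rend a" and I_eq: "I a = {lend a..<rend a}"
proof -
  obtain u v where "u < v" "I a = {u..<v}"
    using partition_I unfolding interval_partition_def by blast
  thus "lend a < rend a" "I a = {lend a..<rend a}" by (auto simp: lend_def rend_def)
qed

lemma I_iff: "t \<in> I a \<longleftrightarrow> lend a \<le> t \<and> t < rend a"
  using I_eq[of a] by auto

lemma lend_in: "lend a \<in> I a" using lend_less_rend[of a] by (simp add: I_iff)

lemma T_on_I: "t \<in> I a \<Longrightarrow> T t = t + shift a"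
  using piecewise_T[of a] lend_in[of a] unfolding shift_def by fastforce

lemma I_cover: "(\<Union>a. I a) = {0..<1}"
  using partition_I unfolding interval_partition_def by blast

lemma I_subset: "I a \<subseteq> {0..<1}" using I_cover by blast

lemma lend_nonneg: "0 \<le> lend a"
  using lend_in[of a] I_subset[of a] by auto

lemma rend_le_1: "rend a \<le> 1"
proof (rule ccontr)
  assume "\<not> rend a \<le> 1"
  hence "max 1 (lend a) \<in> I a" using lend_less_rend[of a] by (simp add: I_iff)
  thus False using I_subset[of a] by force
qed

lemma I_unique: "t \<in> I a \<Longrightarrow> t \<in> I b \<Longrightarrow> a = b"
  using partition_I unfolding interval_partition_def disjoint_family_on_def by blast

lemma letter_eq: "t \<in> I a \<Longrightarrow> letter t = a"
  unfolding letter_def using I_unique by blast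

lemma letter_in: "t \<in> {0..<1} \<Longrightarrow> t \<in> I (letter t)"
  using I_cover letter_eq by blast

lemma T_in: "t \<in> {0..<1} \<Longrightarrow> T t \<in> {0..<1}"
  using bij_T by (auto dest: bij_betwE)

lemma T_pow_in: "t \<in> {0..<1} \<Longrightarrow> (T ^^ n) t \<in> {0..<1}"
proof (induction n)
  case (Suc n) thus ?case using T_in[of "(T ^^ n) t"] by simp
qed auto

lemma T_inj: "s \<in> {0..<1} \<Longrightarrow> t \<in> {0..<1} \<Longrightarrow> T s = T t \<Longrightarrow> s = t"
  using bij_T by (auto simp: bij_betw_def dest: inj_onD)

lemma T_pow_inj: "s \<in> {0..<1} \<Longrightarrow> t \<in> {0..<1} \<Longrightarrow> (T ^^ n) s = (T ^^ n) t \<Longrightarrow> s = t"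
proof (induction n)
  case (Suc n) thus ?case using T_inj[of "(T ^^ n) s" "(T ^^ n) t"] T_pow_in by simp
qed auto

lemma Tinv_in: "t \<in> {0..<1} \<Longrightarrow> Tinv t \<in> {0..<1}"
  and T_Tinv: "t \<in> {0..<1} \<Longrightarrow> T (Tinv t) = t"
  unfolding Tinv_def using bij_T
  by (auto simp: bij_betw_def inv_into_into f_inv_into_f simp del: atLeastLessThan_iff)

lemma Tinv_T: "t \<in> {0..<1} \<Longrightarrow> Tinv (T t) = t"
  unfolding Tinv_def using bij_T by (auto simp: bij_betw_def simp del: atLeastLessThan_iff)

lemma image_I: "T ` I a = {T (lend a)..<T (lend a) + (rend a - lend a)}"
proof -
  have "T ` I a = (\<lambda>t. t + shift a) ` {lend a..<rend a}"
    using T_on_I I_eq[of a] by (intro image_cong) auto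
  also have "\<dots> = {lend a + shift a..<rend a + shift a}"
    by (rule image_add_atLeastLessThan')
  also have "\<dots> = {T (lend a)..<T (lend a) + (rend a - lend a)}"
    unfolding shift_def by (simp add: algebra_simps)
  finally show ?thesis .
qed

text \<open>Interpreting the locale at \<open>Tinv\<close> makes every result about forward iterates
  available for backward ones.\<close>

lemma inverse_exchange: "iet Tinv (\<lambda>a. T ` I a)"
proof
  have "bij_betw Tinv {0..<1} {0..<1}"
    unfolding Tinv_def using bij_T by (rule bij_betw_inv_into)
  moreover have "interval_partition (\<lambda>a. T ` I a)"
    unfolding interval_partition_def
  proof (intro conjI allI)
    fix a show "\<exists>u v. u < v \<and> T ` I a = {u..<v}"
      using image_I[of a] lend_less_rend[of a] by (metis diff_gt_0_iff_gt less_add_same_cancel1)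
    show "disjoint_family (\<lambda>a. T ` I a)"
      unfolding disjoint_family_on_def using T_inj I_unique I_subset by blast
    have "(\<Union>a. T ` I a) = T ` {0..<1}" using I_cover by blast
    thus "(\<Union>a. T ` I a) = {0..<1}" using bij_T by (simp add: bij_betw_def)
  qed
  moreover have "\<forall>t\<in>T ` I a. Tinv t = t + - shift a" for a
    using T_on_I Tinv_T I_subset by fastforce
  ultimately show "interval_exchange Tinv (\<lambda>a. T ` I a)"
    unfolding interval_exchange_def by blast
qed

lemma right_translation:
  assumes "t \<in> {0..<1}"
  shows "\<exists>e>0. t + e \<le> 1 \<and> (\<forall>s\<in>{t..<t+e}. (T ^^ n) s = (T ^^ n) t + (s - t))"
proof (induction n)
  case 0 show ?case using assms by (intro exI[of _ "1 - t"]) auto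
next
  case (Suc n)
  then obtain e where e: "e > 0" "t + e \<le> 1" "\<And>s. s \<in> {t..<t+e} \<Longrightarrow> (T ^^ n) s = (T ^^ n) t + (s - t)"
    by blast
  define a where "a = letter ((T ^^ n) t)"
  have a: "(T ^^ n) t \<in> I a" unfolding a_def using letter_in T_pow_in assms by blast
  define e' where "e' = min e (rend a - (T ^^ n) t)"
  have "e' > 0" using a e(1) unfolding e'_def I_iff by auto
  moreover have "(T ^^ Suc n) s = (T ^^ Suc n) t + (s - t)" if "s \<in> {t..<t+e'}" for s
  proof -
    have 1: "(T ^^ n) s = (T ^^ n) t + (s - t)" by (rule e(3)) (use that in \<open>auto simp: e'_def\<close>)
    hence "(T ^^ n) s \<in> I a" using a that unfolding I_iff e'_def by auto
    thus ?thesis using T_on_I a 1 by simp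
  qed
  moreover have "t + e' \<le> 1" using e(2) by (simp add: e'_def min_def)
  ultimately show ?case by blast
qed

lemma lend_0: "\<exists>a. lend a = 0"
proof -
  have "0 \<in> I (letter 0)" by (rule letter_in) auto
  thus ?thesis using lend_nonneg[of "letter 0"] I_eq[of "letter 0"] by (intro exI[of _ "letter 0"]) auto
qed

lemma rend_special: "rend a \<in> special"
proof (cases "rend a = 1")
  case False
  hence "rend a \<in> {0..<1}" using rend_le_1[of a] lend_less_rend[of a] lend_nonneg[of a] by auto
  then obtain b where b: "rend a \<in> I b" using letter_in by blast
  have "rend a = lend b"
  proof (rule ccontr)
    assume "rend a \<noteq> lend b"
    hence "lend b < rend a" "rend a < rend b" using b unfolding I_iff by auto
    hence "max (lend a) (lend b) \<in> I a \<inter> I b" using lend_less_rend[of a] by (auto simp: I_iff max_def)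
    thus False using I_unique \<open>rend a < rend b\<close> by blast
  qed
  thus ?thesis unfolding special_def by auto
qed (auto simp: special_def)

lemma no_special_translation:
  assumes "0 \<le> p" "p \<le> q" "q < 1" "special \<inter> {p..q} = {}"
  shows "\<exists>a. lend a < p \<and> q < rend a"
proof -
  define a where "a = letter p"
  have a: "p \<in> I a" unfolding a_def using letter_in assms by auto
  hence "lend a < p" using assms unfolding special_def I_iff
    by (metis Int_iff antisym_conv1 atLeastAtMost_iff atLeastLessThan_iff empty_iff insertI2 rangeI order_le_less)
  moreover have "q < rend a" using assms a rend_special[of a] unfolding I_iff
    by (metis Int_iff atLeastAtMost_iff atLeastLessThan_iff empty_iff leI order_less_imp_le)
  ultimately show ?thesis by blast
qed

lemma itinerary_0 [simp]: "itinerary 0 t = []" by (simp add: itinerary_def)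

lemma length_itinerary [simp]: "length (itinerary n t) = n" by (simp add: itinerary_def)

lemma itinerary_add: "itinerary (m + n) t = itinerary m t @ itinerary n ((T ^^ m) t)"
proof -
  have "[0..<m + n] = [0..<m] @ map (\<lambda>i. i + m) [0..<n]"
    using upt_add_eq_append[of 0 m n] map_add_upt[of m n] by (simp add: add.commute)
  thus ?thesis unfolding itinerary_def by (simp add: funpow_add)
qed

lemma itinerary_Suc: "itinerary (Suc n) t = letter t # itinerary n (T t)"
  using itinerary_add[of 1 n t] by (simp add: itinerary_def)

lemma take_itinerary: "m \<le> n \<Longrightarrow> take m (itinerary n t) = itinerary m t"
  unfolding itinerary_def by (simp add: take_map)

lemma special_component_length:
  "\<forall>\<^sub>F l in at_right 0. \<forall>p q. component U p q \<and> special \<inter> {p..q} \<noteq> {} \<longrightarrow> l \<le> q - p"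
proof -
  have "finite special" unfolding special_def by auto
  hence "\<forall>\<^sub>F l in at_right 0. \<forall>c\<in>special. \<forall>p q. component U p q \<and> c \<in> {p..q} \<longrightarrow> l \<le> q - p"
    by (intro eventually_ball_finite ballI component_at_point_length)
  thus ?thesis by eventually_elim blast
qed

text \<open>The whole closed interval has to avoid \<open>special\<close>: \<open>T\<close> must
  also translate \<open>q\<close> and a left neighbourhood of \<open>p\<close>, since these decide
  where the component ends.\<close>

lemma component_translate:
  assumes U: "U \<subseteq> {0..<1}" "\<And>t. t \<in> {0..<1} \<Longrightarrow> T t \<in> U \<longleftrightarrow> t \<in> U"
    and c: "component U p q" and s: "special \<inter> {p..q} = {}"
  shows "\<exists>d. component U (p + d) (q + d) \<and> (\<forall>t\<in>{p<..<q}. T t = t + d)"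
proof -
  have pq: "p < q" "{p<..<q} \<subseteq> U" using c unfolding component_def by auto
  have sub: "{p<..<q} \<subseteq> {0..<1}" using pq U by auto
  have "0 \<le> p" "q \<le> 1"
    using sub pq by (auto simp: greaterThanLessThan_subseteq_atLeastLessThan_iff)
  moreover have "q \<noteq> 1" using s pq unfolding special_def by auto
  ultimately obtain a where a: "lend a < p" "q < rend a"
    using no_special_translation[of p q] s pq by auto
  define d where "d = shift a"
  have tr: "T t = t + d" if "t \<in> {lend a..<rend a}" for t
    using T_on_I[of t a] that unfolding d_def I_iff by auto
  have inv: "t + d \<in> U \<longleftrightarrow> t \<in> U" if "t \<in> {lend a..<rend a}" for t
    using U(2)[of t] tr that I_subset[of a] I_eq[of a] by auto
  have "component U (p + d) (q + d)"
    unfolding component_def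
  proof (intro conjI allI impI subsetI)
    show "p + d < q + d" using pq by simp
    fix x assume "x \<in> {p + d<..<q + d}"
    hence "x - d \<in> {p<..<q}" by auto
    thus "x \<in> U" using inv[of "x - d"] pq a by auto
  next
    have "q \<notin> U" using c unfolding component_def by auto
    thus "q + d \<notin> U" using inv[of q] a pq by auto
  next
    fix e :: real assume "e > 0"
    hence "min e (p - lend a) > 0" using a by auto
    then obtain v where "p - min e (p - lend a) < v" "v \<le> p" "v \<notin> U"
      using c unfolding component_def by blast
    thus "\<exists>v. p + d - e < v \<and> v \<le> p + d \<and> v \<notin> U"
      using inv[of v] a pq by (intro exI[of _ "v + d"]) auto
  qed
  moreover have "\<forall>t\<in>{p<..<q}. T t = t + d" using tr a by auto
  ultimately show ?thesis by blast
qed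

lemma component_translate_pow:
  assumes U: "U \<subseteq> {0..<1}" "\<And>t. t \<in> {0..<1} \<Longrightarrow> T t \<in> U \<longleftrightarrow> t \<in> U"
    and c: "component U p q"
    and s: "\<And>p' q'. component U p' q' \<Longrightarrow> q' - p' = q - p \<Longrightarrow> special \<inter> {p'..q'} = {}"
  shows "\<exists>d. component U (p + d) (q + d) \<and> (\<forall>t\<in>{p<..<q}. (T ^^ n) t = t + d)"
proof (induction n)
  case 0 show ?case using c by (intro exI[of _ 0]) auto
next
  case (Suc n)
  then obtain d where d: "component U (p + d) (q + d)" "\<forall>t\<in>{p<..<q}. (T ^^ n) t = t + d" by blast
  have "special \<inter> {p + d..q + d} = {}" using s[OF d(1)] by simp
  then obtain d' where "component U (p + d + d') (q + d + d')" "\<forall>t\<in>{p+d<..<q+d}. T t = t + d'"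
    using component_translate[OF U d(1)] by blast
  thus ?case using d(2) by (intro exI[of _ "d + d'"]) (auto simp: add.assoc)
qed

text \<open>A sufficiently short component of \<open>U\<close> stays away from the special points, hence is
  translated by \<open>T\<close> and its inverse forever and never reaches \<open>{x..<y}\<close>.\<close>

lemma invariant_set_not_both_near_0:
  assumes U: "U \<subseteq> {0..<1}" "\<And>t. t \<in> {0..<1} \<Longrightarrow> T t \<in> U \<longleftrightarrow> t \<in> U"
    and rU: "\<And>t. t \<in> U \<Longrightarrow> \<exists>e>0. {t..<t+e} \<subseteq> U"
    and K: "x < y" "{x..<y} \<subseteq> U"
    and visit: "\<And>t. t \<in> U \<Longrightarrow> \<exists>n. (T ^^ n) t \<in> {x..<y} \<or> (Tinv ^^ n) t \<in> {x..<y}"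
    and U0: "\<And>e. e > 0 \<Longrightarrow> \<exists>s\<in>{0<..<e}. s \<in> U"
    and V0: "\<And>e. e > 0 \<Longrightarrow> \<exists>v\<in>{0<..<e}. v \<notin> U"
  shows False
proof -
  interpret inv: iet Tinv "\<lambda>a. T ` I a" by (rule inverse_exchange)
  have Uinv: "Tinv t \<in> U \<longleftrightarrow> t \<in> U" if "t \<in> {0..<1}" for t
    using U(2)[of "Tinv t"] T_Tinv[OF that] Tinv_in[OF that] by auto
  have "\<forall>\<^sub>F l in at_right 0. l \<in> {0<..<y - x}" using K by (intro eventually_at_right_real) auto
  with special_component_length[of U] inv.special_component_length[of U]
  have "\<forall>\<^sub>F l in at_right 0. l \<in> {0<..<y - x} \<and>
     (\<forall>p q. component U p q \<and> special \<inter> {p..q} \<noteq> {} \<longrightarrow> l \<le> q - p) \<and>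
     (\<forall>p q. component U p q \<and> inv.special \<inter> {p..q} \<noteq> {} \<longrightarrow> l \<le> q - p)"
    by eventually_elim blast
  from eventually_happens'[OF trivial_limit_at_right_real this]
  obtain l where "l \<in> {0<..<y - x}"
     and l3: "\<And>p q. component U p q \<Longrightarrow> special \<inter> {p..q} \<noteq> {} \<Longrightarrow> l \<le> q - p"
     and l4: "\<And>p q. component U p q \<Longrightarrow> inv.special \<inter> {p..q} \<noteq> {} \<Longrightarrow> l \<le> q - p"
    by blast
  hence l: "0 < l" "l < y - x" by auto
  obtain p q where pq: "component U p q" "q - p < l" using small_component[OF rU l(1) U0 V0] by blast
  define s where "s = (p + q) / 2"
  have s: "s \<in> {p<..<q}" "s \<in> U" using pq unfolding s_def component_def by auto
  obtain n where n: "(T ^^ n) s \<in> {x..<y} \<or> (Tinv ^^ n) s \<in> {x..<y}" using visit s by blast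
  have "special \<inter> {p'..q'} = {}" "inv.special \<inter> {p'..q'} = {}"
    if "component U p' q'" "q' - p' = q - p" for p' q'
    using l3[of p' q'] l4[of p' q'] that pq(2) by force+
  hence "\<exists>d. component U (p + d) (q + d) \<and> (\<forall>t\<in>{p<..<q}. (T ^^ n) t = t + d)"
    "\<exists>d. component U (p + d) (q + d) \<and> (\<forall>t\<in>{p<..<q}. (Tinv ^^ n) t = t + d)"
    using component_translate_pow[OF U pq(1)] inv.component_translate_pow[OF U(1) Uinv] pq(1)
    by blast+
  then obtain d where d: "component U (p + d) (q + d)" "s + d \<in> {x..<y}"
    using n s by metis
  have "y - x \<le> (q + d) - (p + d)"
    by (rule component_contains[OF d(1) K(2) _ d(2)]) (use s in auto)
  thus False using l pq by auto
qed

end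

text \<open>A substitute for being a finite union of intervals closed on the left and open on the
  right: it holds for these, survives Boolean operations, and is all that extending an interval to
  the right inside a set requires.\<close>

definition germ_decided :: "real set \<Rightarrow> bool" where
  "germ_decided D \<longleftrightarrow> (\<forall>t\<in>{0..<1}. \<exists>e>0. {t..<t+e} \<subseteq> D \<or> {t..<t+e} \<inter> D = {})"

lemma germ_decided_interval: "germ_decided {x..<y}"
  unfolding germ_decided_def
proof
  fix t :: real assume "t \<in> {0..<1}"
  show "\<exists>e>0. {t..<t+e} \<subseteq> {x..<y} \<or> {t..<t+e} \<inter> {x..<y} = {}"
  proof (cases "t < x")
    case True thus ?thesis by (intro exI[of _ "x - t"]) auto
  next
    case False thus ?thesis
      by (cases "t < y") (auto intro: exI[of _ "y - t"] exI[of _ 1])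
  qed
qed

lemma germ_decided_combine:
  assumes "germ_decided A" "germ_decided B" shows "germ_decided {t. f (t \<in> A) (t \<in> B)}"
  unfolding germ_decided_def
proof
  fix t :: real assume t: "t \<in> {0..<1}"
  obtain d where d: "d > 0" "{t..<t+d} \<subseteq> A \<or> {t..<t+d} \<inter> A = {}"
    using assms(1) t unfolding germ_decided_def by blast
  obtain e where e: "e > 0" "{t..<t+e} \<subseteq> B \<or> {t..<t+e} \<inter> B = {}"
    using assms(2) t unfolding germ_decided_def by blast
  let ?K = "{t..<t+min d e}"
  have "?K \<subseteq> {t..<t+d}" "?K \<subseteq> {t..<t+e}" by auto
  hence "(\<forall>s\<in>?K. s \<in> A) \<or> (\<forall>s\<in>?K. s \<notin> A)" "(\<forall>s\<in>?K. s \<in> B) \<or> (\<forall>s\<in>?K. s \<notin> B)"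
    using d(2) e(2) by blast+
  hence "?K \<subseteq> {t. f (t \<in> A) (t \<in> B)} \<or> ?K \<inter> {t. f (t \<in> A) (t \<in> B)} = {}"
    by (elim disjE) auto
  thus "\<exists>e>0. {t..<t+e} \<subseteq> {t. f (t \<in> A) (t \<in> B)} \<or> {t..<t+e} \<inter> {t. f (t \<in> A) (t \<in> B)} = {}"
    using d e by (intro exI[of _ "min d e"]) auto
qed

lemma germ_decided_Un: "germ_decided A \<Longrightarrow> germ_decided B \<Longrightarrow> germ_decided (A \<union> B)"
  and germ_decided_Diff: "germ_decided A \<Longrightarrow> germ_decided B \<Longrightarrow> germ_decided (A - B)"
  using germ_decided_combine[of A B "(\<or>)"] germ_decided_combine[of A B "\<lambda>x y. x \<and> \<not> y"]
  unfolding Un_def set_diff_eq by blast+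

lemma germ_decided_UN:
  "finite J \<Longrightarrow> (\<And>j. j \<in> J \<Longrightarrow> germ_decided (A j)) \<Longrightarrow> germ_decided (\<Union>j\<in>J. A j)"
proof (induction J rule: finite_induct)
  case empty show ?case unfolding germ_decided_def by (auto intro: exI[of _ 1])
next
  case (insert j J)
  have "(\<Union>i\<in>insert j J. A i) = A j \<union> (\<Union>i\<in>J. A i)" by auto
  thus ?case using insert germ_decided_Un[of "A j" "\<Union>i\<in>J. A i"] by simp
qed

section \<open>Periodicity on invariant sets that contain no left end point\<close>

context iet
begin

lemma same_itinerary_translation:
  assumes "s \<in> {0..<1}" "t \<in> {0..<1}" "itinerary n s = itinerary n t"
  shows "(T ^^ n) s = (T ^^ n) t + (s - t)"
  using assms(3)
proof (induction n)
  case (Suc n)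
  have "itinerary n s = itinerary n t" and l: "letter ((T ^^ n) s) = letter ((T ^^ n) t)"
    using Suc.prems by (auto simp: itinerary_def)
  hence *: "(T ^^ n) s = (T ^^ n) t + (s - t)" using Suc.IH by blast
  have "(T ^^ n) s \<in> I (letter ((T ^^ n) t))" "(T ^^ n) t \<in> I (letter ((T ^^ n) t))"
    using l letter_in[OF T_pow_in[OF assms(1), of n]] letter_in[OF T_pow_in[OF assms(2), of n]] by auto
  thus ?case using T_on_I * by simp
qed simp

text \<open>An interval inside \<open>D\<close> cannot straddle an end point of the partition,
  because that point would be a left end point in \<open>D\<close>. So \<open>T\<close> translates
  it, and invariance keeps the image in \<open>D\<close>.\<close>

lemma translation_avoiding_special:
  assumes D: "D \<subseteq> {0..<1}" "\<And>t. t \<in> {0..<1} \<Longrightarrow> T t \<in> D \<longleftrightarrow> t \<in> D" "D \<inter> range lend = {}"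
    and xy: "x < y" "{x..<y} \<subseteq> D"
  shows "(\<forall>s\<in>{x..<y}. (T ^^ n) s = (T ^^ n) x + (s - x)) \<and> {(T ^^ n) x..<(T ^^ n) x + (y - x)} \<subseteq> D"
proof (induction n)
  case 0 show ?case using xy by auto
next
  case (Suc n)
  define z where "z = (T ^^ n) x"
  define w where "w = z + (y - x)"
  have zw: "{z..<w} \<subseteq> D" "z < w"
    using conjunct2[OF Suc.IH] xy(1) unfolding z_def w_def by (blast, simp)
  have "z \<in> {z..<w}" using zw(2) by simp
  hence z: "z \<in> {0..<1}" using D(1) zw(1) by blast
  define a where "a = letter z"
  have za: "z \<in> I a" unfolding a_def using letter_in z by blast
  have "w \<le> rend a"
  proof (rule ccontr)
    assume "\<not> w \<le> rend a"
    hence "rend a \<in> D" using zw za by (auto simp: I_iff)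
    thus False using rend_special[of a] D(1,3) unfolding special_def by auto
  qed
  have tr: "T s = T z + (s - z)" "s \<in> {0..<1}" if "s \<in> {z..<w}" for s
  proof -
    have "s \<in> I a" using that za \<open>w \<le> rend a\<close> by (auto simp: I_iff)
    thus "T s = T z + (s - z)" "s \<in> {0..<1}" using T_on_I[of s a] T_on_I[of z a] za I_subset[of a] by (simp, blast)
  qed
  have "(T ^^ Suc n) s = (T ^^ Suc n) x + (s - x)" if "s \<in> {x..<y}" for s
  proof -
    have "(T ^^ n) s = z + (s - x)" using Suc.IH that unfolding z_def by blast
    thus ?thesis using tr(1)[of "z + (s - x)"] that by (auto simp: w_def z_def)
  qed
  moreover have "s \<in> D" if "s \<in> {T z..<T z + (y - x)}" for s
  proof -
    define r where "r = s - T z + z"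
    have 1: "r \<in> {z..<w}" using that unfolding w_def r_def by simp
    have "T r = s" using tr(1)[OF 1] unfolding r_def by simp
    thus ?thesis using D(2)[OF tr(2)[OF 1]] 1 zw(1) by blast
  qed
  moreover have "T z = (T ^^ Suc n) x" unfolding z_def by simp
  ultimately show ?case by (metis subsetI)
qed

text \<open>Pigeonhole for the cells of length \<open>r\<close>.\<close>

lemma close_orbit_points:
  assumes "t \<in> {0..<1}" "r > 0"
  shows "\<exists>i j. i < j \<and> \<bar>(T ^^ j) t - (T ^^ i) t\<bar> < r"
proof -
  define g where "g i = nat \<lfloor>(T ^^ i) t / r\<rfloor>" for i
  have g: "real (g i) \<le> (T ^^ i) t / r \<and> (T ^^ i) t / r < real (g i) + 1" for i
  proof -
    have "0 \<le> (T ^^ i) t / r" using T_pow_in[OF assms(1), of i] assms(2) by auto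
    thus ?thesis unfolding g_def by linarith
  qed
  have "range g \<subseteq> {..nat \<lceil>1 / r\<rceil>}"
  proof (clarsimp)
    fix i
    have "(T ^^ i) t / r \<le> 1 / r" using T_pow_in[OF assms(1), of i] assms(2) by (auto intro: divide_right_mono)
    hence "real (g i) \<le> 1 / r" using g[of i] by linarith
    thus "g i \<le> nat \<lceil>1 / r\<rceil>" by linarith
  qed
  hence "\<not> inj g" using finite_subset finite_imageD[of g UNIV] by (metis finite_atMost infinite_UNIV_nat)
  then obtain i j where "i < j" "g i = g j" unfolding inj_def by (metis linorder_neq_iff)
  hence "\<bar>(T ^^ j) t / r - (T ^^ i) t / r\<bar> < 1" using g[of i] g[of j] by linarith
  hence "\<bar>((T ^^ j) t - (T ^^ i) t) / r\<bar> < 1" by (simp add: diff_divide_distrib)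
  hence "\<bar>(T ^^ j) t - (T ^^ i) t\<bar> < r" using assms(2) by (simp add: abs_divide)
  thus ?thesis using \<open>i < j\<close> by blast
qed

text \<open>Extend \<open>t\<close> to the longest interval \<open>[t,y)\<close> inside
  \<open>D\<close>; all iterates translate it. Two orbit points closer than its length
  \<open>r\<close> give some \<open>q\<close> with \<open>T^q t = t + d\<close> and
  \<open>|d| < r\<close>. For positive \<open>d\<close> the image of \<open>[t,y)\<close> would
  cover \<open>y\<close>; for negative \<open>d\<close> the images would carry \<open>D\<close>
  below 0. So \<open>d = 0\<close>.\<close>

lemma periodic_avoiding_special:
  assumes D: "D \<subseteq> {0..<1}" "\<And>t. t \<in> {0..<1} \<Longrightarrow> T t \<in> D \<longleftrightarrow> t \<in> D" "D \<inter> range lend = {}"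
    and g: "germ_decided D" and t: "t \<in> D"
  shows "\<exists>q>0. \<exists>e>0. \<forall>s\<in>{t..<t+e}. (T ^^ q) s = s"
proof -
  have t01: "t \<in> {0..<1}" using t D by auto
  define Y where "Y = {y. y > t \<and> {t..<y} \<subseteq> D}"
  define y where "y = Sup Y"
  have open_right: "\<exists>e>0. {s..<s+e} \<subseteq> D" if "s \<in> D" for s
  proof -
    have "s \<in> {0..<1}" using that D(1) by blast
    then obtain e where e: "e > 0" "{s..<s+e} \<subseteq> D \<or> {s..<s+e} \<inter> D = {}"
      using g unfolding germ_decided_def by meson
    moreover have "s \<in> {s..<s+e} \<inter> D" using e that by auto
    ultimately show ?thesis by blast
  qed
  obtain e0 where e0: "e0 > 0" "{t..<t+e0} \<subseteq> D" using open_right t by blast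
  have Y1: "t + e0 \<in> Y" using e0 unfolding Y_def by auto
  have Y2: "bdd_above Y"
  proof (rule bdd_aboveI[of _ 1])
    fix y assume "y \<in> Y"
    hence "t < y" "{t..<y} \<subseteq> {0..<1}" using D(1) unfolding Y_def by blast+
    thus "y \<le> 1" by simp
  qed
  have "t + e0 \<le> y" unfolding y_def using Y1 Y2 by (rule cSup_upper)
  hence ty: "t < y" using e0 by simp
  have sub: "{t..<y} \<subseteq> D"
  proof
    fix s assume s: "s \<in> {t..<y}"
    have "\<exists>y'\<in>Y. s < y'" using s Y1 Y2 less_cSup_iff[of Y s] by (auto simp: y_def)
    thus "s \<in> D" using s unfolding Y_def by auto
  qed
  have yD: "y \<notin> D"
  proof
    assume "y \<in> D"
    then obtain e where e: "e > 0" "{y..<y+e} \<subseteq> D" using open_right by blast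
    have "{t..<y+e} \<subseteq> {t..<y} \<union> {y..<y+e}" by auto
    hence "y + e \<in> Y" using e sub ty unfolding Y_def by auto
    hence "y + e \<le> y" unfolding y_def using Y2 by (intro cSup_upper)
    thus False using e by simp
  qed
  define r where "r = y - t"
  have "r > 0" using ty unfolding r_def by simp
  have A: "(\<forall>s\<in>{x..<y}. (T ^^ n) s = (T ^^ n) x + (s - x)) \<and> {(T ^^ n) x..<(T ^^ n) x + (y - x)} \<subseteq> D"
    if "x < y" "{x..<y} \<subseteq> D" for x y n
    using translation_avoiding_special[OF D that] .
  obtain i j where ij: "i < j" "\<bar>(T ^^ j) t - (T ^^ i) t\<bar> < r" using close_orbit_points[OF t01 \<open>r > 0\<close>] by blast
  define q where "q = j - i"
  define d where "d = (T ^^ j) t - (T ^^ i) t"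
  have jq: "(T ^^ j) s = (T ^^ i) ((T ^^ q) s)" for s
    using ij(1) by (simp add: q_def flip: funpow_add o_apply[of "T ^^ i"])
  \<comment> \<open>Injectivity of \<open>T^i\<close> cancels the first \<open>i\<close> steps. For
    negative \<open>d\<close> the point \<open>t - d\<close> of \<open>[t,y)\<close> takes the place
    of \<open>t\<close>: it is the one that \<open>T^q\<close> sends to \<open>t\<close>.\<close>
  have q: "(T ^^ q) t = t + d"
  proof (cases "d \<ge> 0")
    case True
    hence td: "t + d \<in> {t..<y}" using ij(2) unfolding d_def r_def by auto
    have "(T ^^ i) (t + d) = (T ^^ i) t + (t + d - t)"
      using conjunct1[OF A[OF ty sub]] td by blast
    hence "(T ^^ i) (t + d) = (T ^^ i) ((T ^^ q) t)" using jq[of t] unfolding d_def by simp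
    moreover have "t + d \<in> {0..<1}" using td sub D(1) by blast
    ultimately have "t + d = (T ^^ q) t" using T_pow_inj T_pow_in[OF t01, of q] by blast
    thus ?thesis by simp
  next
    case False
    hence td: "t - d \<in> {t..<y}" using ij(2) unfolding d_def r_def by auto
    hence td1: "t - d \<in> {0..<1}" using sub D(1) by blast
    have "(T ^^ j) (t - d) = (T ^^ j) t + (t - d - t)"
      using conjunct1[OF A[OF ty sub]] td by blast
    hence "(T ^^ i) ((T ^^ q) (t - d)) = (T ^^ i) t" using jq[of "t - d"] unfolding d_def by simp
    hence "(T ^^ q) (t - d) = t" using T_pow_inj[of _ t i] T_pow_in[OF td1] t01 by blast
    moreover have "(T ^^ q) (t - d) = (T ^^ q) t + (t - d - t)"
      using conjunct1[OF A[OF ty sub]] td by blast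
    ultimately show ?thesis by simp
  qed
  have "\<not> d > 0"
  proof
    assume "d > 0"
    have "{t + d..<t + d + (y - t)} \<subseteq> D" using conjunct2[OF A[OF ty sub, of q]] unfolding q .
    moreover have "y \<in> {t + d..<t + d + (y - t)}" using ij(2) \<open>d > 0\<close> unfolding d_def r_def by auto
    ultimately show False using yD by blast
  qed
  moreover have "\<not> d < 0"
  proof
    assume "d < 0"
    \<comment> \<open>Each application of \<open>T^q\<close> adds a piece on the left:
      \<open>[x,y)\<close> moves to \<open>[x + d,y + d)\<close>, and the two overlap because
      \<open>|d| < r\<close>.\<close>
    have *: "{t + real k * d..<y} \<subseteq> D" for k
    proof (induction k)
      case (Suc k)
      define x where "x = t + real k * d"
      have x: "x \<le> t" using \<open>d < 0\<close> unfolding x_def by (simp add: mult_nonneg_nonpos)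
      hence "x < y" using ty by simp
      have sx: "{x..<y} \<subseteq> D" using Suc x_def by simp
      have "t \<in> {x..<y}" using x ty by simp
      hence "(T ^^ q) t = (T ^^ q) x + (t - x)" using conjunct1[OF A[OF \<open>x < y\<close> sx]] by blast
      hence "(T ^^ q) x = x + d" using q by simp
      hence "{x + d..<x + d + (y - x)} \<subseteq> D" using conjunct2[OF A[OF \<open>x < y\<close> sx, of q]] by simp
      moreover have "x \<le> x + d + (y - x)" using ij(2) x unfolding d_def r_def by auto
      hence "{x + d..<y} \<subseteq> {x + d..<x + d + (y - x)} \<union> {x..<y}" by auto
      ultimately have "{x + d..<y} \<subseteq> D" using sx by blast
      thus ?case by (simp add: x_def algebra_simps)
    qed (use sub in simp)
    obtain k where k: "t / (- d) < real k" using reals_Archimedean2 by blast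
    hence "t + real k * d < 0" using \<open>d < 0\<close> by (simp add: field_simps)
    moreover have "t \<ge> 0" using t01 by simp
    ultimately have "t + real k * d \<in> {t + real k * d..<y}" using ty by simp
    hence "t + real k * d \<in> D" using *[of k] by blast
    thus False using \<open>t + real k * d < 0\<close> D(1) by auto
  qed
  ultimately have d0: "d = 0" by simp
  have "(T ^^ q) s = s" if "s \<in> {t..<t + r}" for s
  proof -
    have "(T ^^ q) s = (T ^^ q) t + (s - t)"
      by (rule bspec[OF conjunct1[OF A[OF ty sub]]]) (use that r_def in simp)
    also have "\<dots> = s" unfolding q d0 by simp
    finally show ?thesis .
  qed
  moreover have "q > 0" using ij(1) unfolding q_def by simp
  ultimately show ?thesis using \<open>r > 0\<close> by blast
qed

lemma left_translation:
  assumes "t \<in> {0..<1}" "\<And>i. i < n \<Longrightarrow> (T ^^ i) t \<notin> range lend"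
  shows "\<exists>e>0. \<forall>s\<in>{t - e<..t}. (T ^^ n) s = (T ^^ n) t + (s - t)"
  using assms(2)
proof (induction n)
  case 0 show ?case by (intro exI[of _ 1]) auto
next
  case (Suc n)
  then obtain e where e: "e > 0" "\<And>s. s \<in> {t - e<..t} \<Longrightarrow> (T ^^ n) s = (T ^^ n) t + (s - t)"
    by (metis less_Suc_eq)
  define z where "z = (T ^^ n) t"
  define a where "a = letter z"
  have za: "z \<in> I a" unfolding z_def a_def using letter_in T_pow_in assms by blast
  moreover have "z \<noteq> lend a" using Suc.prems[of n] unfolding z_def by blast
  ultimately have "lend a < z" by (auto simp: I_iff)
  define e' where "e' = min e (z - lend a)"
  have "(T ^^ Suc n) s = (T ^^ Suc n) t + (s - t)" if "s \<in> {t - e'<..t}" for s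
  proof -
    have 1: "(T ^^ n) s = z + (s - t)" unfolding z_def by (rule e(2)) (use that in \<open>auto simp: e'_def\<close>)
    hence "(T ^^ n) s \<in> I a" using za that by (auto simp: I_iff e'_def)
    thus ?thesis using T_on_I za 1 unfolding z_def by simp
  qed
  moreover have "e' > 0" using e(1) \<open>lend a < z\<close> unfolding e'_def by simp
  ultimately show ?case by blast
qed

text \<open>Let \<open>s\<close> be the infimum of the points down to which \<open>T^q\<close> is
  the identity. If the first \<open>q\<close> iterates of \<open>s\<close> avoided all left end
  points, \<open>T^q\<close> would be a translation on a left neighbourhood of \<open>s\<close> as
  well, and the identity would continue beyond \<open>s\<close>. So the orbit of \<open>s\<close>
  passes through a left end point, which is then periodic.\<close>

lemma extend_periodic_left:
  assumes t: "t \<in> {0..<1}" and q: "q > 0" "(T ^^ q) t = t"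
  shows "\<exists>s\<in>{0..t}. (\<forall>r\<in>{s..t}. (T ^^ q) r = r) \<and>
           (\<exists>b j. s = (T ^^ j) (lend b) \<and> (T ^^ q) (lend b) = lend b)"
proof -
  define A where "A = {s\<in>{0..t}. \<forall>r\<in>{s..t}. (T ^^ q) r = r}"
  define s where "s = Inf A"
  have tA: "t \<in> A" using t q unfolding A_def by auto
  have bA: "bdd_below A" unfolding A_def by (intro bdd_belowI[of _ 0]) auto
  have st: "s \<le> t" unfolding s_def using tA bA by (rule cInf_lower)
  have s0: "0 \<le> s" unfolding s_def using tA by (intro cInf_greatest) (auto simp: A_def)
  have s01: "s \<in> {0..<1}" using s0 st t by auto
  have above: "(T ^^ q) r = r" if "s < r" "r \<le> t" for r
  proof -
    obtain s' where "s' \<in> A" "s' < r" using \<open>s < r\<close> tA bA cInf_less_iff[of A r] unfolding s_def by auto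
    thus ?thesis using that unfolding A_def by auto
  qed
  have sfix: "(T ^^ q) s = s"
  proof (cases "s = t")
    case False
    obtain e where e: "e > 0" "\<And>r. r \<in> {s..<s+e} \<Longrightarrow> (T ^^ q) r = (T ^^ q) s + (r - s)"
      using right_translation[OF s01] by blast
    have "s < min t (s + e)" using st False e(1) by simp
    then obtain r where r: "s < r" "r < min t (s + e)" using dense by blast
    thus ?thesis using e(2)[of r] above[of r] by auto
  qed (use q in simp)
  have sA: "\<forall>r\<in>{s..t}. (T ^^ q) r = r" using sfix above by force
  have "\<exists>i<q. (T ^^ i) s \<in> range lend"
  proof (rule ccontr)
    assume n: "\<not> ?thesis"
    then obtain e where e: "e > 0" "\<And>r. r \<in> {s - e<..s} \<Longrightarrow> (T ^^ q) r = (T ^^ q) s + (r - s)"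
      using left_translation[OF s01, of q] by blast
    have "s \<noteq> 0" using n q lend_0 by force
    define s' where "s' = max 0 (s - e / 2)"
    have s': "s' < s" "s' \<ge> 0" "s - e < s'" using e(1) \<open>s \<noteq> 0\<close> s0 unfolding s'_def by auto
    have "(T ^^ q) r = r" if "r \<in> {s'..t}" for r
      using e(2)[of r] sA that s' sfix by (cases "r \<le> s") auto
    hence "s' \<in> A" unfolding A_def using s' st by auto
    hence "s \<le> s'" unfolding s_def using bA by (intro cInf_lower)
    thus False using s' by simp
  qed
  then obtain i b where i: "i < q" "(T ^^ i) s = lend b" by auto
  have "(T ^^ q) (lend b) = (T ^^ i) ((T ^^ q) s)"
    unfolding i(2)[symmetric] by (simp add: add.commute flip: funpow_add o_apply[of "T ^^ _"])
  hence "(T ^^ q) (lend b) = lend b" using sfix i by simp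
  moreover have "s = (T ^^ (q - i)) (lend b)"
    using sfix i(1) unfolding i(2)[symmetric] by (simp flip: funpow_add o_apply[of "T ^^ _"])
  ultimately show ?thesis using sA s0 st by (intro bexI[of _ s]) auto
qed

end

section \<open>Self-similarity and minimality\<close>

definition subst_word :: "('a \<Rightarrow> 'a list) \<Rightarrow> 'a list \<Rightarrow> 'a list" where
  "subst_word \<sigma> w = concat (map \<sigma> w)"

lemma subst_word_simps [simp]:
  "subst_word \<sigma> [] = []"
  "subst_word \<sigma> (a # w) = \<sigma> a @ subst_word \<sigma> w"
  "subst_word \<sigma> (v @ w) = subst_word \<sigma> v @ subst_word \<sigma> w"
  by (auto simp: subst_word_def)

lemma subst_pow_append [simp]:
  "(subst_word \<sigma> ^^ n) (v @ w) = (subst_word \<sigma> ^^ n) v @ (subst_word \<sigma> ^^ n) w"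
  by (induction n) auto

lemma subst_pow_Nil [simp]: "(subst_word \<sigma> ^^ n) [] = []"
  by (induction n) auto

lemma subst_pow_Cons: "(subst_word \<sigma> ^^ n) (a # w) = (subst_word \<sigma> ^^ n) [a] @ (subst_word \<sigma> ^^ n) w"
  using subst_pow_append[of n \<sigma> "[a]" w] by simp

lemma subst_pow_Suc: "(subst_word \<sigma> ^^ Suc n) w = (subst_word \<sigma> ^^ n) (subst_word \<sigma> w)"
  by (simp add: funpow_swap1)

locale self_similar_iet = iet T I for T :: "real \<Rightarrow> real" and I :: "'a::finite \<Rightarrow> real set" +
  fixes \<alpha> :: real and \<sigma> :: "'a \<Rightarrow> 'a list"
  assumes self_sim: "self_similar T \<alpha>" and assoc_subst: "associated_substitution T I \<alpha> \<sigma>"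
begin

abbreviation "sub \<equiv> subst_word \<sigma>"

lemma alpha: "0 < \<alpha>" "\<alpha> < 1"
  and returns: "t \<in> {0..<\<alpha>} \<Longrightarrow> \<exists>n>0. (T ^^ n) t \<in> {0..<\<alpha>}"
  and first_return: "t \<in> {0..<1} \<Longrightarrow> first_return_map T \<alpha> (\<alpha> * t) = \<alpha> * T t"
  using self_sim unfolding self_similar_def by auto

lemma return_time: "t \<in> I a \<Longrightarrow> first_return_time T \<alpha> (\<alpha> * t) = length (\<sigma> a)"
  and return_letters: "t \<in> I a \<Longrightarrow> m < length (\<sigma> a) \<Longrightarrow> (T ^^ m) (\<alpha> * t) \<in> I (\<sigma> a ! m)"
  using assoc_subst unfolding associated_substitution_def by blast+

lemma scale_in: "t \<in> {0..<1} \<Longrightarrow> \<alpha> ^ n * t \<in> {0..<\<alpha> ^ n}"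
  using alpha by (auto simp: mult_less_cancel_left1)

lemma power_alpha_le_1: "\<alpha> ^ n \<le> 1"
  using alpha by (simp add: power_le_one)

lemma scale_in_unit: "t \<in> {0..<1} \<Longrightarrow> \<alpha> ^ n * t \<in> {0..<1}"
  using scale_in[of t n] power_alpha_le_1[of n] by auto

lemma scale1: "t \<in> {0..<1} \<Longrightarrow> \<alpha> * t \<in> {0..<\<alpha>}" "t \<in> {0..<1} \<Longrightarrow> \<alpha> * t \<in> {0..<1}"
  using scale_in[of t 1] scale_in_unit[of t 1] by auto

lemma first_return_properties:
  assumes "t \<in> I a"
  shows "0 < length (\<sigma> a)" "(T ^^ length (\<sigma> a)) (\<alpha> * t) = \<alpha> * T t"
    "0 < m \<Longrightarrow> (T ^^ m) (\<alpha> * t) \<in> {0..<\<alpha>} \<Longrightarrow> length (\<sigma> a) \<le> m"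
proof -
  have t: "t \<in> {0..<1}" using assms I_subset by blast
  let ?P = "\<lambda>n. 0 < n \<and> (T ^^ n) (\<alpha> * t) \<in> {0..<\<alpha>}"
  have L: "length (\<sigma> a) = (LEAST n. ?P n)"
    using return_time[OF assms] unfolding first_return_time_def by simp
  have "\<exists>n. ?P n" using returns scale1 t by blast
  hence "?P (length (\<sigma> a))" unfolding L by (rule LeastI_ex)
  thus "0 < length (\<sigma> a)" by blast
  show "(T ^^ length (\<sigma> a)) (\<alpha> * t) = \<alpha> * T t"
    using first_return[OF t] return_time[OF assms] unfolding first_return_map_def by simp
  show "0 < m \<Longrightarrow> (T ^^ m) (\<alpha> * t) \<in> {0..<\<alpha>} \<Longrightarrow> length (\<sigma> a) \<le> m"
    unfolding L by (rule Least_le) blast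
qed

lemma sigma_nonempty: "\<sigma> a \<noteq> []"
  using first_return_properties(1)[OF lend_in] by auto

lemma length_sub_ge: "length w \<le> length (sub w)"
proof (induction w)
  case (Cons a w)
  have "length (\<sigma> a) > 0" using sigma_nonempty by blast
  thus ?case using Cons by (simp del: length_greater_0_conv)
qed simp

lemma length_sub_pow_ge: "length w \<le> length ((sub ^^ n) w)"
  by (induction n) (auto intro: le_trans length_sub_ge)

lemma itinerary_scaled_letter:
  assumes "t \<in> I a"
  shows "itinerary (length (\<sigma> a)) (\<alpha> * t) = \<sigma> a"
proof (rule nth_equalityI)
  fix i assume "i < length (itinerary (length (\<sigma> a)) (\<alpha> * t))"
  hence i: "i < length (\<sigma> a)" by simp
  have "letter ((T ^^ i) (\<alpha> * t)) = \<sigma> a ! i" by (rule letter_eq[OF return_letters[OF assms i]])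
  thus "itinerary (length (\<sigma> a)) (\<alpha> * t) ! i = \<sigma> a ! i" using i by (simp add: itinerary_def)
qed simp

lemma scaled_itinerary_1:
  assumes "t \<in> {0..<1}"
  shows "itinerary (length (sub (itinerary i t))) (\<alpha> * t) = sub (itinerary i t) \<and>
    (T ^^ length (sub (itinerary i t))) (\<alpha> * t) = \<alpha> * (T ^^ i) t"
  using assms
proof (induction i arbitrary: t)
  case (Suc i)
  define a where "a = letter t"
  have a: "t \<in> I a" unfolding a_def using Suc.prems by (rule letter_in)
  have T1: "T t \<in> {0..<1}" using Suc.prems by (rule T_in)
  let ?w = "sub (itinerary i (T t))"
  have w: "sub (itinerary (Suc i) t) = \<sigma> a @ ?w" by (simp add: itinerary_Suc a_def)
  have "(T ^^ length (\<sigma> a)) (\<alpha> * t) = \<alpha> * T t" by (rule first_return_properties(2)[OF a])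
  moreover have "(T ^^ (length (\<sigma> a) + length ?w)) x = (T ^^ length ?w) ((T ^^ length (\<sigma> a)) x)" for x
    by (simp add: add.commute[of "length (\<sigma> a)"] funpow_add)
  moreover have "(T ^^ Suc i) t = (T ^^ i) (T t)" by (simp add: funpow_swap1)
  ultimately show ?case unfolding w length_append itinerary_add
    using Suc.IH[OF T1] itinerary_scaled_letter[OF a] by simp
qed simp

text \<open>Renormalization to depth \<open>n\<close>: by induction the point
  \<open>\<alpha> ^ n * t\<close> reads the word \<open>(sub ^^ n) (itinerary i t)\<close>, and
  \<open>scaled_itinerary_1\<close> at that point adds one more application of
  \<open>sub\<close>.\<close>

lemma scaled_itinerary:
  assumes "t \<in> {0..<1}"
  shows "itinerary (length ((sub ^^ n) (itinerary i t))) (\<alpha> ^ n * t) = (sub ^^ n) (itinerary i t) \<and>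
    (T ^^ length ((sub ^^ n) (itinerary i t))) (\<alpha> ^ n * t) = \<alpha> ^ n * (T ^^ i) t"
proof (induction n)
  case (Suc n)
  let ?w = "(sub ^^ n) (itinerary i t)"
  show ?case using scaled_itinerary_1[OF scale_in_unit[OF assms, of n], of "length ?w"] Suc
    by (simp add: mult.assoc)
qed simp

lemmas scaled_itinerary_pow = conjunct2[OF scaled_itinerary]

lemma itinerary_1: "t \<in> I a \<Longrightarrow> itinerary (Suc 0) t = [a]"
  using letter_eq by (simp add: itinerary_def)

lemma tower_itinerary:
  assumes "t \<in> I a"
  shows "itinerary (length ((sub ^^ n) [a])) (\<alpha> ^ n * t) = (sub ^^ n) [a]"
    "(T ^^ length ((sub ^^ n) [a])) (\<alpha> ^ n * t) = \<alpha> ^ n * T t"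
proof -
  have "t \<in> {0..<1}" using assms I_subset by blast
  from scaled_itinerary[OF this, of n 1]
  show "itinerary (length ((sub ^^ n) [a])) (\<alpha> ^ n * t) = (sub ^^ n) [a]"
    "(T ^^ length ((sub ^^ n) [a])) (\<alpha> ^ n * t) = \<alpha> ^ n * T t" using itinerary_1[OF assms] by auto
qed

text \<open>A converse to \<open>scaled_itinerary_1\<close>: each visit to
  \<open>[0,\<alpha>)\<close> is a succession of first returns, so splitting off the first one
  decreases \<open>m\<close>.\<close>

lemma return_is_iterate_1:
  assumes "t \<in> {0..<1}" "(T ^^ m) (\<alpha> * t) \<in> {0..<\<alpha>}"
  shows "\<exists>i. m = length (sub (itinerary i t))"
  using assms
proof (induction m arbitrary: t rule: less_induct)
  case (less m)
  show ?case
  proof (cases "m = 0")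
    case True thus ?thesis by (intro exI[of _ 0]) simp
  next
    case False
    define a where "a = letter t"
    define l where "l = length (\<sigma> a)"
    have a: "t \<in> I a" unfolding a_def using less.prems(1) by (rule letter_in)
    have l: "0 < l" "l \<le> m" "(T ^^ l) (\<alpha> * t) = \<alpha> * T t"
      using first_return_properties[OF a] less.prems False unfolding l_def by auto
    have "(T ^^ m) (\<alpha> * t) = (T ^^ (m - l)) ((T ^^ l) (\<alpha> * t))"
      using l(2) funpow_add[of "m - l" l T] by simp
    hence "(T ^^ (m - l)) (\<alpha> * T t) \<in> {0..<\<alpha>}" using less.prems(2) l(3) by simp
    moreover have "m - l < m" using l by simp
    ultimately obtain i where "m - l = length (sub (itinerary i (T t)))"
      using less.IH T_in[OF less.prems(1)] by blast
    hence "m = length (sub (itinerary (Suc i) t))"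
      using l by (simp add: itinerary_Suc l_def a_def)
    thus ?thesis by blast
  qed
qed

lemma return_is_iterate:
  assumes "t \<in> {0..<1}" "(T ^^ m) (\<alpha> ^ n * t) \<in> {0..<\<alpha> ^ n}"
  shows "\<exists>i. m = length ((sub ^^ n) (itinerary i t))"
  using assms
proof (induction n arbitrary: t)
  case 0 show ?case by (intro exI[of _ m]) simp
next
  case (Suc n)
  have at: "\<alpha> * t \<in> {0..<1}" using Suc.prems scale1 by blast
  have "\<alpha> ^ Suc n \<le> \<alpha> ^ n" using alpha by (simp add: mult_le_cancel_right1)
  hence "(T ^^ m) (\<alpha> ^ n * (\<alpha> * t)) \<in> {0..<\<alpha> ^ n}" using Suc.prems(2) by (auto simp: mult.assoc mult.left_commute)
  then obtain i where i: "m = length ((sub ^^ n) (itinerary i (\<alpha> * t)))" using Suc.IH[OF at] by blast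
  have "\<alpha> ^ n * (T ^^ i) (\<alpha> * t) \<in> {0..<\<alpha> ^ Suc n}"
    using Suc.prems(2) scaled_itinerary_pow[OF at, of n i] unfolding i by (simp add: mult.assoc mult.left_commute)
  hence "\<alpha> ^ n * (T ^^ i) (\<alpha> * t) < \<alpha> ^ n * \<alpha>" by (simp add: mult.commute)
  hence "(T ^^ i) (\<alpha> * t) \<in> {0..<\<alpha>}" using T_pow_in[OF at, of i] alpha by (simp add: mult_less_cancel_left)
  then obtain j where "i = length (sub (itinerary j t))" using return_is_iterate_1 Suc.prems(1) by blast
  hence "m = length ((sub ^^ Suc n) (itinerary j t))"
    using i scaled_itinerary_1[OF Suc.prems(1), of j] by (simp only: subst_pow_Suc)
  thus ?case by blast
qed

section \<open>Orbits of the intervals \<open>[0,\<alpha>^n)\<close>\<close>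

definition reach :: "nat \<Rightarrow> real set" where
  "reach n = {t. \<exists>m s. s \<in> {0..<\<alpha> ^ n} \<and> t = (T ^^ m) s}"

lemma base_in_unit: "s \<in> {0..<\<alpha> ^ n} \<Longrightarrow> s \<in> {0..<1}"
  using power_alpha_le_1[of n] by auto

lemma base_scaled: "s \<in> {0..<\<alpha> ^ n} \<Longrightarrow> \<exists>t\<in>{0..<1}. s = \<alpha> ^ n * t"
  using alpha by (intro bexI[of _ "s / \<alpha> ^ n"]) (auto simp: field_simps)

lemma reach_subset: "reach n \<subseteq> {0..<1}"
  unfolding reach_def using T_pow_in base_in_unit by blast

lemma base_subset_reach: "{0..<\<alpha> ^ n} \<subseteq> reach n"
  unfolding reach_def by (force intro: exI[of _ 0])

lemma reach_mono: "reach (Suc n) \<subseteq> reach n"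
proof -
  have "\<alpha> ^ Suc n \<le> \<alpha> ^ n" using alpha by (simp add: mult_le_cancel_right1)
  hence "{0..<\<alpha> ^ Suc n} \<subseteq> {0..<\<alpha> ^ n}" by auto
  thus ?thesis unfolding reach_def by blast
qed

text \<open>The Rokhlin towers of level \<open>n\<close>: the floors over
  \<open>\<alpha>^n * I a\<close> are translated intervals, and after the top floor the orbit is
  back in the base. The point is that the union is finite.\<close>

lemma reach_eq:
  "reach n = (\<Union>a. \<Union>m<length ((sub ^^ n) [a]).
     {(T ^^ m) (\<alpha> ^ n * lend a)..<(T ^^ m) (\<alpha> ^ n * lend a) + \<alpha> ^ n * (rend a - lend a)})"
  (is "_ = ?R")
proof -
  have floor: "(T ^^ m) (\<alpha> ^ n * t) = (T ^^ m) (\<alpha> ^ n * lend a) + \<alpha> ^ n * (t - lend a)"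
    if "t \<in> I a" "m < length ((sub ^^ n) [a])" for t a m
  proof -
    have t: "t \<in> {0..<1}" "lend a \<in> {0..<1}" using that lend_in[of a] I_subset by blast+
    have "itinerary m (\<alpha> ^ n * t) = take m ((sub ^^ n) [a])" if "t \<in> I a" for t
      using tower_itinerary(1)[OF that, of n] take_itinerary \<open>m < _\<close> by (metis less_imp_le)
    hence "itinerary m (\<alpha> ^ n * t) = itinerary m (\<alpha> ^ n * lend a)" using that lend_in by simp
    from same_itinerary_translation[OF _ _ this] scale_in_unit t show ?thesis
      by (simp add: right_diff_distrib)
  qed
  have 1: "(T ^^ m) (\<alpha> ^ n * t) \<in> ?R" if "t \<in> {0..<1}" for m t
    using that
  proof (induction m arbitrary: t rule: less_induct)
    case (less m)
    define a where "a = letter t"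
    define l where "l = length ((sub ^^ n) [a])"
    have a: "t \<in> I a" unfolding a_def using less.prems by (rule letter_in)
    show ?case
    proof (cases "m < l")
      case True
      have "t - lend a \<ge> 0" "t - lend a < rend a - lend a" using a by (auto simp: I_iff)
      hence "\<alpha> ^ n * (t - lend a) \<ge> 0" "\<alpha> ^ n * (t - lend a) < \<alpha> ^ n * (rend a - lend a)"
        using alpha by auto
      thus ?thesis using floor[OF a, of m] True unfolding l_def by (intro UN_I[of a] UN_I[of m]) auto
    next
      case False
      have "l > 0" using length_sub_pow_ge[of "[a]" n] unfolding l_def by (simp del: length_greater_0_conv)
      have "(T ^^ m) (\<alpha> ^ n * t) = (T ^^ (m - l)) ((T ^^ l) (\<alpha> ^ n * t))"
        using False funpow_add[of "m - l" l T] by simp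
      also have "(T ^^ l) (\<alpha> ^ n * t) = \<alpha> ^ n * T t" unfolding l_def by (rule tower_itinerary(2)[OF a])
      finally show ?thesis using less.IH[of "m - l" "T t"] T_in[OF less.prems] False \<open>l > 0\<close> by simp
    qed
  qed
  have 2: "x \<in> reach n" if "m < length ((sub ^^ n) [a])"
    "x \<in> {(T ^^ m) (\<alpha> ^ n * lend a)..<(T ^^ m) (\<alpha> ^ n * lend a) + \<alpha> ^ n * (rend a - lend a)}" for x a m
  proof -
    define t where "t = lend a + (x - (T ^^ m) (\<alpha> ^ n * lend a)) / \<alpha> ^ n"
    have t: "t \<in> I a" using that(2) alpha unfolding t_def by (simp add: I_iff field_simps)
    have "(T ^^ m) (\<alpha> ^ n * t) = x" using floor[OF t that(1)] alpha unfolding t_def by simp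
    moreover have "\<alpha> ^ n * t \<in> {0..<\<alpha> ^ n}" using t I_subset by (intro scale_in) blast
    ultimately show ?thesis unfolding reach_def by blast
  qed
  have "reach n \<subseteq> ?R"
  proof
    fix x assume "x \<in> reach n"
    then obtain m s where "s \<in> {0..<\<alpha> ^ n}" "x = (T ^^ m) s" unfolding reach_def by blast
    moreover obtain t where "t \<in> {0..<1}" "s = \<alpha> ^ n * t" using base_scaled[OF \<open>s \<in> _\<close>] by blast
    ultimately show "x \<in> ?R" using 1[of t m] by simp
  qed
  moreover have "?R \<subseteq> reach n" using 2 by blast
  ultimately show ?thesis by blast
qed

lemma germ_decided_reach: "germ_decided (reach n)"
  unfolding reach_eq by (intro germ_decided_UN germ_decided_interval) auto

text \<open>Going backwards, only a point of the base is critical: its preimage lies on the top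
  floor of a tower.\<close>

lemma reach_invariant:
  assumes "t \<in> {0..<1}" shows "T t \<in> reach n \<longleftrightarrow> t \<in> reach n"
proof
  assume "t \<in> reach n"
  then obtain m s where "s \<in> {0..<\<alpha> ^ n}" "t = (T ^^ m) s" unfolding reach_def by blast
  hence "T t = (T ^^ Suc m) s" by simp
  thus "T t \<in> reach n" using \<open>s \<in> _\<close> unfolding reach_def by blast
next
  have *: "t \<in> reach n" if "s \<in> {0..<\<alpha> ^ n}" "T t = (T ^^ Suc m) s" for s m
  proof -
    have "t = (T ^^ m) s"
      using T_inj[OF assms T_pow_in[OF base_in_unit[OF that(1)], of m]] that(2) by simp
    thus ?thesis using that unfolding reach_def by blast
  qed
  assume "T t \<in> reach n"
  then obtain m s where s: "s \<in> {0..<\<alpha> ^ n}" "T t = (T ^^ m) s" unfolding reach_def by blast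
  show "t \<in> reach n"
  proof (cases m)
    case 0
    obtain s' where s': "s' \<in> {0..<1}" "s = \<alpha> ^ n * s'" using base_scaled s by blast
    define r where "r = Tinv s'"
    have r: "r \<in> {0..<1}" "T r = s'" unfolding r_def using s' Tinv_in T_Tinv by auto
    define a where "a = letter r"
    have a: "r \<in> I a" unfolding a_def using r by (intro letter_in)
    have "length ((sub ^^ n) [a]) > 0"
      using length_sub_pow_ge[of "[a]" n] by (simp del: length_greater_0_conv)
    then obtain l where l: "length ((sub ^^ n) [a]) = Suc l" using gr0_conv_Suc by blast
    have "(T ^^ Suc l) (\<alpha> ^ n * r) = T t" using tower_itinerary(2)[OF a, of n] l r s' s 0 by simp
    thus ?thesis using * scale_in[OF r(1)] by metis
  qed (use * s in blast)
qed

end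

locale growing_iet = self_similar_iet T I \<alpha> \<sigma>
  for T :: "real \<Rightarrow> real" and I :: "'a::finite \<Rightarrow> real set" and \<alpha> \<sigma> +
  assumes growth: "\<exists>a. \<forall>q. \<forall>\<^sub>F n in sequentially. q < length ((subst_word \<sigma> ^^ n) [a])"
begin

lemma eventually_power_less: "e > 0 \<Longrightarrow> \<forall>\<^sub>F n in sequentially. \<alpha> ^ n < e"
  using order_tendstoD(2)[OF LIMSEQ_realpow_zero] alpha by simp

text \<open>For a growing letter \<open>a\<close>, the point \<open>\<alpha>^n * lend a\<close>
  needs at least \<open>length ((sub ^^ n) [a])\<close> steps to return to
  \<open>[0,\<alpha>^n)\<close>, and this exceeds \<open>q\<close> for large
  \<open>n\<close>.\<close>

lemma no_periodic_near_0:
  assumes "e > 0" "q > 0"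
  shows "\<exists>t\<in>{0..<e}. (T ^^ q) t \<noteq> t"
proof (rule ccontr)
  assume "\<not> ?thesis"
  hence id: "\<And>t. t \<in> {0..<e} \<Longrightarrow> (T ^^ q) t = t" by blast
  obtain a where "\<forall>\<^sub>F n in sequentially. q < length ((sub ^^ n) [a])" using growth by blast
  with eventually_power_less[OF assms(1)]
  have "\<forall>\<^sub>F n in sequentially. \<alpha> ^ n < e \<and> q < length ((sub ^^ n) [a])" by eventually_elim blast
  then obtain n where n: "\<alpha> ^ n < e" "q < length ((sub ^^ n) [a])"
    using eventually_happens'[OF sequentially_bot] by blast
  define t where "t = lend a"
  have t: "t \<in> I a" "t \<in> {0..<1}" unfolding t_def using lend_in I_subset by blast+
  have s: "\<alpha> ^ n * t \<in> {0..<\<alpha> ^ n}" using t scale_in by blast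
  have "(T ^^ q) (\<alpha> ^ n * t) = \<alpha> ^ n * t" by (rule id) (use s n in auto)
  then obtain i where i: "q = length ((sub ^^ n) (itinerary i t))"
    using return_is_iterate[OF t(2), of q n] s by auto
  then obtain j where "i = Suc j" using assms(2) by (cases i) auto
  hence "itinerary i t = a # itinerary j (T t)" using letter_eq[OF t(1)] by (simp add: itinerary_Suc)
  hence "length ((sub ^^ n) [a]) \<le> q" unfolding i
    using subst_pow_Cons[of n \<sigma> a "itinerary j (T t)"] by simp
  thus False using n by simp
qed

text \<open>The sets \<open>reach n - reach (Suc n)\<close> are disjoint, so all but finitely many avoid the end points
  of the intervals and \<open>T\<close> is periodic on them. Extending a period interval to the left
  until it meets one of the finitely many periodic orbits of end points reaches \<open>0\<close>.\<close>

lemma reach_1: "reach 1 = {0..<1}"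
proof (rule ccontr)
  assume "reach 1 \<noteq> {0..<1}"
  then obtain c where c: "c \<in> {0..<1}" "c \<notin> reach 1" using reach_subset by blast
  have "0 \<in> reach 1" using base_subset_reach[of 1] alpha by auto
  hence "c > 0" using c by (cases "c = 0") auto
  define D where "D n = reach n - reach (Suc n)" for n
  have D: "D n \<subseteq> {0..<1}" "\<And>t. t \<in> {0..<1} \<Longrightarrow> T t \<in> D n \<longleftrightarrow> t \<in> D n" "germ_decided (D n)" for n
    unfolding D_def using reach_subset reach_invariant germ_decided_Diff germ_decided_reach by blast+
  \<comment> \<open>By \<open>return_is_iterate\<close>, an orbit segment from
    \<open>[0,\<alpha>^(n+1))\<close> to \<open>\<alpha>^n * c\<close> consists of whole words of
    level \<open>n\<close>; it rescales to a segment from \<open>[0,\<alpha>)\<close> to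
    \<open>c\<close>, which does not exist.\<close>
  have cD: "\<alpha> ^ n * c \<in> D n" for n
  proof -
    have "\<alpha> ^ n * c \<in> reach n" using base_subset_reach scale_in[OF c(1)] by blast
    moreover have "\<alpha> ^ n * c \<notin> reach (Suc n)"
    proof
      assume "\<alpha> ^ n * c \<in> reach (Suc n)"
      then obtain m s where s: "s \<in> {0..<\<alpha> ^ Suc n}" "\<alpha> ^ n * c = (T ^^ m) s" unfolding reach_def by blast
      obtain t where t: "t \<in> {0..<1}" "s = \<alpha> ^ Suc n * t" using base_scaled s by blast
      define s' where "s' = \<alpha> * t"
      have s': "s' \<in> {0..<\<alpha>}" "s' \<in> {0..<1}" unfolding s'_def using scale1 t by blast+
      have ss: "s = \<alpha> ^ n * s'" unfolding s'_def t by simp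
      have "(T ^^ m) (\<alpha> ^ n * s') \<in> {0..<\<alpha> ^ n}" using s(2) ss scale_in[OF c(1), of n] by simp
      then obtain i where "m = length ((sub ^^ n) (itinerary i s'))" using return_is_iterate s' by blast
      hence "\<alpha> ^ n * c = \<alpha> ^ n * (T ^^ i) s'" using s(2) ss scaled_itinerary_pow[OF s'(2)] by simp
      hence "c = (T ^^ i) s'" using alpha by simp
      thus False using c s'(1) unfolding reach_def by auto
    qed
    ultimately show ?thesis unfolding D_def by blast
  qed
  have ev1: "\<forall>\<^sub>F n in sequentially. lend b \<notin> D n" for b
  proof (cases "\<exists>n. lend b \<in> D n")
    case True
    then obtain n0 where n0: "lend b \<in> D n0" by blast
    have "decseq reach" using reach_mono by (simp add: decseq_Suc_iff)
    hence "lend b \<notin> D n" if "n > n0" for n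
      using n0 decseqD[of reach "Suc n0" n] that unfolding D_def by auto
    thus ?thesis by (intro eventually_mono[OF eventually_gt_at_top[of n0]])
  qed (auto intro: always_eventually)
  \<comment> \<open>\<open>Z\<close> is the finite union of the periodic orbits of left end points.
    For large \<open>n\<close> the point \<open>\<alpha>^n * c\<close> lies below all its positive
    elements, so the left extension of a period interval can only stop at 0.\<close>
  define P where "P = {b. \<exists>q>0. (T ^^ q) (lend b) = lend b}"
  define Z where "Z = (\<Union>b\<in>P. range (\<lambda>j. (T ^^ j) (lend b)))"
  have "finite (range (\<lambda>j. (T ^^ j) (lend b)))" if b: "b \<in> P" for b
  proof -
    obtain q where q: "q > 0" "(T ^^ q) (lend b) = lend b" using b unfolding P_def by blast
    have "range (\<lambda>j. (T ^^ j) (lend b)) \<subseteq> (\<lambda>j. (T ^^ j) (lend b)) ` {..<q}"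
    proof
      fix x assume "x \<in> range (\<lambda>j. (T ^^ j) (lend b))"
      then obtain j where "x = (T ^^ j) (lend b)" by blast
      hence "x = (T ^^ (j mod q)) (lend b)" using funpow_mod_eq[OF q(2), of j] by simp
      thus "x \<in> (\<lambda>j. (T ^^ j) (lend b)) ` {..<q}" using q(1) by auto
    qed
    thus ?thesis using finite_subset by blast
  qed
  hence "finite Z" unfolding Z_def by auto
  moreover have "\<forall>\<^sub>F n in sequentially. z > 0 \<longrightarrow> \<alpha> ^ n * c < z" for z
  proof (cases "z > 0")
    case True
    have "\<forall>\<^sub>F n in sequentially. \<alpha> ^ n < z / c" using True \<open>c > 0\<close> by (intro eventually_power_less) auto
    thus ?thesis
      by eventually_elim (use \<open>c > 0\<close> in \<open>simp add: pos_less_divide_eq\<close>)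
  qed auto
  ultimately have "\<forall>\<^sub>F n in sequentially. \<forall>z\<in>Z. z > 0 \<longrightarrow> \<alpha> ^ n * c < z"
    by (intro eventually_ball_finite) auto
  moreover have "\<forall>\<^sub>F n in sequentially. \<forall>b\<in>UNIV. lend b \<notin> D n"
    using ev1 by (intro eventually_ball_finite) auto
  ultimately have "\<forall>\<^sub>F n in sequentially. (\<forall>b\<in>UNIV. lend b \<notin> D n) \<and> (\<forall>z\<in>Z. z > 0 \<longrightarrow> \<alpha> ^ n * c < z)"
    by eventually_elim blast
  then obtain n where n: "\<And>b. lend b \<notin> D n" "\<And>z. z \<in> Z \<Longrightarrow> z > 0 \<Longrightarrow> \<alpha> ^ n * c < z"
    using eventually_happens'[OF sequentially_bot] by blast
  define t where "t = \<alpha> ^ n * c"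
  have t: "t \<in> D n" "t \<in> {0..<1}" "t > 0"
    using cD[of n] D(1)[of n] \<open>c > 0\<close> alpha unfolding t_def by (blast, blast, simp)
  have "D n \<inter> range lend = {}" using n(1) by auto
  from periodic_avoiding_special[OF D(1) D(2) this D(3) t(1)]
  obtain q e where q: "q > 0" "e > 0" "\<forall>s\<in>{t..<t+e}. (T ^^ q) s = s" by blast
  have "(T ^^ q) t = t" using q by simp
  from extend_periodic_left[OF t(2) q(1) this]
  obtain s b j where s: "s \<in> {0..t}" "\<forall>r\<in>{s..t}. (T ^^ q) r = r" "s = (T ^^ j) (lend b)"
    "(T ^^ q) (lend b) = lend b" by blast
  have "s \<in> Z" using s q(1) unfolding Z_def P_def by blast
  hence "s = 0" using n(2)[of s] s(1) unfolding t_def by force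
  hence "\<forall>r\<in>{0..<t}. (T ^^ q) r = r" using s(2) by auto
  thus False using no_periodic_near_0[OF t(3) q(1)] by blast
qed

lemma reach_all: "reach n = {0..<1}"
proof (induction n)
  case 0 show ?case using reach_subset base_subset_reach[of 0] by auto
next
  case (Suc n)
  have "t \<in> reach (Suc n)" if "t \<in> {0..<1}" for t
  proof -
    have tr: "t \<in> reach n" using that Suc by simp
    obtain m s where s: "s \<in> {0..<\<alpha> ^ n}" "t = (T ^^ m) s"
      using tr unfolding reach_def by blast
    obtain s' where s': "s' \<in> {0..<1}" "s = \<alpha> ^ n * s'" using base_scaled s by blast
    have "s' \<in> reach 1" using s'(1) reach_1 by simp
    then obtain i r where r: "r \<in> {0..<\<alpha>}" "s' = (T ^^ i) r" unfolding reach_def by fastforce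
    have r1: "r \<in> {0..<1}" using r alpha by auto
    have "s = (T ^^ length ((sub ^^ n) (itinerary i r))) (\<alpha> ^ n * r)"
      using scaled_itinerary_pow[OF r1] s' r by simp
    hence "t = (T ^^ (m + length ((sub ^^ n) (itinerary i r)))) (\<alpha> ^ n * r)"
      using s(2) by (simp add: funpow_add)
    moreover have "\<alpha> ^ n * r \<in> {0..<\<alpha> ^ Suc n}" using r alpha by (simp add: mult.commute)
    ultimately show ?thesis unfolding reach_def by blast
  qed
  thus ?case using reach_subset by blast
qed

text \<open>Otherwise the letter at 0 has shift 0, and all points near 0 have period 1.\<close>

lemma fixed_0_impossible: "T 0 \<noteq> 0"
proof
  assume "T 0 = 0"
  define a where "a = letter 0"
  have a: "0 \<in> I a" unfolding a_def by (rule letter_in) simp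
  have "shift a = 0" using T_on_I[OF a] \<open>T 0 = 0\<close> by simp
  moreover have "0 < rend a" "lend a \<le> 0" using a by (auto simp: I_iff)
  ultimately have "(T ^^ 1) t = t" if "t \<in> {0..<rend a}" for t
    using T_on_I[of t a] that by (auto simp: I_iff)
  thus False using no_periodic_near_0[of "rend a" 1] \<open>0 < rend a\<close> by auto
qed

text \<open>The points whose two-sided orbit meets \<open>[x,y)\<close> form an invariant set
  \<open>U\<close>. Every point is an iterate of some point of \<open>[0,\<alpha>^n)\<close>, for
  each \<open>n\<close> (\<open>reach_all\<close>). So if the orbit of \<open>t0\<close> missed
  \<open>[x,y)\<close>, both \<open>U\<close> and its complement would accumulate at 0, contrary to
  \<open>invariant_set_not_both_near_0\<close>.\<close>

theorem minimal:
  assumes t0: "t0 \<in> {0..<1}" and xy: "0 \<le> x" "x < y" "y \<le> 1"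
  shows "\<exists>n. (T ^^ n) t0 \<in> {x..<y} \<or> (Tinv ^^ n) t0 \<in> {x..<y}"
proof (rule ccontr)
  assume no: "\<not> ?thesis"
  interpret inv: iet Tinv "\<lambda>a. T ` I a" by (rule inverse_exchange)
  define U where "U = {t\<in>{0..<1}. \<exists>n. (T ^^ n) t \<in> {x..<y} \<or> (Tinv ^^ n) t \<in> {x..<y}}"
  have U1: "U \<subseteq> {0..<1}" unfolding U_def by blast
  have U2: "T t \<in> U \<longleftrightarrow> t \<in> U" if t: "t \<in> {0..<1}" for t
  proof
    have bk: "(Tinv ^^ Suc k) (T t) = (Tinv ^^ k) t" for k using Tinv_T[OF t] by (simp add: funpow_swap1)
    assume "T t \<in> U"
    then obtain n where "(T ^^ n) (T t) \<in> {x..<y} \<or> (Tinv ^^ n) (T t) \<in> {x..<y}" unfolding U_def by blast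
    moreover have "(T ^^ n) (T t) = (T ^^ Suc n) t" by (simp add: funpow_swap1)
    moreover have "(Tinv ^^ n) (T t) \<in> {x..<y} \<Longrightarrow> (T ^^ 1) t \<in> {x..<y} \<or> (\<exists>k. (Tinv ^^ k) t \<in> {x..<y})"
      using bk by (cases n) (simp, metis)
    ultimately have "\<exists>k. (T ^^ k) t \<in> {x..<y} \<or> (Tinv ^^ k) t \<in> {x..<y}" by metis
    thus "t \<in> U" unfolding U_def using t by blast
  next
    assume "t \<in> U"
    then obtain n where n: "(T ^^ n) t \<in> {x..<y} \<or> (Tinv ^^ n) t \<in> {x..<y}" unfolding U_def by blast
    have bk: "(Tinv ^^ Suc k) (T t) = (Tinv ^^ k) t" for k using Tinv_T[OF t] by (simp add: funpow_swap1)
    have "(T ^^ n) t \<in> {x..<y} \<Longrightarrow> (\<exists>k. (T ^^ k) (T t) \<in> {x..<y}) \<or> (Tinv ^^ 1) (T t) \<in> {x..<y}"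
      using Tinv_T[OF t] by (cases n) (simp, metis funpow_Suc_right o_apply)
    moreover have "(Tinv ^^ n) t \<in> {x..<y} \<Longrightarrow> (Tinv ^^ Suc n) (T t) \<in> {x..<y}"
      by (simp only: bk)
    ultimately show "T t \<in> U" using n T_in[OF t] unfolding U_def by blast
  qed
  have U3: "\<exists>e>0. {t..<t+e} \<subseteq> U" if tU: "t \<in> U" for t
  proof -
    have t: "t \<in> {0..<1}" using tU U1 by blast
    have *: "\<exists>e>0. {t..<t+e} \<subseteq> U" if S: "S \<in> {T, Tinv}" and n: "(S ^^ n) t \<in> {x..<y}"
      and e: "e > 0" "t + e \<le> 1" "\<forall>s\<in>{t..<t+e}. (S ^^ n) s = (S ^^ n) t + (s - t)" for S n e
    proof -
      define e' where "e' = min e (y - (S ^^ n) t)"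
      have "e' > 0" using n e(1) unfolding e'_def by simp
      moreover have "s \<in> U" if "s \<in> {t..<t+e'}" for s
      proof -
        have "(S ^^ n) s = (S ^^ n) t + (s - t)" by (rule bspec[OF e(3)]) (use that in \<open>auto simp: e'_def\<close>)
        moreover have "e' \<le> y - (S ^^ n) t" unfolding e'_def by simp
        ultimately have "(S ^^ n) s \<in> {x..<y}" using that n by auto
        moreover have "e' \<le> e" unfolding e'_def by simp
        hence "s \<in> {0..<1}" using that t e(2) by auto
        ultimately show ?thesis using S unfolding U_def by blast
      qed
      ultimately show ?thesis by blast
    qed
    obtain n where "(T ^^ n) t \<in> {x..<y} \<or> (Tinv ^^ n) t \<in> {x..<y}" using tU unfolding U_def by blast
    thus ?thesis using right_translation[OF t, of n] inv.right_translation[OF t, of n] *[of T n] *[of Tinv n]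
      by blast
  qed
  have KU: "{x..<y} \<subseteq> U" unfolding U_def using xy by (force intro: exI[of _ 0])
  have near: "\<exists>s\<in>{0..<\<alpha> ^ n}. s \<in> S"
    if S: "\<And>t. t \<in> {0..<1} \<Longrightarrow> T t \<in> S \<longleftrightarrow> t \<in> S" "t \<in> S" "t \<in> {0..<1}" for S t n
  proof -
    have "t \<in> reach n" using S(3) reach_all by simp
    then obtain m s where s: "s \<in> {0..<\<alpha> ^ n}" "t = (T ^^ m) s" unfolding reach_def by blast
    have "(T ^^ m) s \<in> S \<longleftrightarrow> s \<in> S"
    proof (induction m)
      case (Suc m) thus ?case using S(1)[OF T_pow_in[OF base_in_unit[OF s(1)], of m]] by simp
    qed simp
    thus ?thesis using s S(2) by blast
  qed
  have U0: "\<exists>s\<in>{0<..<e}. s \<in> U" if e: "e > 0" for e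
  proof -
    obtain n where n: "\<alpha> ^ n < e" using eventually_happens'[OF sequentially_bot eventually_power_less[OF e]] by blast
    have "x \<in> U" "x \<in> {0..<1}" using KU xy by auto
    then obtain s where s: "s \<in> {0..<\<alpha> ^ n}" "s \<in> U" using near[of U x] U2 by blast
    obtain d where d: "d > 0" "{s..<s+d} \<subseteq> U" using U3 s by blast
    have "s < min e (s + d)" using s n d by simp
    then obtain r where "s < r" "r < min e (s + d)" using dense by blast
    hence "r \<in> {0<..<e}" "r \<in> {s..<s+d}" using s by auto
    thus ?thesis using d by blast
  qed
  \<comment> \<open>The complement meets every \<open>[0,\<alpha>^n)\<close>, but perhaps only in 0.
    It then contains the forward orbit of 0, in particular the return point
    \<open>\<alpha>^n * T 0\<close>, which differs from 0.\<close>
  have V0: "\<exists>v\<in>{0<..<e}. v \<notin> U" if e: "e > 0" for e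
  proof (rule ccontr)
    assume c: "\<not> ?thesis"
    obtain n where n: "\<alpha> ^ n < e" using eventually_happens'[OF sequentially_bot eventually_power_less[OF e]] by blast
    have *: "s = 0" if "s \<in> {0..<\<alpha> ^ n}" "s \<notin> U" for s using c that n by force
    have "t0 \<notin> U" unfolding U_def using no by blast
    hence "\<exists>s\<in>{0..<\<alpha> ^ n}. s \<in> - U" using U2 t0 by (intro near[of "- U" t0]) auto
    then obtain s where "s \<in> {0..<\<alpha> ^ n}" "s \<notin> U" by blast
    hence "0 \<notin> U" using * by metis
    define a where "a = letter 0"
    have a: "0 \<in> I a" unfolding a_def by (rule letter_in) simp
    have T0: "\<alpha> ^ n * T 0 = (T ^^ length ((sub ^^ n) [a])) 0" using tower_itinerary(2)[OF a, of n] by simp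
    have "(T ^^ m) 0 \<notin> U" for m
    proof (induction m)
      case (Suc m) thus ?case using U2[OF T_pow_in[of 0 m]] by simp
    qed (use \<open>0 \<notin> U\<close> in simp)
    hence "\<alpha> ^ n * T 0 = 0" using * scale_in[OF T_in[of 0], of n] unfolding T0 by auto
    thus False using fixed_0_impossible alpha by simp
  qed
  have "\<exists>n. (T ^^ n) t \<in> {x..<y} \<or> (Tinv ^^ n) t \<in> {x..<y}" if "t \<in> U" for t
    using that unfolding U_def by blast
  from invariant_set_not_both_near_0[OF U1 U2 U3 xy(2) KU this U0 V0] show False by blast
qed

end

section \<open>Blowing up an orbit\<close>

lemma (in iet) int_iterate_in: "t \<in> {0..<1} \<Longrightarrow> int_iterate T n t \<in> {0..<1}"
proof -
  interpret inv: iet Tinv "\<lambda>a. T ` I a" by (rule inverse_exchange)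
  show "t \<in> {0..<1} \<Longrightarrow> int_iterate T n t \<in> {0..<1}"
    unfolding int_iterate_def Tinv_def[symmetric]
    using T_pow_in[of t "nat n"] inv.T_pow_in[of t "nat (- n)"] by simp
qed

lemma (in iet) int_iterate_add_1:
  assumes "t \<in> {0..<1}" shows "int_iterate T (n + 1) t = T (int_iterate T n t)"
proof -
  interpret inv: iet Tinv "\<lambda>a. T ` I a" by (rule inverse_exchange)
  show ?thesis
  proof (cases "0 \<le> n")
    case True
    hence "nat (n + 1) = Suc (nat n)" by simp
    thus ?thesis using True by (simp add: int_iterate_def)
  next
    case False
    hence k: "nat (- n) = Suc (nat (- (n + 1)))" by simp
    have "T (int_iterate T n t) = T (Tinv ((Tinv ^^ nat (- (n + 1))) t))"
      using False unfolding int_iterate_def Tinv_def[symmetric] k by simp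
    also have "\<dots> = (Tinv ^^ nat (- (n + 1))) t" using T_Tinv inv.T_pow_in[OF assms] by blast
    also have "\<dots> = int_iterate T (n + 1) t"
      using False by (cases "n = -1") (auto simp: int_iterate_def Tinv_def)
    finally show ?thesis ..
  qed
qed

text \<open>A probability measure whose image under \<open>T\<close> has density \<open>l a\<close> on \<open>I a\<close>
  serves as the length measure of the blown-up interval: \<open>F\<close> is its distribution function
  and \<open>h\<close> the generalized inverse of \<open>F\<close>.\<close>

locale blow_up = iet T I for T :: "real \<Rightarrow> real" and I :: "'a::finite \<Rightarrow> real set" +
  fixes p :: "real pmf" and l :: "'a \<Rightarrow> real"
  assumes set_p: "set_pmf p \<subseteq> {0..<1}"
    and dense_p: "\<And>x y. 0 \<le> x \<Longrightarrow> x < y \<Longrightarrow> y \<le> 1 \<Longrightarrow> \<exists>t\<in>{x..<y}. t \<in> set_pmf p"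
    and l_pos: "\<And>a. l a > 0"
    and quasi_invariant: "\<And>t a. t \<in> I a \<Longrightarrow> pmf p (T t) = l a * pmf p t"
begin

abbreviation "\<mu> \<equiv> measure_pmf.prob p"

definition F :: "real \<Rightarrow> real" where "F t = \<mu> {..<t}"
definition h :: "real \<Rightarrow> real" where "h x = Sup {t\<in>{0..1}. F t \<le> x}"
definition J :: "'a \<Rightarrow> real set" where "J a = {F (lend a)..<F (rend a)}"
definition f :: "real \<Rightarrow> real" where
  "f x = (let a = letter (h x) in F (T (lend a)) + l a * (x - F (lend a)))"

lemma F_mono: "s \<le> t \<Longrightarrow> F s \<le> F t"
  unfolding F_def by (intro measure_pmf.finite_measure_mono) auto

lemma F_diff: "s \<le> t \<Longrightarrow> F t = F s + \<mu> {s..<t}"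
proof -
  assume "s \<le> t"
  hence "{..<t} = {..<s} \<union> {s..<t}" by auto
  thus ?thesis unfolding F_def
    using measure_pmf.finite_measure_Union[of "{..<s}" p "{s..<t}"] by force
qed

lemma F_strict: "0 \<le> s \<Longrightarrow> s < t \<Longrightarrow> t \<le> 1 \<Longrightarrow> F s < F t"
proof -
  assume st: "0 \<le> s" "s < t" "t \<le> 1"
  then obtain r where r: "r \<in> {s..<t}" "r \<in> set_pmf p" using dense_p by blast
  have "0 < pmf p r" using r by (simp add: pmf_positive)
  also have "pmf p r = \<mu> {r}" by (simp add: measure_pmf_single)
  also have "\<dots> \<le> \<mu> {s..<t}" using r by (intro measure_pmf.finite_measure_mono) auto
  finally show "F s < F t" using F_diff[of s t] st by simp
qed

lemma F_0: "F 0 = 0"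
proof -
  have "\<mu> {..<0} = \<mu> {}" by (rule measure_prob_cong_0) (use set_p in \<open>auto simp: pmf_eq_0_set_pmf\<close>)
  thus ?thesis unfolding F_def by simp
qed

lemma F_1: "F 1 = 1"
  unfolding F_def using set_p by (simp add: measure_pmf.prob_eq_1 AE_measure_pmf_iff) auto

lemma F_left_continuous: "x < F t \<Longrightarrow> \<exists>s<t. x < F s"
proof -
  assume x: "x < F t"
  define A where "A n = {..<t - 1 / Suc n}" for n
  have "(\<Union>n. A n) = {..<t}"
  proof
    show "(\<Union>n. A n) \<subseteq> {..<t}"
    proof
      fix s assume "s \<in> (\<Union>n. A n)"
      then obtain n where "s < t - 1 / Suc n" unfolding A_def by blast
      moreover have "0 < 1 / real (Suc n)" by simp
      ultimately have "s < t" by linarith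
      thus "s \<in> {..<t}" by simp
    qed
    show "{..<t} \<subseteq> (\<Union>n. A n)"
    proof
      fix s assume "s \<in> {..<t}"
      hence "0 < t - s" by simp
      then obtain n where "1 / Suc n < t - s" using nat_approx_posE by blast
      hence "s \<in> A n" unfolding A_def by simp
      thus "s \<in> (\<Union>n. A n)" by blast
    qed
  qed
  moreover have "incseq A"
  proof (intro monoI)
    fix m n :: nat assume "m \<le> n"
    hence "1 / real (Suc n) \<le> 1 / real (Suc m)" by (simp add: field_simps)
    thus "A m \<subseteq> A n" unfolding A_def by auto
  qed
  ultimately have "(\<lambda>n. \<mu> (A n)) \<longlonglongrightarrow> F t"
    unfolding F_def using measure_pmf.finite_Lim_measure_incseq[of A p] by auto
  hence "\<forall>\<^sub>F n in sequentially. x < \<mu> (A n)" using x by (rule order_tendstoD)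
  then obtain n where "x < \<mu> (A n)" using eventually_happens'[OF sequentially_bot] by blast
  hence "x < F (t - 1 / Suc n)" unfolding F_def A_def .
  thus ?thesis by (intro exI[of _ "t - 1 / Suc n"]) auto
qed

text \<open>Left continuity of \<open>F\<close> makes the supremum in \<open>h\<close> attained. The
  later properties of \<open>h\<close> are read off from this adjunction.\<close>

lemma galois:
  assumes "x \<in> {0..<1}" "t \<in> {0..1}" shows "t \<le> h x \<longleftrightarrow> F t \<le> x"
proof
  let ?S = "{t\<in>{0..1}. F t \<le> x}"
  have 0: "0 \<in> ?S" using F_0 assms by auto
  have b: "bdd_above ?S" by (rule bdd_aboveI[of _ 1]) auto
  show "F t \<le> x \<Longrightarrow> t \<le> h x" unfolding h_def using b assms by (intro cSup_upper) auto
  show "t \<le> h x \<Longrightarrow> F t \<le> x"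
  proof (rule ccontr)
    assume t: "t \<le> h x" "\<not> F t \<le> x"
    then obtain s where s: "s < t" "x < F s" using F_left_continuous by force
    have "h x \<le> s" unfolding h_def
    proof (rule cSup_least)
      show "?S \<noteq> {}" using 0 by blast
      fix r assume "r \<in> ?S"
      thus "r \<le> s" using F_mono[of s r] s by force
    qed
    thus False using t s by simp
  qed
qed

lemma h_in: assumes "x \<in> {0..<1}" shows "h x \<in> {0..<1}"
  using galois[OF assms, of 0] galois[OF assms, of 1] assms F_0 F_1 by auto

lemma F_in: assumes "t \<in> {0..<1}" shows "F t \<in> {0..<1}"
  using F_mono[of 0 t] F_strict[of t 1] F_0 F_1 assms by auto

lemma h_F: assumes "t \<in> {0..<1}" shows "h (F t) = t"
proof (rule antisym)
  show "t \<le> h (F t)" using galois[OF F_in[OF assms], of t] assms by auto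
  show "h (F t) \<le> t"
  proof (rule ccontr)
    assume "\<not> h (F t) \<le> t"
    moreover have "h (F t) \<in> {0..<1}" using h_in F_in assms by blast
    ultimately have "F t < F (h (F t))" using assms by (intro F_strict) auto
    moreover have "F (h (F t)) \<le> F t" using galois[OF F_in[OF assms], of "h (F t)"] h_in[OF F_in[OF assms]] by auto
    ultimately show False by simp
  qed
qed

lemma h_mono: assumes "x \<in> {0..<1}" "y \<in> {0..<1}" "x \<le> y" shows "h x \<le> h y"
  using galois[OF assms(1), of "h x"] galois[OF assms(2), of "h x"] h_in[OF assms(1)] assms(3) by auto

lemma h_surj: "h ` {0..<1} = {0..<1}"
  using h_in h_F F_in by (auto simp del: atLeastLessThan_iff) (metis imageI)

text \<open>A jump of \<open>h\<close> would need a flat piece of \<open>F\<close>, and density of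
  the atoms excludes it (\<open>F_strict\<close>).\<close>

lemma h_continuous: "continuous_on {0..<1} h"
  unfolding continuous_on_def
proof (intro ballI order_tendstoI)
  fix x a assume x: "x \<in> {0..<1::real}" and a: "a < h x"
  have ev: "\<forall>\<^sub>F y in at x within {0..<1}. y \<in> {0..<1}" by (simp add: eventually_at_filter)
  show "\<forall>\<^sub>F y in at x within {0..<1}. a < h y"
  proof (cases "a < 0")
    case True
    from ev show ?thesis by eventually_elim (use h_in True in force)
  next
    case False
    obtain s where s: "a < s" "s < h x" using a dense by blast
    have s01: "s \<in> {0..1}" using s False h_in[OF x] by auto
    have "F s < F (h x)" using s s01 h_in[OF x] by (intro F_strict) auto
    also have "F (h x) \<le> x" using galois[OF x, of "h x"] h_in[OF x] by auto
    finally have "\<forall>\<^sub>F y in at x within {0..<1}. F s < y"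
      by (intro order_tendstoD(1)[OF tendsto_ident_at])
    with ev show ?thesis
    proof eventually_elim
      case (elim y)
      hence "s \<le> h y" using galois[of y s] s01 by auto
      thus ?case using s by simp
    qed
  qed
next
  fix x a assume x: "x \<in> {0..<1::real}" and a: "h x < a"
  have ev: "\<forall>\<^sub>F y in at x within {0..<1}. y \<in> {0..<1}" by (simp add: eventually_at_filter)
  show "\<forall>\<^sub>F y in at x within {0..<1}. h y < a"
  proof (cases "a > 1")
    case True
    from ev show ?thesis by eventually_elim (use h_in True in force)
  next
    case False
    hence a01: "a \<in> {0..1}" using a h_in[OF x] by auto
    hence "x < F a" using galois[OF x, of a] a by auto
    hence "\<forall>\<^sub>F y in at x within {0..<1}. y < F a"
      by (intro order_tendstoD(2)[OF tendsto_ident_at])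
    with ev show ?thesis
    proof eventually_elim
      case (elim y) thus ?case using galois[of y a] a01 by auto
    qed
  qed
qed

lemma F_lend_rend: "0 \<le> F (lend a)" "F (lend a) < F (rend a)" "F (rend a) \<le> 1"
  using F_mono[of 0 "lend a"] F_strict[of "lend a" "rend a"] F_mono[of "rend a" 1] F_0 F_1
    lend_nonneg[of a] lend_less_rend[of a] rend_le_1[of a] by auto

lemma J_iff: "x \<in> J a \<longleftrightarrow> x \<in> {0..<1} \<and> h x \<in> I a"
proof (cases "x \<in> {0..<1}")
  case True
  have "lend a \<in> {0..1}" "rend a \<in> {0..1}"
    using lend_nonneg[of a] lend_less_rend[of a] rend_le_1[of a] by auto
  thus ?thesis using galois[OF True, of "lend a"] galois[OF True, of "rend a"] True
    unfolding J_def I_iff by auto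
next
  case False thus ?thesis using F_lend_rend[of a] unfolding J_def by auto
qed

lemma J_partition: "interval_partition J"
  unfolding interval_partition_def
proof (intro conjI allI)
  fix a show "\<exists>u v. u < v \<and> J a = {u..<v}" unfolding J_def using F_lend_rend by blast
next
  show "disjoint_family J" unfolding disjoint_family_on_def using J_iff I_unique by blast
  show "(\<Union>a. J a) = {0..<1}" using J_iff h_in letter_in by blast
qed

lemma h_J: "h ` J a = I a"
proof
  show "h ` J a \<subseteq> I a" using J_iff by blast
  show "I a \<subseteq> h ` J a"
  proof
    fix t assume t: "t \<in> I a"
    hence "t \<in> {0..<1}" using I_subset by blast
    hence "h (F t) = t" "F t \<in> {0..<1}" using h_F F_in by blast+
    thus "t \<in> h ` J a" using t J_iff by (metis imageI)
  qed
qed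

lemma prob_image:
  assumes "A \<subseteq> I a" shows "\<mu> (T ` A) = l a * \<mu> A"
proof -
  have "inj_on T A" using assms I_subset T_inj by (meson inj_onI subsetD)
  hence "bij_betw T A (T ` A)" by (rule inj_on_imp_bij_betw)
  hence "\<mu> (T ` A) = infsetsum (\<lambda>t. pmf p (T t)) A"
    unfolding measure_pmf_conv_infsetsum by (subst infsetsum_reindex_bij_betw) auto
  also have "\<dots> = infsetsum (\<lambda>t. l a * pmf p t) A"
    using assms quasi_invariant by (intro infsetsum_cong) auto
  also have "\<dots> = l a * \<mu> A"
    unfolding measure_pmf_conv_infsetsum by (rule infsetsum_cmult_right) (rule pmf_abs_summable)
  finally show ?thesis .
qed

lemma F_image:
  assumes "s \<in> {lend a..rend a}"
  shows "F (T (lend a) + (s - lend a)) = F (T (lend a)) + l a * (F s - F (lend a))"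
proof -
  have "T ` {lend a..<s} = (\<lambda>t. t + shift a) ` {lend a..<s}"
    using assms by (intro image_cong refl T_on_I) (auto simp: I_iff)
  also have "\<dots> = {lend a + shift a..<s + shift a}" by (rule image_add_atLeastLessThan')
  also have "\<dots> = {T (lend a)..<T (lend a) + (s - lend a)}" unfolding shift_def by (simp add: algebra_simps)
  finally have "\<mu> {T (lend a)..<T (lend a) + (s - lend a)} = l a * \<mu> {lend a..<s}"
    using prob_image[of "{lend a..<s}" a] assms unfolding I_eq[of a] by simp
  thus ?thesis using F_diff[of "lend a" s] F_diff[of "T (lend a)" "T (lend a) + (s - lend a)"] assms by auto
qed

lemma f_eq: "x \<in> J a \<Longrightarrow> f x = F (T (lend a)) + l a * (x - F (lend a))"
  unfolding f_def Let_def using J_iff letter_eq by metis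

lemma image_bounds: "0 \<le> T (lend a)" "T (lend a) + (rend a - lend a) \<le> 1"
proof -
  have "T ` I a \<subseteq> {0..<1}" using T_in I_subset by blast
  hence "{T (lend a)..<T (lend a) + (rend a - lend a)} \<subseteq> {0..<1}" using image_I by simp
  thus "0 \<le> T (lend a)" "T (lend a) + (rend a - lend a) \<le> 1" using lend_less_rend[of a] by auto
qed

lemma f_in: assumes "x \<in> J a" shows "f x \<in> {0..<1}"
proof -
  have x: "F (lend a) \<le> x" "x < F (rend a)" using assms unfolding J_def by auto
  have "l a * (x - F (lend a)) < l a * (F (rend a) - F (lend a))" using l_pos x by simp
  hence "f x < F (T (lend a) + (rend a - lend a))"
    using f_eq[OF assms] F_image[of "rend a" a] lend_less_rend[of a] by simp
  also have "\<dots> \<le> 1" using F_mono[OF image_bounds(2)] F_1 by simp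
  finally have "f x < 1" .
  moreover have "0 \<le> F (T (lend a))" using F_mono[OF image_bounds(1)] F_0 by simp
  hence "0 \<le> f x" using f_eq[OF assms] l_pos[of a] x by simp
  ultimately show ?thesis by simp
qed

text \<open>By \<open>F_image\<close>, \<open>F s \<le> x\<close> holds exactly if \<open>F\<close>
  at the translate of \<open>s\<close> is at most \<open>f x\<close>. Through \<open>galois\<close>,
  \<open>T (h x)\<close> and \<open>h (f x)\<close> dominate the same translated points of the
  closed interval from \<open>lend a\<close> to \<open>rend a\<close>.\<close>

lemma h_f_J: assumes "x \<in> J a" shows "h (f x) = T (h x)"
proof -
  have x01: "x \<in> {0..<1}" and hx: "h x \<in> I a" using assms J_iff by blast+
  have *: "F s \<le> x \<longleftrightarrow> F (T (lend a) + (s - lend a)) \<le> f x" if "s \<in> {lend a..rend a}" for s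
  proof -
    have "F s \<le> x \<longleftrightarrow> l a * (F s - F (lend a)) \<le> l a * (x - F (lend a))" using l_pos[of a] by simp
    thus ?thesis using F_image[OF that] f_eq[OF assms] by simp
  qed
  have **: "s \<le> h x \<longleftrightarrow> T (lend a) + (s - lend a) \<le> h (f x)" if "s \<in> {lend a..rend a}" for s
  proof -
    have "s \<in> {0..1}" "T (lend a) + (s - lend a) \<in> {0..1}"
      using that lend_nonneg[of a] rend_le_1[of a] image_bounds[of a] by auto
    thus ?thesis using *[OF that] galois[OF x01] galois[OF f_in[OF assms]] by blast
  qed
  have Th: "T (h x) = T (lend a) + (h x - lend a)"
    using T_on_I[OF hx] T_on_I[OF lend_in[of a]] by simp
  have hx': "lend a \<le> h x" "h x < rend a" using hx by (auto simp: I_iff)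
  hence "T (h x) \<le> h (f x)" using **[of "h x"] Th by simp
  moreover have "\<not> T (h x) < h (f x)"
  proof
    assume lt: "T (h x) < h (f x)"
    \<comment> \<open>The cap \<open>rend a\<close> keeps \<open>s\<close> within the range of
      \<open>**\<close>; still \<open>h x < s\<close>, as \<open>h x < rend a\<close>.\<close>
    define s where "s = min (rend a) (h x + (h (f x) - T (h x)))"
    have "h x < s" "s \<in> {lend a..rend a}" using hx' lt unfolding s_def by auto
    moreover have "T (lend a) + (s - lend a) \<le> h (f x)" using Th unfolding s_def by simp
    ultimately show False using **[of s] by simp
  qed
  ultimately show ?thesis by simp
qed

lemma J_cover: "x \<in> {0..<1} \<Longrightarrow> \<exists>a. x \<in> J a"
  using J_partition unfolding interval_partition_def by blast

lemma h_f: "x \<in> {0..<1} \<Longrightarrow> h (f x) = T (h x)" and f_in_unit: "x \<in> {0..<1} \<Longrightarrow> f x \<in> {0..<1}"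
  using J_cover h_f_J f_in by blast+

lemma f_inj: assumes "x \<in> {0..<1}" "y \<in> {0..<1}" "f x = f y" shows "x = y"
proof -
  have "h x = h y" using h_f[OF assms(1)] h_f[OF assms(2)] assms(3) T_inj h_in assms(1,2) by metis
  moreover obtain a where "x \<in> J a" using J_cover assms by blast
  ultimately have "y \<in> J a" using J_iff assms by metis
  hence "l a * (x - F (lend a)) = l a * (y - F (lend a))"
    using assms(3) unfolding f_eq[OF \<open>x \<in> J a\<close>] f_eq[OF \<open>y \<in> J a\<close>] by linarith
  thus ?thesis using l_pos[of a] by simp
qed

lemma f_surj: assumes y: "y \<in> {0..<1}" shows "\<exists>x\<in>{0..<1}. f x = y"
proof -
  define t where "t = Tinv (h y)"
  have t: "t \<in> {0..<1}" "T t = h y" unfolding t_def using Tinv_in T_Tinv h_in y by auto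
  define a where "a = letter t"
  have a: "t \<in> I a" unfolding a_def using t by (intro letter_in)
  have "h y \<in> {T (lend a)..<T (lend a) + (rend a - lend a)}" using imageI[OF a, of T] unfolding image_I t(2) .
  moreover have "T (lend a) \<in> {0..1}" "T (lend a) + (rend a - lend a) \<in> {0..1}"
    using image_bounds[of a] lend_less_rend[of a] by auto
  ultimately have y': "F (T (lend a)) \<le> y" "y < F (T (lend a) + (rend a - lend a))"
    using galois[OF y, of "T (lend a)"] galois[OF y, of "T (lend a) + (rend a - lend a)"] by auto
  define x where "x = F (lend a) + (y - F (T (lend a))) / l a"
  have "y - F (T (lend a)) < l a * (F (rend a) - F (lend a))"
    using y'(2) F_image[of "rend a" a] lend_less_rend[of a] by simp
  hence "(y - F (T (lend a))) / l a < F (rend a) - F (lend a)"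
    using l_pos[of a] by (simp add: pos_divide_less_eq mult.commute)
  hence "x \<in> J a" using y'(1) l_pos[of a] unfolding x_def J_def by simp
  moreover have "f x = y" using f_eq[OF \<open>x \<in> J a\<close>] l_pos[of a] unfolding x_def by simp
  ultimately show ?thesis using J_iff by blast
qed

lemma f_bij: "bij_betw f {0..<1} {0..<1}"
  unfolding bij_betw_def using f_inj f_in_unit f_surj by (auto intro!: inj_onI simp del: atLeastLessThan_iff) (metis imageI)

lemma affine_f: "affine_interval_exchange f J (\<chi> a. l a)"
  unfolding affine_interval_exchange_def
proof (intro conjI allI f_bij J_partition)
  fix a show "0 < (\<chi> a. l a) $ a" using l_pos by simp
  show "\<exists>c. \<forall>t\<in>J a. f t = (\<chi> a. l a) $ a * t + c"
    using f_eq by (intro exI[of _ "F (T (lend a)) - l a * F (lend a)"]) (simp add: algebra_simps)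
qed

lemma semi_conjugacy_h: "semi_conjugacy h f T"
  unfolding semi_conjugacy_def
  using h_continuous h_surj h_mono h_f by (auto intro!: mono_onI simp del: atLeastLessThan_iff)

lemma h_int_iterate:
  assumes "x \<in> {0..<1}"
  shows "int_iterate f n x \<in> {0..<1} \<and> h (int_iterate f n x) = int_iterate T n (h x)"
proof -
  have fwd: "(f ^^ k) x \<in> {0..<1} \<and> h ((f ^^ k) x) = (T ^^ k) (h x)" for k
  proof (induction k)
    case (Suc k) thus ?case using f_in_unit[of "(f ^^ k) x"] h_f[of "(f ^^ k) x"] by simp
  qed (use assms in simp)
  define g where "g = inv_into {0..<1} f"
  have g: "g y \<in> {0..<1} \<and> h (g y) = Tinv (h y)" if y: "y \<in> {0..<1}" for y
  proof -
    have gy: "g y \<in> {0..<1}" "f (g y) = y"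
      using y f_bij unfolding g_def bij_betw_def by (metis inv_into_into, metis f_inv_into_f)
    thus ?thesis using h_f[OF gy(1)] Tinv_T h_in by metis
  qed
  have bwd: "(g ^^ k) x \<in> {0..<1} \<and> h ((g ^^ k) x) = (Tinv ^^ k) (h x)" for k
  proof (induction k)
    case (Suc k) thus ?case using g[of "(g ^^ k) x"] by simp
  qed (use assms in simp)
  show ?thesis unfolding int_iterate_def g_def[symmetric] Tinv_def[symmetric] using fwd bwd by simp
qed

text \<open>The atom at \<open>t0\<close> makes \<open>F\<close> jump, and \<open>h\<close> has the
  constant value \<open>t0\<close> inside the gap. The iterates of the gap lie over different points
  of the orbit.\<close>

lemma wandering:
  assumes t0: "t0 \<in> set_pmf p" and inj: "inj (\<lambda>n. int_iterate T n t0)"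
  shows "\<exists>W. wandering_interval f W"
proof -
  define W where "W = {F t0<..<F t0 + pmf p t0}"
  have t01: "t0 \<in> {0..<1}" using t0 set_p by blast
  have "{..t0} = {..<t0} \<union> {t0}" by auto
  hence G: "\<mu> {..t0} = F t0 + pmf p t0"
    unfolding F_def using measure_pmf.finite_measure_Union[of "{..<t0}" p "{t0}"] by (simp add: measure_pmf_single)
  have W01: "W \<subseteq> {0..<1}"
  proof
    fix x assume x: "x \<in> W"
    have "\<mu> {..t0} \<le> 1" by simp
    thus "x \<in> {0..<1}" using x F_in[OF t01] G unfolding W_def by auto
  qed
  have hW: "h x = t0" if x: "x \<in> W" for x
  proof (rule ccontr)
    have x01: "x \<in> {0..<1}" using x W01 by blast
    have "t0 \<le> h x" using galois[OF x01, of t0] x t01 unfolding W_def by auto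
    moreover assume "h x \<noteq> t0"
    ultimately have "t0 < h x" by simp
    hence "\<mu> {..t0} \<le> F (h x)" unfolding F_def by (intro measure_pmf.finite_measure_mono) auto
    also have "\<dots> \<le> x" using galois[OF x01, of "h x"] h_in[OF x01] by auto
    finally show False using x G unfolding W_def by simp
  qed
  have "F t0 < F t0 + pmf p t0" using t0 by (simp add: pmf_positive)
  hence W: "interior W \<noteq> {}" "is_interval W" unfolding W_def
    by (auto simp: interior_open is_interval_oo)
  have disj: "disjoint_family (\<lambda>n. int_iterate f n ` W)"
    unfolding disjoint_family_on_def
  proof (intro ballI impI)
    fix m n :: int assume "m \<noteq> n"
    have "int_iterate T m t0 \<noteq> int_iterate T n t0" using inj \<open>m \<noteq> n\<close> by (auto dest: injD)
    moreover have "h y = int_iterate T k t0" if "y \<in> int_iterate f k ` W" for y k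
      using that h_int_iterate hW W01 by force
    ultimately have "False" if "y \<in> int_iterate f m ` W" "y \<in> int_iterate f n ` W" for y
      using that by metis
    thus "int_iterate f m ` W \<inter> int_iterate f n ` W = {}" by blast
  qed
  show ?thesis unfolding wandering_interval_def by (intro exI[of _ W] conjI W01 W disj)
qed

end

text \<open>Normalized, the weights are a distribution on the integers, which the injective orbit
  map carries to atoms on the orbit. At orbit points \<open>step\<close> is the quasi-invariance
  that \<open>blow_up\<close> asks for; elsewhere both sides vanish.\<close>

lemma (in iet) denjoy_construction:
  fixes m :: "int \<Rightarrow> real" and l :: "'a \<Rightarrow> real"
  assumes t0: "t0 \<in> {0..<1}"
    and inj: "inj (\<lambda>n. int_iterate T n t0)"
    and dense: "\<And>x y. 0 \<le> x \<Longrightarrow> x < y \<Longrightarrow> y \<le> 1 \<Longrightarrow> \<exists>n. int_iterate T n t0 \<in> {x..<y}"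
    and m: "\<And>n. m n > 0" "m summable_on UNIV"
    and step: "\<And>n. m (n + 1) = l (letter (int_iterate T n t0)) * m n"
    and l: "\<And>a. l a > 0"
  shows "\<exists>f J h. affine_interval_exchange f J (\<chi> a. l a) \<and> semi_conjugacy h f T \<and>
           (\<forall>a. h ` J a = I a) \<and> (\<exists>W. wandering_interval f W)"
proof -
  define orb where "orb n = int_iterate T n t0" for n
  have orb_inj: "inj orb" using inj unfolding orb_def .
  have orb_in: "orb n \<in> {0..<1}" for n unfolding orb_def by (rule int_iterate_in[OF t0])
  have orb_step: "orb (n + 1) = T (orb n)" for n unfolding orb_def by (rule int_iterate_add_1[OF t0])
  define S where "S = infsetsum m UNIV"
  have summ: "Infinite_Set_Sum.abs_summable_on m UNIV"
    using m summable_on_iff_abs_summable_on_real abs_summable_equivalent by blast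
  have nn: "(\<integral>\<^sup>+x. ennreal (m x) \<partial>count_space UNIV) = ennreal S"
    unfolding S_def using nn_integral_conv_infsetsum[OF summ] m(1) by (simp add: less_imp_le)
  have "S \<ge> m 0"
  proof -
    have "infsetsum m {0} \<le> S" unfolding S_def
      by (rule infsetsum_mono_neutral_left) (use m summ in \<open>auto intro: less_imp_le\<close>)
    thus ?thesis by simp
  qed
  hence S: "S > 0" using m(1)[of 0] by simp
  define q where "q = embed_pmf (\<lambda>n. m n / S)"
  have q: "pmf q n = m n / S" for n
    unfolding q_def
  proof (rule pmf_embed_pmf)
    show "0 \<le> m n / S" for n using m(1)[of n] S by simp
    have "(\<integral>\<^sup>+x. ennreal (m x / S) \<partial>count_space UNIV) = (\<integral>\<^sup>+x. ennreal (m x) / ennreal S \<partial>count_space UNIV)"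
      using S m(1) by (intro nn_integral_cong) (simp add: divide_ennreal less_imp_le)
    also have "\<dots> = ennreal S / ennreal S" unfolding nn[symmetric] by (rule nn_integral_divide) simp
    also have "\<dots> = 1" using S by (simp add: divide_ennreal)
    finally show "(\<integral>\<^sup>+x. ennreal (m x / S) \<partial>count_space UNIV) = 1" .
  qed
  define p where "p = map_pmf orb q"
  have p_orb: "pmf p (orb n) = m n / S" for n unfolding p_def using pmf_map_inj'[OF orb_inj] q by simp
  have "pmf q n \<noteq> 0" for n using q[of n] m(1)[of n] S by simp
  hence "set_pmf q = UNIV" by (auto simp: set_pmf_eq)
  hence orb_set: "set_pmf p = range orb" unfolding p_def by simp
  interpret blow_up T I p l
  proof
    show "set_pmf p \<subseteq> {0..<1}" unfolding orb_set using orb_in by blast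
    show "\<exists>t\<in>{x..<y}. t \<in> set_pmf p" if "0 \<le> x" "x < y" "y \<le> 1" for x y
      using dense[OF that] unfolding orb_set orb_def by blast
    show "l a > 0" for a by (rule l)
    show "pmf p (T t) = l a * pmf p t" if t: "t \<in> I a" for t a
    proof (cases "t \<in> range orb")
      case True
      then obtain n where n: "t = orb n" by blast
      hence "letter (int_iterate T n t0) = a" using letter_eq[OF t] unfolding orb_def by simp
      thus ?thesis using p_orb[of "n + 1"] p_orb[of n] step[of n] n orb_step[of n] by simp
    next
      case False
      have "T t \<notin> range orb"
      proof
        assume "T t \<in> range orb"
        then obtain n where "T t = orb n" by blast
        also have "orb n = T (orb (n - 1))" using orb_step[of "n - 1"] by simp
        finally have "t = orb (n - 1)" using T_inj orb_in t I_subset by blast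
        thus False using False by blast
      qed
      thus ?thesis using False orb_set by (simp add: pmf_eq_0_set_pmf[THEN iffD2])
    qed
  qed
  have "t0 = orb 0" unfolding orb_def int_iterate_def by simp
  hence "t0 \<in> set_pmf p" unfolding orb_set by blast
  from wandering[OF this inj] have "\<exists>W. wandering_interval f W" .
  thus ?thesis using affine_f semi_conjugacy_h h_J
    by (intro exI[of _ f] exI[of _ J] exI[of _ h] conjI allI)
qed

section \<open>Extreme points of the fractals\<close>

text \<open>Compactness of the space of sequences over a finite set, by a diagonal argument;
  convergence is eventual constancy of each coordinate.\<close>

lemma finite_valued_subsequence:
  fixes X :: "nat \<Rightarrow> nat \<Rightarrow> 'b"
  assumes "finite A" "\<And>n k. X n k \<in> A"
  shows "\<exists>r x. strict_mono r \<and> (\<forall>k. \<forall>\<^sub>F n in sequentially. X (r n) k = x k)"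
proof -
  define P where "P k s \<longleftrightarrow> (\<exists>v. \<forall>i. X (s i) k = v)" for k and s :: "nat \<Rightarrow> nat"
  interpret subseqs P
  proof
    fix k and s :: "nat \<Rightarrow> nat" assume "strict_mono s"
    have "finite (range (\<lambda>i. X (s i) k))" using assms by (intro finite_subset[OF _ assms(1)]) auto
    then obtain v where v: "infinite {i. X (s i) k = v}"
      using pigeonhole_infinite[of UNIV "\<lambda>i. X (s i) k"] infinite_UNIV_nat by auto
    define r where "r = enumerate {i. X (s i) k = v}"
    have "strict_mono r" unfolding r_def using v by (simp add: strict_mono_enumerate)
    moreover have "X (s (r i)) k = v" for i unfolding r_def using enumerate_in_set[OF v, of i] by simp
    ultimately show "\<exists>r'. strict_mono r' \<and> P k (s \<circ> r')" unfolding P_def by auto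
  qed
  have "\<exists>v. \<forall>\<^sub>F n in sequentially. X (diagseq n) k = v" for k
  proof -
    have "P k (diagseq \<circ> ((+) (Suc k)))" by (rule diagseq_holds) (auto simp: P_def)
    then obtain v where v: "\<And>i. X (diagseq (Suc k + i)) k = v" unfolding P_def by auto
    have "X (diagseq n) k = v" if "n \<ge> Suc k" for n using v[of "n - Suc k"] that by simp
    thus ?thesis by (intro exI[of _ v] eventually_mono[OF eventually_ge_at_top[of "Suc k"]])
  qed
  then obtain x where "\<And>k. \<forall>\<^sub>F n in sequentially. X (diagseq n) k = x k" by metis
  thus ?thesis using subseq_diagseq by blast
qed

lemma word_value_Nil [simp]: "word_value \<gamma> [] = 0"
  and word_value_Cons [simp]: "word_value \<gamma> (a # w) = \<gamma> $ a + word_value \<gamma> w"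
  and word_value_append [simp]: "word_value \<gamma> (v @ w) = word_value \<gamma> v + word_value \<gamma> w"
  by (auto simp: word_value_def)

locale eigen_subst =
  fixes \<sigma> :: "'a::finite \<Rightarrow> 'a list" and \<beta> :: complex and \<Gamma> :: "complex^'a"
  assumes nonempty: "\<And>a. \<sigma> a \<noteq> []" and beta: "cmod \<beta> > 1"
    and eigen: "\<And>a. word_value \<Gamma> (\<sigma> a) = \<beta> * \<Gamma> $ a"
begin

abbreviation "wv \<equiv> word_value \<Gamma>"
abbreviation "S \<equiv> prefix_suffix_seqs \<sigma>"
abbreviation "\<zeta> \<equiv> zeta \<beta> \<Gamma>"

definition splits :: "('a list \<times> 'a \<times> 'a list) set" where
  "splits = {(p, c, s). \<exists>a. \<sigma> a = p @ [c] @ s}"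

text \<open>A bound \<open>B\<close> on the digit values bounds the series by the sum of
  \<open>B / |\<beta>|^m\<close> over positive \<open>m\<close>, which is
  \<open>B / (|\<beta>| - 1)\<close>.\<close>

definition radius :: real where
  "radius = Max ((\<lambda>t. cmod (wv (fst t))) ` splits) / (cmod \<beta> - 1)"

lemma beta_nz: "\<beta> \<noteq> 0" using beta by auto

lemma inverse_beta: "0 < 1 / cmod \<beta>" "1 / cmod \<beta> < 1"
  using beta by (auto simp: divide_less_eq)

lemma wv_subst: "wv (subst_word \<sigma> w) = \<beta> * wv w"
  by (induction w) (auto simp: eigen distrib_left)

lemma wv_subst_pow: "wv ((subst_word \<sigma> ^^ n) w) = \<beta> ^ n * wv w"
  by (induction n) (auto simp: wv_subst)

lemma finite_splits: "finite splits"
proof -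
  have "splits \<subseteq> (\<Union>a. (\<lambda>i. (take i (\<sigma> a), \<sigma> a ! i, drop (Suc i) (\<sigma> a))) ` {..<length (\<sigma> a)})"
  proof
    fix t assume "t \<in> splits"
    then obtain p c s a where t: "t = (p, c, s)" "\<sigma> a = p @ [c] @ s" unfolding splits_def by auto
    hence "t = (take (length p) (\<sigma> a), \<sigma> a ! length p, drop (Suc (length p)) (\<sigma> a))" "length p < length (\<sigma> a)"
      by auto
    thus "t \<in> (\<Union>a. (\<lambda>i. (take i (\<sigma> a), \<sigma> a ! i, drop (Suc i) (\<sigma> a))) ` {..<length (\<sigma> a)})" by blast
  qed
  thus ?thesis by (rule finite_subset) auto
qed

lemma S_iff: "x \<in> S a \<longleftrightarrow> \<sigma> a = fst (x 0) @ [fst (snd (x 0))] @ snd (snd (x 0)) \<and>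
    (\<forall>k. \<sigma> (fst (snd (x k))) = fst (x (Suc k)) @ [fst (snd (x (Suc k)))] @ snd (snd (x (Suc k))))"
  unfolding prefix_suffix_seqs_def by (simp add: case_prod_beta)

lemma S_splits: assumes "x \<in> S a" shows "x k \<in> splits"
proof (cases k)
  case 0
  thus ?thesis using assms unfolding S_iff splits_def by (auto simp: case_prod_beta)
next
  case (Suc j)
  thus ?thesis using assms unfolding S_iff splits_def by (auto simp: case_prod_beta)
qed

lemma shift_in_S: "x \<in> S a \<Longrightarrow> (\<lambda>k. x (Suc k)) \<in> S (fst (snd (x 0)))"
  unfolding S_iff by auto

lemma cons_in_S: "\<sigma> a = p @ [c] @ s \<Longrightarrow> y \<in> S c \<Longrightarrow> case_nat (p, c, s) y \<in> S a"
  unfolding S_iff by (auto split: nat.split)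

lemma S_nonempty: "\<exists>x. x \<in> S a"
proof -
  define b where "b k = ((\<lambda>c. hd (\<sigma> c)) ^^ k) a" for k
  have "(\<lambda>k. ([], hd (\<sigma> (b k)), tl (\<sigma> (b k)))) \<in> S a"
    unfolding S_iff using nonempty by (simp add: b_def)
  thus ?thesis by blast
qed

lemma radius_bound: "t \<in> splits \<Longrightarrow> cmod (wv (fst t)) \<le> radius * (cmod \<beta> - 1)"
  unfolding radius_def using beta finite_splits by (auto intro!: Max_ge)

lemma zeta_term_bound:
  assumes "x \<in> S a"
  shows "norm (wv (fst (x k)) / \<beta> ^ Suc k) \<le> radius * (cmod \<beta> - 1) * (1 / cmod \<beta>) ^ Suc k"
  using divide_right_mono[OF radius_bound[OF S_splits[OF assms, of k]], of "cmod \<beta> ^ Suc k"]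
  by (simp only: norm_divide norm_power power_one_over) (simp add: divide_inverse)

lemma zeta_summable: assumes "x \<in> S a" shows "summable (\<lambda>k. wv (fst (x k)) / \<beta> ^ Suc k)"
proof (rule summable_comparison_test')
  show "summable (\<lambda>k. radius * (cmod \<beta> - 1) * (1 / cmod \<beta>) ^ Suc k)"
    using inverse_beta by (intro summable_mult summable_ignore_initial_segment[of _ 1, simplified] summable_geometric) auto
qed (use zeta_term_bound[OF assms] in auto)

lemma zeta_shift:
  assumes "x \<in> S a"
  shows "\<zeta> x = (wv (fst (x 0)) + \<zeta> (\<lambda>k. x (Suc k))) / \<beta>"
proof -
  have "\<zeta> x = wv (fst (x 0)) / \<beta> + (\<Sum>k. wv (fst (x (Suc k))) / \<beta> ^ Suc (Suc k))"
    unfolding zeta_def using suminf_split_head[OF zeta_summable[OF assms]] by simp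
  also have "(\<Sum>k. wv (fst (x (Suc k))) / \<beta> ^ Suc (Suc k)) = (\<Sum>k. (wv (fst (x (Suc k))) / \<beta> ^ Suc k) / \<beta>)"
    by (simp add: mult.commute)
  also have "\<dots> = \<zeta> (\<lambda>k. x (Suc k)) / \<beta>"
    unfolding zeta_def using zeta_summable[OF shift_in_S[OF assms]] by (rule suminf_divide)
  finally show ?thesis by (simp add: add_divide_distrib)
qed

lemma beta_zeta: "x \<in> S a \<Longrightarrow> \<beta> * \<zeta> x = wv (fst (x 0)) + \<zeta> (\<lambda>k. x (Suc k))"
  using zeta_shift[of x a] beta_nz by simp

lemma zeta_bound: assumes "x \<in> S a" shows "cmod (\<zeta> x) \<le> radius"
proof -
  define q where "q = 1 / cmod \<beta>"
  have q: "0 < q" "q < 1" unfolding q_def by (rule inverse_beta)+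
  have "(\<lambda>k. radius * (cmod \<beta> - 1) * q * q ^ k) sums (radius * (cmod \<beta> - 1) * q * (1 / (1 - q)))"
    using q by (intro sums_mult geometric_sums) auto
  moreover have "radius * (cmod \<beta> - 1) * q * (1 / (1 - q)) = radius"
  proof -
    have "(cmod \<beta> - 1) * q = 1 - q" unfolding q_def using beta_nz by (simp add: field_simps)
    thus ?thesis using q by (simp add: mult.assoc)
  qed
  ultimately have s: "(\<lambda>k. radius * (cmod \<beta> - 1) * q ^ Suc k) sums radius" by (simp add: mult.assoc)
  have "cmod (\<zeta> x) \<le> (\<Sum>k. radius * (cmod \<beta> - 1) * q ^ Suc k)"
    unfolding zeta_def
    by (rule norm_suminf_le) (use s zeta_term_bound[OF assms] in \<open>auto simp: q_def dest: sums_summable\<close>)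
  thus ?thesis using s by (simp add: sums_unique[symmetric])
qed

lemma zeta_close:
  assumes "x \<in> S a" "y \<in> S b" "\<And>k. k < n \<Longrightarrow> x k = y k"
  shows "cmod (\<zeta> x - \<zeta> y) \<le> 2 * radius / cmod \<beta> ^ n"
  using assms
proof (induction n arbitrary: x y a b)
  case 0
  thus ?case using norm_triangle_ineq4[of "\<zeta> x" "\<zeta> y"] zeta_bound[of x a] zeta_bound[of y b] by simp
next
  case (Suc n)
  have "\<zeta> x - \<zeta> y = (\<zeta> (\<lambda>k. x (Suc k)) - \<zeta> (\<lambda>k. y (Suc k))) / \<beta>"
    using zeta_shift[OF Suc.prems(1)] zeta_shift[OF Suc.prems(2)] Suc.prems(3)[of 0]
    by (simp add: diff_divide_distrib add_divide_distrib)
  moreover have "cmod (\<zeta> (\<lambda>k. x (Suc k)) - \<zeta> (\<lambda>k. y (Suc k))) \<le> 2 * radius / cmod \<beta> ^ n"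
    by (rule Suc.IH[OF shift_in_S[OF Suc.prems(1)] shift_in_S[OF Suc.prems(2)]]) (use Suc.prems(3) in auto)
  ultimately have "cmod (\<zeta> x - \<zeta> y) \<le> 2 * radius / cmod \<beta> ^ n / cmod \<beta>"
    by (simp only: norm_divide) (simp only: divide_right_mono norm_ge_zero)
  thus ?case by (simp add: mult.commute)
qed

text \<open>Each condition on a sequence involves at most two neighbouring digits and so passes to
  the limit. Continuity of \<open>\<zeta>\<close> comes from \<open>zeta_close\<close>: beyond a
  long common beginning the tails are negligible.\<close>

lemma S_limit:
  assumes "\<forall>\<^sub>F n in sequentially. X n \<in> S a" "\<And>k. \<forall>\<^sub>F n in sequentially. X n k = x k"
  shows "x \<in> S a" "(\<lambda>n. \<zeta> (X n)) \<longlonglongrightarrow> \<zeta> x"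
proof -
  show x: "x \<in> S a" unfolding S_iff
  proof (intro conjI allI)
    have "\<forall>\<^sub>F n in sequentially. X n \<in> S a \<and> X n 0 = x 0" using assms by (intro eventually_conj) auto
    then obtain n where "X n \<in> S a" "X n 0 = x 0" using eventually_happens'[OF sequentially_bot] by blast
    thus "\<sigma> a = fst (x 0) @ [fst (snd (x 0))] @ snd (snd (x 0))" unfolding S_iff by metis
    fix k
    have "\<forall>\<^sub>F n in sequentially. X n \<in> S a \<and> X n k = x k \<and> X n (Suc k) = x (Suc k)"
      using assms by (intro eventually_conj) auto
    then obtain n where "X n \<in> S a" "X n k = x k" "X n (Suc k) = x (Suc k)"
      using eventually_happens'[OF sequentially_bot] by blast
    thus "\<sigma> (fst (snd (x k))) = fst (x (Suc k)) @ [fst (snd (x (Suc k)))] @ snd (snd (x (Suc k)))"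
      unfolding S_iff by metis
  qed
  show "(\<lambda>n. \<zeta> (X n)) \<longlonglongrightarrow> \<zeta> x"
  proof (rule tendstoI)
    fix e :: real assume "e > 0"
    have "(\<lambda>N. 2 * radius * (1 / cmod \<beta>) ^ N) \<longlonglongrightarrow> 2 * radius * 0"
      using inverse_beta by (intro tendsto_mult tendsto_const LIMSEQ_power_zero) auto
    hence "\<forall>\<^sub>F N in sequentially. 2 * radius * (1 / cmod \<beta>) ^ N < e"
      using \<open>e > 0\<close> by (intro order_tendstoD(2)) auto
    then obtain N where N: "2 * radius * (1 / cmod \<beta>) ^ N < e"
      using eventually_happens'[OF sequentially_bot] by blast
    have "\<forall>\<^sub>F n in sequentially. \<forall>k\<in>{..<N}. X n k = x k"
      using assms(2) by (intro eventually_ball_finite) auto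
    with assms(1) show "\<forall>\<^sub>F n in sequentially. dist (\<zeta> (X n)) (\<zeta> x) < e"
    proof eventually_elim
      case (elim n)
      have "cmod (\<zeta> (X n) - \<zeta> x) \<le> 2 * radius / cmod \<beta> ^ N"
        by (rule zeta_close[OF elim(1) x]) (use elim(2) in auto)
      thus ?case using N by (simp add: dist_norm power_one_over)
    qed
  qed
qed

text \<open>The direction \<open>w\<close> is not normalized: at level \<open>k\<close> it is
  \<open>z * \<beta>^k\<close>, so that values are compared in the scale of Birkhoff sums and not in
  that of the fractal.\<close>

definition minimizer :: "complex \<Rightarrow> 'a \<Rightarrow> (nat \<Rightarrow> 'a list \<times> 'a \<times> 'a list) \<Rightarrow> bool" where
  "minimizer w a x \<longleftrightarrow> x \<in> S a \<and> (\<forall>y\<in>S a. Re (w * \<zeta> x) \<le> Re (w * \<zeta> y))"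

lemma minimizer_exists: "\<exists>x. minimizer w a x"
proof -
  define V where "V = (\<lambda>x. Re (w * \<zeta> x)) ` S a"
  define v where "v = Inf V"
  have V: "V \<noteq> {}" "bdd_below V"
  proof -
    show "V \<noteq> {}" using S_nonempty unfolding V_def by auto
    have "- (cmod w * radius) \<le> Re (w * \<zeta> x)" if "x \<in> S a" for x
    proof -
      have "\<bar>Re (w * \<zeta> x)\<bar> \<le> cmod w * cmod (\<zeta> x)" using abs_Re_le_cmod[of "w * \<zeta> x"] by (simp add: norm_mult)
      also have "\<dots> \<le> cmod w * radius" using zeta_bound[OF that] by (simp add: mult_left_mono)
      finally show ?thesis by linarith
    qed
    thus "bdd_below V" unfolding V_def by (auto intro!: bdd_belowI)
  qed
  have "\<exists>x\<in>S a. Re (w * \<zeta> x) < v + 1 / Suc n" for n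
    using cInf_lessD[of V "v + 1 / Suc n"] V unfolding v_def V_def by auto
  then obtain X where X: "\<And>n. X n \<in> S a" "\<And>n. Re (w * \<zeta> (X n)) < v + 1 / Suc n" by metis
  obtain r x where r: "strict_mono r" "\<And>k. \<forall>\<^sub>F n in sequentially. X (r n) k = x k"
    using finite_valued_subsequence[OF finite_splits, of X] S_splits[OF X(1)] by metis
  have "\<forall>\<^sub>F n in sequentially. X (r n) \<in> S a" using X by simp
  note lim = S_limit[OF this r(2)]
  have "(\<lambda>n. Re (w * \<zeta> (X (r n)))) \<longlonglongrightarrow> Re (w * \<zeta> x)"
    by (intro tendsto_intros lim)
  moreover have "(\<lambda>n. v + 1 / Suc (r n)) \<longlonglongrightarrow> v + 0"
    by (intro tendsto_intros LIMSEQ_subseq_LIMSEQ[OF LIMSEQ_inverse_real_of_nat r(1), unfolded o_def inverse_eq_divide])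
  ultimately have "Re (w * \<zeta> x) \<le> v + 0"
    by (rule LIMSEQ_le) (use X(2) in \<open>auto intro: less_imp_le\<close>)
  moreover have "v \<le> Re (w * \<zeta> y)" if "y \<in> S a" for y
    unfolding v_def by (rule cInf_lower) (use that V in \<open>auto simp: V_def\<close>)
  ultimately have "minimizer w a x" unfolding minimizer_def using lim(1) by fastforce
  thus ?thesis by blast
qed

text \<open>Principle of optimality: by \<open>beta_zeta\<close> the functional is a contribution of
  the first digit plus the functional of the tail, so a better tail would improve \<open>x\<close>.
  The shift absorbs one factor \<open>\<beta>\<close>.\<close>

lemma minimizer_shift:
  assumes "minimizer (w * \<beta>) a x"
  shows "minimizer w (fst (snd (x 0))) (\<lambda>k. x (Suc k))"
  unfolding minimizer_def
proof (intro conjI ballI)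
  have x: "x \<in> S a" using assms unfolding minimizer_def by blast
  show "(\<lambda>k. x (Suc k)) \<in> S (fst (snd (x 0)))" by (rule shift_in_S[OF x])
  fix y assume y: "y \<in> S (fst (snd (x 0)))"
  define x' where "x' = case_nat (fst (x 0), fst (snd (x 0)), snd (snd (x 0))) y"
  have "\<sigma> a = fst (x 0) @ [fst (snd (x 0))] @ snd (snd (x 0))" using x unfolding S_iff by blast
  hence x': "x' \<in> S a" unfolding x'_def using y by (rule cons_in_S)
  have "Re (w * \<beta> * \<zeta> x) \<le> Re (w * \<beta> * \<zeta> x')" using assms x' unfolding minimizer_def by blast
  moreover have "w * \<beta> * \<zeta> x = w * wv (fst (x 0)) + w * \<zeta> (\<lambda>k. x (Suc k))"
    by (simp only: mult.assoc beta_zeta[OF x] distrib_left)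
  moreover have "w * \<beta> * \<zeta> x' = w * wv (fst (x 0)) + w * \<zeta> y"
    by (simp only: mult.assoc beta_zeta[OF x'] distrib_left) (simp add: x'_def)
  ultimately show "Re (w * \<zeta> (\<lambda>k. x (Suc k))) \<le> Re (w * \<zeta> y)" by simp
qed

definition near_min :: "real \<Rightarrow> complex \<Rightarrow> 'a \<Rightarrow> (nat \<Rightarrow> 'a list \<times> 'a \<times> 'a list) \<Rightarrow> bool" where
  "near_min e w a x \<longleftrightarrow> x \<in> S a \<and> (\<forall>y\<in>S a. Re (w * \<zeta> x) \<le> Re (w * \<zeta> y) + e)"

text \<open>Quantitative form of the unique representation property, by compactness.\<close>

lemma uniform_separation:
  assumes urp: "unique_representation_property \<sigma> \<beta> \<Gamma>"
  shows "\<exists>e>0. \<forall>a \<tau> x y. cmod \<tau> = 1 \<longrightarrow> near_min e \<tau> a x \<longrightarrow> near_min e \<tau> a y \<longrightarrow> x 0 \<noteq> y 0 \<longrightarrow>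
           e \<le> cmod (\<zeta> x - \<zeta> y)"
proof (rule ccontr)
  assume neg: "\<not> ?thesis"
  have "\<exists>a \<tau> x y. cmod \<tau> = 1 \<and> near_min (1 / Suc n) \<tau> a x \<and> near_min (1 / Suc n) \<tau> a y \<and> x 0 \<noteq> y 0 \<and>
       cmod (\<zeta> x - \<zeta> y) < 1 / Suc n" for n
  proof (rule ccontr)
    assume "\<not> ?thesis"
    hence "\<forall>a \<tau> x y. cmod \<tau> = 1 \<longrightarrow> near_min (1 / Suc n) \<tau> a x \<longrightarrow> near_min (1 / Suc n) \<tau> a y \<longrightarrow> x 0 \<noteq> y 0 \<longrightarrow>
       1 / Suc n \<le> cmod (\<zeta> x - \<zeta> y)" using not_less by blast
    moreover have "1 / real (Suc n) > 0" by simp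
    ultimately show False using neg by blast
  qed
  then obtain a0 \<tau>0 x0 y0 where A0: "\<And>n. cmod (\<tau>0 n) = 1" "\<And>n. near_min (1 / Suc n) (\<tau>0 n) (a0 n) (x0 n)"
      "\<And>n. near_min (1 / Suc n) (\<tau>0 n) (a0 n) (y0 n)" "\<And>n. x0 n 0 \<noteq> y0 n 0"
      "\<And>n. cmod (\<zeta> (x0 n) - \<zeta> (y0 n)) < 1 / Suc n"
    by metis
  have "\<tau>0 n \<in> sphere 0 1" for n using A0(1) by simp
  then obtain \<tau> r1 where r1: "\<tau> \<in> sphere 0 1" "strict_mono r1" "(\<tau>0 \<circ> r1) \<longlonglongrightarrow> \<tau>"
    using compact_sphere[of "0::complex" 1] unfolding compact_def by blast
  \<comment> \<open>Bundled, because one subsequence has to serve the letter and both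
    sequences.\<close>
  define Z where "Z n k = (a0 (r1 n), x0 (r1 n) k, y0 (r1 n) k)" for n k
  have "Z n k \<in> UNIV \<times> splits \<times> splits" for n k
    using A0(2,3) S_splits unfolding Z_def near_min_def by blast
  moreover have "finite (UNIV \<times> splits \<times> splits :: ('a \<times> _) set)" using finite_splits by simp
  ultimately obtain r2 z where r2: "strict_mono r2" "\<And>k. \<forall>\<^sub>F n in sequentially. Z (r2 n) k = z k"
    using finite_valued_subsequence[of _ Z] by metis
  define r where "r = r1 \<circ> r2"
  have r: "strict_mono r" unfolding r_def using r1 r2 by (intro strict_mono_o)
  define a where "a = fst (z 0)"
  define x where "x k = fst (snd (z k))" for k
  define y where "y k = snd (snd (z k))" for k
  have xk: "\<forall>\<^sub>F n in sequentially. x0 (r n) k = x k" for k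
    using r2(2)[of k] by eventually_elim (metis Z_def x_def r_def o_apply fst_conv snd_conv)
  have yk: "\<forall>\<^sub>F n in sequentially. y0 (r n) k = y k" for k
    using r2(2)[of k] by eventually_elim (metis Z_def y_def r_def o_apply fst_conv snd_conv)
  have ak: "\<forall>\<^sub>F n in sequentially. a0 (r n) = a"
    using r2(2)[of 0] by eventually_elim (metis Z_def a_def r_def o_apply fst_conv)
  have "\<forall>\<^sub>F n in sequentially. x0 (r n) \<in> S a" "\<forall>\<^sub>F n in sequentially. y0 (r n) \<in> S a"
    using ak A0(2,3) unfolding near_min_def by (auto elim!: eventually_mono)
  note xl = S_limit[OF this(1) xk] and yl = S_limit[OF this(2) yk]
  have tau: "(\<lambda>n. \<tau>0 (r n)) \<longlonglongrightarrow> \<tau>"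
    using LIMSEQ_subseq_LIMSEQ[OF r1(3) r2(1)] by (simp add: o_def r_def)
  have small: "(\<lambda>n. 1 / Suc (r n)) \<longlonglongrightarrow> 0"
    using LIMSEQ_subseq_LIMSEQ[OF LIMSEQ_inverse_real_of_nat r] by (simp add: o_def inverse_eq_divide)
  have min: "Re (\<tau> * \<zeta> x) \<le> Re (\<tau> * \<zeta> x')" "Re (\<tau> * \<zeta> y) \<le> Re (\<tau> * \<zeta> x')" if x': "x' \<in> S a" for x'
  proof -
    have R: "(\<lambda>n. Re (\<tau>0 (r n) * \<zeta> x') + 1 / Suc (r n)) \<longlonglongrightarrow> Re (\<tau> * \<zeta> x') + 0"
      by (intro tendsto_intros tau small)
    have "(\<lambda>n. Re (\<tau>0 (r n) * \<zeta> (x0 (r n)))) \<longlonglongrightarrow> Re (\<tau> * \<zeta> x)" by (intro tendsto_intros tau xl)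
    moreover have "\<forall>\<^sub>F n in sequentially. Re (\<tau>0 (r n) * \<zeta> (x0 (r n))) \<le> Re (\<tau>0 (r n) * \<zeta> x') + 1 / Suc (r n)"
      using ak by eventually_elim (use A0(2) x' in \<open>auto simp: near_min_def\<close>)
    ultimately show "Re (\<tau> * \<zeta> x) \<le> Re (\<tau> * \<zeta> x')"
      using tendsto_le[OF sequentially_bot R] by simp
    have "(\<lambda>n. Re (\<tau>0 (r n) * \<zeta> (y0 (r n)))) \<longlonglongrightarrow> Re (\<tau> * \<zeta> y)" by (intro tendsto_intros tau yl)
    moreover have "\<forall>\<^sub>F n in sequentially. Re (\<tau>0 (r n) * \<zeta> (y0 (r n))) \<le> Re (\<tau>0 (r n) * \<zeta> x') + 1 / Suc (r n)"
      using ak by eventually_elim (use A0(3) x' in \<open>auto simp: near_min_def\<close>)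
    ultimately show "Re (\<tau> * \<zeta> y) \<le> Re (\<tau> * \<zeta> x')"
      using tendsto_le[OF sequentially_bot R] by simp
  qed
  have "(\<lambda>n. cmod (\<zeta> (x0 (r n)) - \<zeta> (y0 (r n)))) \<longlonglongrightarrow> cmod (\<zeta> x - \<zeta> y)" by (intro tendsto_intros xl yl)
  hence "cmod (\<zeta> x - \<zeta> y) \<le> 0"
    using A0(5) by (intro tendsto_le[OF sequentially_bot small]) (auto intro!: always_eventually less_imp_le)
  hence eq: "\<zeta> x = \<zeta> y" by simp
  have "\<zeta> x \<in> extreme_points_dir (fractal \<sigma> \<beta> \<Gamma> a) \<tau>"
    unfolding extreme_points_dir_def fractal_def using xl(1) min(1) by auto
  moreover have "cmod \<tau> = 1" using r1(1) by simp
  ultimately have "x = y"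
    using urp xl(1) yl(1) eq unfolding unique_representation_property_def by metis
  \<comment> \<open>First digits are eventually constant along the subsequence, so distinct ones
    stay distinct in the limit.\<close>
  moreover have "\<forall>\<^sub>F n in sequentially. x0 (r n) 0 = x 0 \<and> y0 (r n) 0 = y 0" using xk yk by (intro eventually_conj)
  then obtain n where "x0 (r n) 0 = x 0" "y0 (r n) 0 = y 0"
    using eventually_happens'[OF sequentially_bot] by blast
  ultimately show False using A0(4)[of "r n"] by simp
qed

end

section \<open>Almost every direction\<close>

text \<open>Directions with two far apart near-extreme points are rare because the abscissa of an
  extreme point is monotone in the direction and jumps by at least \<open>e / 2\<close> there.\<close>

lemma two_near_minima_cover:
  fixes F :: "complex set" and R c e :: real
  assumes R: "\<And>\<zeta>. \<zeta> \<in> F \<Longrightarrow> \<bar>Im \<zeta>\<bar> \<le> R" and "e > 0" "c \<ge> 0"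
  defines "near \<equiv> \<lambda>s \<zeta>. \<zeta> \<in> F \<and> (\<forall>\<zeta>'\<in>F. Re \<zeta> - s * Im \<zeta> \<le> Re \<zeta>' - s * Im \<zeta>' + c)"
  defines "X \<equiv> {s. \<exists>\<zeta>1 \<zeta>2. near s \<zeta>1 \<and> near s \<zeta>2 \<and> e \<le> \<bar>Im \<zeta>1 - Im \<zeta>2\<bar>}"
  shows "\<exists>m :: nat \<Rightarrow> real. X \<subseteq> (\<Union>j\<le>nat \<lceil>4 * R / e\<rceil>. {m j - 4 * c / e..m j + 4 * c / e})"
proof -
  have "\<exists>\<zeta>1 \<zeta>2. near s \<zeta>1 \<and> near s \<zeta>2 \<and> Im \<zeta>2 + e \<le> Im \<zeta>1" if "s \<in> X" for s
    using that unfolding X_def by (smt (verit) mem_Collect_eq)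
  then obtain f g where fg: "\<And>s. s \<in> X \<Longrightarrow> near s (f s)" "\<And>s. s \<in> X \<Longrightarrow> near s (g s)"
     "\<And>s. s \<in> X \<Longrightarrow> Im (g s) + e \<le> Im (f s)" by metis
  define d where "d = 4 * c / e"
  have step: "Im (f s1) + e / 2 \<le> Im (f s2)" if s: "s1 \<in> X" "s2 \<in> X" "s1 < s2" "d \<le> s2 - s1" for s1 s2
  proof -
    \<comment> \<open>The upper point \<open>f s1\<close> is compared with the lower point
      \<open>g s2\<close>: adding the two near-minimality inequalities cancels the real parts and
      leaves \<open>(s2 - s1) * D \<le> 2 * c\<close>.\<close>
    define D where "D = Im (f s1) - Im (g s2)"
    have "Re (f s1) - s1 * Im (f s1) \<le> Re (g s2) - s1 * Im (g s2) + c"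
      using fg(1)[OF s(1)] fg(2)[OF s(2)] unfolding near_def by blast
    moreover have "Re (g s2) - s2 * Im (g s2) \<le> Re (f s1) - s2 * Im (f s1) + c"
      using fg(1)[OF s(1)] fg(2)[OF s(2)] unfolding near_def by blast
    ultimately have "(s2 - s1) * D \<le> 2 * c" unfolding D_def by (simp add: algebra_simps)
    also have "2 * c = d * (e / 2)" unfolding d_def using \<open>e > 0\<close> by simp
    also have "\<dots> \<le> (s2 - s1) * (e / 2)" using s \<open>e > 0\<close> by (intro mult_right_mono) auto
    finally have "D \<le> e / 2" using s by simp
    thus ?thesis using fg(3)[OF s(2)] unfolding D_def by simp
  qed
  \<comment> \<open>The index of the cell of height \<open>e / 2\<close> that contains
    \<open>Im (f s)\<close>, counted from \<open>-R\<close>. By \<open>step\<close>, parameters with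
    the same index are at most \<open>d\<close> apart, so one interval per cell suffices.\<close>
  define v where "v s = nat \<lfloor>2 * (Im (f s) + R) / e\<rfloor>" for s
  have v: "v s \<le> nat \<lceil>4 * R / e\<rceil>" "real (v s) \<le> 2 * (Im (f s) + R) / e" "2 * (Im (f s) + R) / e < real (v s) + 1"
    if "s \<in> X" for s
  proof -
    have b: "\<bar>Im (f s)\<bar> \<le> R" using fg(1)[OF that] R unfolding near_def by blast
    have "2 * (Im (f s) + R) / e \<ge> 0" using b \<open>e > 0\<close> by simp
    thus v: "real (v s) \<le> 2 * (Im (f s) + R) / e" "2 * (Im (f s) + R) / e < real (v s) + 1"
      unfolding v_def by linarith+
    have "2 * (Im (f s) + R) / e \<le> 4 * R / e" using b \<open>e > 0\<close> by (intro divide_right_mono) auto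
    thus "v s \<le> nat \<lceil>4 * R / e\<rceil>" using v by linarith
  qed
  have close: "\<bar>s1 - s2\<bar> \<le> d" if s: "s1 \<in> X" "s2 \<in> X" "v s1 = v s2" for s1 s2
  proof -
    have *: "s2 - s1 < d" if s: "s1 \<in> X" "s2 \<in> X" "v s1 = v s2" "s1 < s2" for s1 s2
    proof (rule ccontr)
      assume "\<not> s2 - s1 < d"
      hence "Im (f s1) + e / 2 \<le> Im (f s2)" using step s by simp
      hence "2 * (Im (f s1) + e / 2 + R) / e \<le> 2 * (Im (f s2) + R) / e"
        using \<open>e > 0\<close> by (intro divide_right_mono) auto
      moreover have "2 * (Im (f s1) + e / 2 + R) / e = 2 * (Im (f s1) + R) / e + 1"
        using \<open>e > 0\<close> by (simp add: field_simps)
      ultimately have "2 * (Im (f s1) + R) / e + 1 \<le> 2 * (Im (f s2) + R) / e" by simp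
      thus False using v(2)[OF s(1)] v(3)[OF s(2)] s(3) by simp
    qed
    have d0: "0 \<le> d" unfolding d_def using assms(2,3) by simp
    show ?thesis
    proof (cases "s1 < s2")
      case True
      show ?thesis using *[OF s True] True by linarith
    next
      case False
      hence "s1 = s2 \<or> s2 < s1" by linarith
      thus ?thesis
      proof
        assume "s2 < s1"
        thus ?thesis using *[OF s(2,1) s(3)[symmetric]] by linarith
      next
        assume "s1 = s2"
        thus ?thesis using d0 by (simp only: diff_self abs_zero)
      qed
    qed
  qed
  define m where "m j = (SOME s. s \<in> X \<and> v s = j)" for j
  have "X \<subseteq> (\<Union>j\<le>nat \<lceil>4 * R / e\<rceil>. {m j - d..m j + d})"
  proof
    fix s assume s: "s \<in> X"
    have ms: "m (v s) \<in> X \<and> v (m (v s)) = v s"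
      unfolding m_def by (rule someI[of _ s]) (simp only: s simp_thms)
    have "\<bar>s - m (v s)\<bar> \<le> d" by (rule close[OF s]) (use ms in \<open>simp_all only: simp_thms\<close>)
    hence "s \<in> {m (v s) - d..m (v s) + d}" by auto
    thus "s \<in> (\<Union>j\<le>nat \<lceil>4 * R / e\<rceil>. {m j - d..m j + d})" using v(1)[OF s] by blast
  qed
  thus ?thesis unfolding d_def by blast
qed

lemma strip_eq_cbox: "{w. Re w \<in> {a..b} \<and> Im w \<in> {c..d}} = cbox (Complex a c) (Complex b d)"
  by (auto simp: in_cbox_complex_iff)

lemma emeasure_strip:
  assumes "a \<le> b" "c \<le> d"
  shows "{w. Re w \<in> {a..b} \<and> Im w \<in> {c..d}} \<in> sets (lborel :: complex measure)"
    "emeasure lborel {w. Re w \<in> {a..b} \<and> Im w \<in> {c..d}} = ennreal ((b - a) * (d - c))"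
proof -
  show "{w. Re w \<in> {a..b} \<and> Im w \<in> {c..d}} \<in> sets (lborel :: complex measure)"
    unfolding strip_eq_cbox by simp
  show "emeasure lborel {w. Re w \<in> {a..b} \<and> Im w \<in> {c..d}} = ennreal ((b - a) * (d - c))"
    unfolding strip_eq_cbox using assms
    by (subst emeasure_lborel_cbox) (auto simp: Basis_complex_def inner_complex_def)
qed

section \<open>Bad directions in slope coordinates, and Borel-Cantelli\<close>

context eigen_subst
begin

definition bad :: "real \<Rightarrow> nat \<Rightarrow> complex \<Rightarrow> bool" where
  "bad c k z \<longleftrightarrow> (\<exists>a x y. near_min c (z * \<beta> ^ k) a x \<and> near_min c (z * \<beta> ^ k) a y \<and> x 0 \<noteq> y 0)"

text \<open>For \<open>z = u * Complex 1 s\<close>, the functional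
  \<open>Re (z * \<beta>^k * w)\<close> is a positive multiple of \<open>Re - s * Im\<close> at the
  rotated point, and \<open>pos\<close> records the sign of \<open>u\<close>. In this form
  \<open>two_near_minima_cover\<close> applies with parameter \<open>s\<close>.\<close>

definition rotated :: "nat \<Rightarrow> 'a \<Rightarrow> bool \<Rightarrow> complex set" where
  "rotated k a pos = (\<lambda>x. (if pos then 1 else -1) * (\<beta> / of_real (cmod \<beta>)) ^ k * \<zeta> x) ` S a"

text \<open>Dividing by \<open>|u| * |\<beta>|^k\<close> turns the gap \<open>c\<close> into at most
  \<open>L * c / |\<beta>|^k\<close>. The separation constant \<open>e\<close> bounds the modulus of
  the difference of the two points from below. As \<open>Re - s * Im\<close> of the difference is at
  most \<open>e / 2\<close> and \<open>|s| \<le> L\<close>, the imaginary part has to account for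
  the rest.\<close>

lemma bad_slope:
  assumes e: "e > 0" "\<And>a \<tau> x y. cmod \<tau> = 1 \<Longrightarrow> near_min e \<tau> a x \<Longrightarrow> near_min e \<tau> a y \<Longrightarrow> x 0 \<noteq> y 0 \<Longrightarrow>
           e \<le> cmod (\<zeta> x - \<zeta> y)"
    and L: "L \<ge> 1" "1 / L \<le> \<bar>u\<bar>" "\<bar>s\<bar> \<le> L" and "c \<ge> 0"
    and c: "L * c / cmod \<beta> ^ k \<le> e / 2"
    and b: "bad c k (Complex u (u * s))"
  shows "\<exists>a pos \<zeta>1 \<zeta>2. \<zeta>1 \<in> rotated k a pos \<and> \<zeta>2 \<in> rotated k a pos \<and>
     (\<forall>\<zeta>'\<in>rotated k a pos. Re \<zeta>1 - s * Im \<zeta>1 \<le> Re \<zeta>' - s * Im \<zeta>' + L * c / cmod \<beta> ^ k) \<and>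
     (\<forall>\<zeta>'\<in>rotated k a pos. Re \<zeta>2 - s * Im \<zeta>2 \<le> Re \<zeta>' - s * Im \<zeta>' + L * c / cmod \<beta> ^ k) \<and>
     e / (2 * (1 + L)) \<le> \<bar>Im \<zeta>1 - Im \<zeta>2\<bar>"
proof -
  define z where "z = Complex u (u * s)"
  define B where "B = cmod \<beta> ^ k"
  define c' where "c' = L * c / B"
  have B: "B > 0" unfolding B_def using beta_nz by simp
  have u: "u \<noteq> 0" "1 / \<bar>u\<bar> \<le> L"
  proof -
    show "u \<noteq> 0" using L by auto
    thus "1 / \<bar>u\<bar> \<le> L" using L by (simp add: field_simps)
  qed
  obtain a x y where xy: "near_min c (z * \<beta> ^ k) a x" "near_min c (z * \<beta> ^ k) a y" "x 0 \<noteq> y 0"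
    using b unfolding bad_def z_def by blast
  define pos where "pos \<longleftrightarrow> u > 0"
  define \<rho> where "\<rho> = (if pos then 1 else -1) * (\<beta> / of_real (cmod \<beta>)) ^ k"
  have rot: "rotated k a pos = (\<lambda>x. \<rho> * \<zeta> x) ` S a" unfolding rotated_def \<rho>_def by simp
  have nrho: "cmod \<rho> = 1" unfolding \<rho>_def using beta_nz by (simp add: norm_mult norm_power norm_divide)
  have zb: "Re (z * \<beta> ^ k * w) = \<bar>u\<bar> * B * (Re (\<rho> * w) - s * Im (\<rho> * w))" for w
  proof -
    have "z * \<beta> ^ k = of_real (\<bar>u\<bar> * B) * Complex 1 s * \<rho>"
    proof -
      have "(\<beta> / of_real (cmod \<beta>)) ^ k = \<beta> ^ k / of_real B" unfolding B_def by (simp add: power_divide)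
      moreover have "z = of_real \<bar>u\<bar> * (if pos then 1 else -1) * Complex 1 s"
        unfolding z_def pos_def by (auto simp: complex_eq_iff)
      ultimately show ?thesis unfolding \<rho>_def using B by simp
    qed
    hence "z * \<beta> ^ k * w = of_real (\<bar>u\<bar> * B) * (Complex 1 s * (\<rho> * w))" by (simp add: mult.assoc)
    moreover have "Re (of_real r * v) = r * Re v" for r v by simp
    ultimately have "Re (z * \<beta> ^ k * w) = (\<bar>u\<bar> * B) * Re (Complex 1 s * (\<rho> * w))" by presburger
    thus ?thesis by (simp only: times_complex.sel complex.sel mult_1)
  qed
  have c': "c / (\<bar>u\<bar> * B) \<le> c'"
  proof -
    have "c / (\<bar>u\<bar> * B) = (1 / \<bar>u\<bar>) * (c / B)" by simp
    also have "\<dots> \<le> L * (c / B)" using u B \<open>c \<ge> 0\<close> by (intro mult_right_mono) auto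
    finally show ?thesis unfolding c'_def by simp
  qed
  have near: "Re (\<rho> * \<zeta> x) - s * Im (\<rho> * \<zeta> x) \<le> Re (\<rho> * \<zeta> y) - s * Im (\<rho> * \<zeta> y) + c'"
    if "near_min c (z * \<beta> ^ k) a x" "y \<in> S a" for x y
  proof -
    have "Re (z * \<beta> ^ k * \<zeta> x) \<le> Re (z * \<beta> ^ k * \<zeta> y) + c" using that unfolding near_min_def by blast
    hence "\<bar>u\<bar> * B * ((Re (\<rho> * \<zeta> x) - s * Im (\<rho> * \<zeta> x)) - (Re (\<rho> * \<zeta> y) - s * Im (\<rho> * \<zeta> y))) \<le> c"
      unfolding zb by (simp add: algebra_simps)
    hence "(Re (\<rho> * \<zeta> x) - s * Im (\<rho> * \<zeta> x)) - (Re (\<rho> * \<zeta> y) - s * Im (\<rho> * \<zeta> y)) \<le> c / (\<bar>u\<bar> * B)"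
      using u B by (simp add: field_simps)
    thus ?thesis using c' by simp
  qed
  have xS: "x \<in> S a" "y \<in> S a" using xy unfolding near_min_def by auto
  define \<tau> where "\<tau> = z * \<beta> ^ k / of_real (cmod (z * \<beta> ^ k))"
  have z0: "cmod (z * \<beta> ^ k) > 0" "cmod (z * \<beta> ^ k) \<ge> \<bar>u\<bar> * B"
  proof -
    have "\<bar>u\<bar> \<le> cmod z" using abs_Re_le_cmod[of z] unfolding z_def by simp
    thus "cmod (z * \<beta> ^ k) \<ge> \<bar>u\<bar> * B" unfolding B_def by (simp add: norm_mult norm_power mult_right_mono)
    moreover have "\<bar>u\<bar> * B > 0" using u B by simp
    ultimately show "cmod (z * \<beta> ^ k) > 0" by linarith
  qed
  have tau: "cmod \<tau> = 1" unfolding \<tau>_def using z0(1) by (simp add: norm_divide)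
  have near_tau: "near_min e \<tau> a x" if "near_min c (z * \<beta> ^ k) a x" for x
    unfolding near_min_def
  proof (intro conjI ballI)
    show "x \<in> S a" using that unfolding near_min_def by blast
    fix y assume y: "y \<in> S a"
    let ?n = "cmod (z * \<beta> ^ k)"
    have Rt: "Re (\<tau> * w) = Re (z * \<beta> ^ k * w) / ?n" for w
      unfolding \<tau>_def by (simp only: times_divide_eq_left Re_divide_of_real)
    have "Re (z * \<beta> ^ k * \<zeta> x) / ?n \<le> (Re (z * \<beta> ^ k * \<zeta> y) + c) / ?n"
      using that y z0(1) unfolding near_min_def by (intro divide_right_mono) auto
    also have "\<dots> = Re (z * \<beta> ^ k * \<zeta> y) / ?n + c / ?n" by (rule add_divide_distrib)
    also have "c / ?n \<le> c / (\<bar>u\<bar> * B)" using z0 u B \<open>c \<ge> 0\<close> by (intro divide_left_mono) auto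
    also have "\<dots> \<le> e" using c' c e(1) unfolding c'_def B_def by linarith
    finally show "Re (\<tau> * \<zeta> x) \<le> Re (\<tau> * \<zeta> y) + e" unfolding Rt by simp
  qed
  have "e \<le> cmod (\<zeta> x - \<zeta> y)" by (rule e(2)[OF tau near_tau[OF xy(1)] near_tau[OF xy(2)] xy(3)])
  also have "\<dots> = cmod (\<rho> * \<zeta> x - \<rho> * \<zeta> y)" using nrho by (simp add: norm_mult flip: right_diff_distrib)
  also have "\<dots> \<le> \<bar>Re (\<rho> * \<zeta> x - \<rho> * \<zeta> y)\<bar> + \<bar>Im (\<rho> * \<zeta> x - \<rho> * \<zeta> y)\<bar>" by (rule cmod_le)
  finally have sep: "e \<le> \<bar>Re (\<rho> * \<zeta> x) - Re (\<rho> * \<zeta> y)\<bar> + \<bar>Im (\<rho> * \<zeta> x) - Im (\<rho> * \<zeta> y)\<bar>" by simp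
  define DA where "DA = Re (\<rho> * \<zeta> x) - Re (\<rho> * \<zeta> y)"
  define DB where "DB = Im (\<rho> * \<zeta> x) - Im (\<rho> * \<zeta> y)"
  have "\<bar>DA - s * DB\<bar> \<le> c'"
    using near[OF xy(1) xS(2)] near[OF xy(2) xS(1)] unfolding DA_def DB_def by (simp add: algebra_simps abs_le_iff)
  hence "\<bar>DA\<bar> \<le> \<bar>s * DB\<bar> + c'" by linarith
  also have "\<bar>s * DB\<bar> \<le> L * \<bar>DB\<bar>" using L(3) by (simp add: abs_mult mult_right_mono)
  finally have "e \<le> (1 + L) * \<bar>DB\<bar> + c'" using sep unfolding DA_def[symmetric] DB_def[symmetric] by (simp add: algebra_simps)
  moreover have "c' \<le> e / 2" using c unfolding c'_def B_def .
  ultimately have "e / 2 \<le> (1 + L) * \<bar>DB\<bar>" by simp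
  hence "e / (2 * (1 + L)) \<le> \<bar>DB\<bar>" using L(1) by (simp add: field_simps)
  hence "e / (2 * (1 + L)) \<le> \<bar>Im (\<rho> * \<zeta> x) - Im (\<rho> * \<zeta> y)\<bar>" unfolding DB_def .
  moreover have "\<rho> * \<zeta> x \<in> rotated k a pos" "\<rho> * \<zeta> y \<in> rotated k a pos" unfolding rot using xS by auto
  moreover have "\<forall>\<zeta>'\<in>rotated k a pos. Re (\<rho> * \<zeta> x) - s * Im (\<rho> * \<zeta> x) \<le> Re \<zeta>' - s * Im \<zeta>' + L * c / cmod \<beta> ^ k"
    "\<forall>\<zeta>'\<in>rotated k a pos. Re (\<rho> * \<zeta> y) - s * Im (\<rho> * \<zeta> y) \<le> Re \<zeta>' - s * Im \<zeta>' + L * c / cmod \<beta> ^ k"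
    unfolding rot using near[OF xy(1)] near[OF xy(2)] unfolding c'_def B_def by auto
  ultimately show ?thesis by blast
qed

lemma rotated_bound: "\<zeta>1 \<in> rotated k a pos \<Longrightarrow> \<bar>Im \<zeta>1\<bar> \<le> radius"
proof -
  assume "\<zeta>1 \<in> rotated k a pos"
  then obtain x where x: "x \<in> S a" "\<zeta>1 = (if pos then 1 else -1) * (\<beta> / of_real (cmod \<beta>)) ^ k * \<zeta> x"
    unfolding rotated_def by blast
  have "cmod \<zeta>1 = cmod (\<zeta> x)" unfolding x(2) using beta_nz by (simp add: norm_mult norm_power norm_divide)
  thus ?thesis using abs_Im_le_cmod[of \<zeta>1] zeta_bound[OF x(1)] by simp
qed

lemma linear_over_power_summable: "summable (\<lambda>k. real k / cmod \<beta> ^ k)"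
proof -
  have "summable (\<lambda>k. real (Suc k) * (1 / cmod \<beta>) ^ k)"
    by (rule sums_summable[OF geometric_deriv_sums]) (use inverse_beta in auto)
  hence "summable (\<lambda>k. real k * (1 / cmod \<beta>) ^ k)"
    by (rule summable_comparison_test'[where N = 0]) (simp add: mult_right_mono)
  thus ?thesis by (simp add: power_one_over)
qed

text \<open>In the coordinates \<open>w = (u, s)\<close> the bad set of level \<open>k\<close> lies
  in a number of boxes independent of \<open>k\<close>, each of width \<open>2 * L\<close> and
  height \<open>2 * d k\<close>, where \<open>d k\<close> is a multiple of
  \<open>k / |\<beta>|^k\<close>. Measurability is only needed for the boxes.\<close>

lemma AE_bad_eventually_not_slope:
  assumes urp: "unique_representation_property \<sigma> \<beta> \<Gamma>" and "\<kappa> \<ge> 0" "L \<ge> 1"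
  shows "AE w in lborel. 1 / L \<le> \<bar>Re w\<bar> \<longrightarrow> \<bar>Re w\<bar> \<le> L \<longrightarrow> \<bar>Im w\<bar> \<le> L \<longrightarrow>
    (\<forall>\<^sub>F k in sequentially. \<not> bad (\<kappa> * real k) k (Complex (Re w) (Re w * Im w)))"
proof -
  obtain e where e: "e > 0" "\<And>a \<tau> x y. cmod \<tau> = 1 \<Longrightarrow> near_min e \<tau> a x \<Longrightarrow> near_min e \<tau> a y \<Longrightarrow> x 0 \<noteq> y 0 \<Longrightarrow>
           e \<le> cmod (\<zeta> x - \<zeta> y)"
    using uniform_separation[OF urp] by metis
  define e' where "e' = e / (2 * (1 + L))"
  have e': "e' > 0" unfolding e'_def using e \<open>L \<ge> 1\<close> by simp
  define c where "c k = L * (\<kappa> * real k) / cmod \<beta> ^ k" for k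
  have c0: "c k \<ge> 0" for k unfolding c_def using \<open>\<kappa> \<ge> 0\<close> \<open>L \<ge> 1\<close> by simp
  have csum: "summable c"
    using summable_mult[OF linear_over_power_summable, of "L * \<kappa>"] unfolding c_def by (simp add: mult.assoc)
  have "c \<longlonglongrightarrow> 0" by (rule summable_LIMSEQ_zero[OF csum])
  hence "\<forall>\<^sub>F k in sequentially. c k < e / 2" using e(1) by (intro order_tendstoD) auto
  then obtain k1 where k1: "\<And>k. k \<ge> k1 \<Longrightarrow> c k < e / 2" unfolding eventually_sequentially by blast
  define N where "N = nat \<lceil>4 * radius / e'\<rceil>"
  define d where "d k = 4 * c k / e'" for k
  have d0: "d k \<ge> 0" for k unfolding d_def using c0 e' by simp
  define X where "X k a pos = {s. \<exists>\<zeta>1 \<zeta>2. (\<zeta>1 \<in> rotated k a pos \<and>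
      (\<forall>\<zeta>'\<in>rotated k a pos. Re \<zeta>1 - s * Im \<zeta>1 \<le> Re \<zeta>' - s * Im \<zeta>' + c k)) \<and>
      (\<zeta>2 \<in> rotated k a pos \<and> (\<forall>\<zeta>'\<in>rotated k a pos. Re \<zeta>2 - s * Im \<zeta>2 \<le> Re \<zeta>' - s * Im \<zeta>' + c k)) \<and>
      e' \<le> \<bar>Im \<zeta>1 - Im \<zeta>2\<bar>}" for k a pos
  have "\<exists>m :: nat \<Rightarrow> real. X k a pos \<subseteq> (\<Union>j\<le>N. {m j - d k..m j + d k})" for k a pos
    unfolding X_def N_def d_def using two_near_minima_cover[OF rotated_bound e' c0] .
  note ex_m = this
  define m where "m k a pos = (SOME m :: nat \<Rightarrow> real. X k a pos \<subseteq> (\<Union>j\<le>N. {m j - d k..m j + d k}))" for k a pos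
  have m: "X k a pos \<subseteq> (\<Union>j\<le>N. {m k a pos j - d k..m k a pos j + d k})" for k a pos
    unfolding m_def by (rule someI_ex[OF ex_m])
  define box where "box k t = (case t of (a, pos, j) \<Rightarrow>
    {w. Re w \<in> {-L..L} \<and> Im w \<in> {m k a pos j - d k..m k a pos j + d k}})" for k and t :: "'a \<times> bool \<times> nat"
  define Idx where "Idx = (UNIV :: 'a set) \<times> (UNIV :: bool set) \<times> {..N}"
  have fin: "finite Idx" unfolding Idx_def by simp
  define A where "A k = (\<Union>t\<in>Idx. box k t)" for k
  have box: "box k t \<in> sets lborel" "emeasure lborel (box k t) = ennreal (4 * L * d k)" for k t
  proof -
    obtain a pos j where t: "t = (a, pos, j)" by (cases t) auto
    have "- L \<le> L" "m k a pos j - d k \<le> m k a pos j + d k" using \<open>L \<ge> 1\<close> d0[of k] by auto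
    from emeasure_strip[OF this]
    show "box k t \<in> sets lborel" "emeasure lborel (box k t) = ennreal (4 * L * d k)"
      unfolding box_def t by (auto simp: algebra_simps)
  qed
  have A: "A k \<in> sets lborel" for k unfolding A_def using fin box(1) by (intro sets.finite_UN) auto
  have Ae: "emeasure lborel (A k) \<le> ennreal (real (card Idx) * (4 * L * d k))" for k
  proof -
    have "emeasure lborel (A k) \<le> (\<Sum>t\<in>Idx. emeasure lborel (box k t))"
      unfolding A_def using fin box(1) by (intro emeasure_subadditive_finite) auto
    also have "\<dots> = ennreal (real (card Idx) * (4 * L * d k))"
      unfolding box(2) using d0[of k] \<open>L \<ge> 1\<close> by (simp add: ennreal_of_nat_eq_real_of_nat ennreal_mult)
    finally show ?thesis .
  qed
  have dsum: "summable (\<lambda>k. real (card Idx) * (4 * L * d k))"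
    unfolding d_def by (intro summable_mult summable_divide csum)
  have "AE w in lborel. \<forall>\<^sub>F k in sequentially. w \<in> space lborel - A k"
  proof (rule borel_cantelli_AE1[OF A])
    show "emeasure lborel (A k) < \<infinity>" for k using Ae[of k] by (simp add: le_less_trans)
    have "norm (measure lborel (A k)) \<le> real (card Idx) * (4 * L * d k)" for k
      using Ae[of k] d0[of k] \<open>L \<ge> 1\<close> by (simp add: measure_def enn2real_leI)
    thus "summable (\<lambda>k. measure lborel (A k))" using dsum by (rule summable_comparison_test'[rotated, where N = 0])
  qed
  thus ?thesis
  proof eventually_elim
    case (elim w)
    show ?case
    proof (intro impI)
      assume w: "1 / L \<le> \<bar>Re w\<bar>" "\<bar>Re w\<bar> \<le> L" "\<bar>Im w\<bar> \<le> L"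
      show "\<forall>\<^sub>F k in sequentially. \<not> bad (\<kappa> * real k) k (Complex (Re w) (Re w * Im w))"
        using elim eventually_ge_at_top[of k1]
      proof eventually_elim
        case (elim k)
        show ?case
        proof
          assume b: "bad (\<kappa> * real k) k (Complex (Re w) (Re w * Im w))"
          have "\<kappa> * real k \<ge> 0" using \<open>\<kappa> \<ge> 0\<close> by simp
          moreover have "L * (\<kappa> * real k) / cmod \<beta> ^ k \<le> e / 2" using k1[OF elim(2)] unfolding c_def by simp
          ultimately have "\<exists>a pos \<zeta>1 \<zeta>2. \<zeta>1 \<in> rotated k a pos \<and> \<zeta>2 \<in> rotated k a pos \<and>
              (\<forall>\<zeta>'\<in>rotated k a pos. Re \<zeta>1 - Im w * Im \<zeta>1 \<le> Re \<zeta>' - Im w * Im \<zeta>' + c k) \<and>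
              (\<forall>\<zeta>'\<in>rotated k a pos. Re \<zeta>2 - Im w * Im \<zeta>2 \<le> Re \<zeta>' - Im w * Im \<zeta>' + c k) \<and>
              e' \<le> \<bar>Im \<zeta>1 - Im \<zeta>2\<bar>"
            unfolding c_def e'_def by (intro bad_slope[OF e \<open>L \<ge> 1\<close> w(1,3) _ _ b])
          then obtain a pos where "Im w \<in> X k a pos" unfolding X_def by blast
          then obtain j where "j \<le> N" "Im w \<in> {m k a pos j - d k..m k a pos j + d k}" using m by blast
          hence "w \<in> A k" unfolding A_def Idx_def box_def using w(2)
            by (intro UN_I[of "(a, pos, j)"]) auto
          thus False using elim(1) by blast
        qed
      qed
    qed
  qed
qed

text \<open>The change of coordinates \<open>\<phi>\<close> is differentiable and so preserves
  negligible sets. The images of the sets \<open>W n\<close> contain all exceptional points off the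
  imaginary axis, and the axis is negligible.\<close>

theorem AE_eventually_not_bad:
  assumes urp: "unique_representation_property \<sigma> \<beta> \<Gamma>" and "\<kappa> \<ge> 0"
  shows "AE z in lborel. z \<noteq> 0 \<and> (\<forall>\<^sub>F k in sequentially. \<not> bad (\<kappa> * real k) k z)"
proof -
  define G where "G z \<longleftrightarrow> (\<forall>\<^sub>F k in sequentially. \<not> bad (\<kappa> * real k) k z)" for z
  define \<phi> where "\<phi> w = Complex (Re w) (Re w * Im w)" for w
  define W where "W n = {w. 1 / Suc n \<le> \<bar>Re w\<bar> \<and> \<bar>Re w\<bar> \<le> Suc n \<and> \<bar>Im w\<bar> \<le> Suc n \<and> \<not> G (\<phi> w)}" for n :: nat
  have "negligible (W n)" for n
  proof -
    have "AE w in lborel. w \<notin> W n"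
      using AE_bad_eventually_not_slope[OF assms, of "real (Suc n)"]
      by (simp add: W_def G_def \<phi>_def imp_conjL) (auto elim: eventually_mono)
    then obtain M where "W n \<subseteq> M" "M \<in> null_sets lborel" unfolding eventually_ae_filter by auto
    hence "negligible M" by (simp add: negligible_iff_null_sets null_sets_completionI)
    thus ?thesis using \<open>W n \<subseteq> M\<close> negligible_subset by blast
  qed
  moreover have "\<phi> differentiable_on A" for A
  proof -
    have "\<phi> = (\<lambda>w. of_real (Re w) + of_real (Re w * Im w) * \<i>)"
      unfolding \<phi>_def by (intro ext) (simp add: complex_eq_iff)
    moreover have "(\<lambda>w. of_real (Re w) + of_real (Re w * Im w) * \<i>) differentiable_on A"
      unfolding differentiable_on_def
    proof
      fix x assume "x \<in> A"
      have "((\<lambda>w. of_real (Re w) + of_real (Re w * Im w) * \<i>) has_derivative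
         (\<lambda>h. of_real (Re h) + of_real (Re x * Im h + Re h * Im x) * \<i>)) (at x within A)"
        by (auto intro!: derivative_eq_intros simp: fun_eq_iff)
      thus "(\<lambda>w. of_real (Re w) + of_real (Re w * Im w) * \<i>) differentiable at x within A"
        unfolding differentiable_def by blast
    qed
    ultimately show ?thesis by simp
  qed
  ultimately have "negligible (\<phi> ` W n)" for n
    by (intro negligible_differentiable_image_negligible) auto
  hence "negligible (\<Union>n. \<phi> ` W n)" 
    by (intro negligible_countable_Union) auto
  moreover have "negligible {z::complex. z \<bullet> 1 = 0}" by (rule negligible_standard_hyperplane) (simp add: Basis_complex_def)
  ultimately have neg: "negligible ((\<Union>n. \<phi> ` W n) \<union> {z. z \<bullet> 1 = 0})" by (rule negligible_Un)
  have sub: "{z. \<not> (z \<noteq> 0 \<and> G z)} \<subseteq> (\<Union>n. \<phi> ` W n) \<union> {z. z \<bullet> 1 = 0}"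
  proof
    fix z assume z: "z \<in> {z. \<not> (z \<noteq> 0 \<and> G z)}"
    show "z \<in> (\<Union>n. \<phi> ` W n) \<union> {z. z \<bullet> 1 = 0}"
    proof (cases "Re z = 0")
      case True thus ?thesis by (simp add: inner_complex_def)
    next
      case False
      hence "\<not> G z" using z by auto
      define w where "w = Complex (Re z) (Im z / Re z)"
      have zw: "\<phi> w = z" unfolding \<phi>_def w_def using False by (simp add: complex_eq_iff)
      obtain n :: nat where n: "max (1 / \<bar>Re z\<bar>) (max \<bar>Re z\<bar> \<bar>Im z / Re z\<bar>) \<le> real n" using real_arch_simple by blast
      have "1 / \<bar>Re z\<bar> \<le> real (Suc n)" using n by simp
      hence "1 / real (Suc n) \<le> \<bar>Re z\<bar>" using False by (simp add: field_simps)
      moreover have "Re w = Re z" "Im w = Im z / Re z" unfolding w_def by simp_all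
      ultimately have "w \<in> W n" using \<open>\<not> G z\<close> n by (simp add: W_def zw)
      thus ?thesis using zw by blast
    qed
  qed
  have "negligible {z. \<not> (z \<noteq> 0 \<and> G z)}" using neg sub by (rule negligible_subset)
  hence "{z. \<not> (z \<noteq> 0 \<and> G z)} \<in> null_sets lebesgue" by (simp only: negligible_iff_null_sets)
  hence "AE z in lebesgue. z \<noteq> 0 \<and> G z"
    unfolding eventually_ae_filter by auto
  thus ?thesis unfolding G_def by (simp add: AE_completion_iff)
qed

end

section \<open>Paths of minimal prefixes\<close>

text \<open>With \<open>\<xi> = b / |b|\<close>, the means of \<open>Re (w \<xi>^n)\<close> vanish while those of their squares are
  \<open>|w|^2 / 2\<close>, so these numbers cannot be asymptotically nonpositive.\<close>

lemma rotation_unbounded_above: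
  fixes b w :: complex
  assumes b: "cmod b > 1" and irr: "\<And>n::nat. n > 0 \<Longrightarrow> (b / of_real (cmod b)) ^ n \<noteq> 1"
    and bound: "\<And>n. Re (w * b ^ n) \<le> C"
  shows "w = 0"
proof (rule ccontr)
  assume "w \<noteq> 0"
  define \<xi> where "\<xi> = b / of_real (cmod b)"
  define M where "M = cmod w"
  define y where "y n = Re (w * \<xi> ^ n)" for n
  define C' where "C' = max C 0"
  have M: "M > 0" unfolding M_def using \<open>w \<noteq> 0\<close> by simp
  have b0: "b \<noteq> 0" using b by auto
  have nxi: "cmod \<xi> = 1" unfolding \<xi>_def using b0 by (simp add: norm_divide)
  \<comment> \<open>Two geometric sums have to stay bounded: the one with ratio
    \<open>\<xi>\<close>, and the one with ratio \<open>\<xi>^2\<close> that comes from the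
    squares.\<close>
  have xi1: "\<xi> \<noteq> 1" and xi2: "\<xi> ^ 2 \<noteq> 1" using irr[of 1] irr[of 2] unfolding \<xi>_def by simp_all
  have geo: "\<bar>\<Sum>n<N. Re (v * x ^ n)\<bar> \<le> 2 * cmod v / cmod (x - 1)" if x: "cmod x = 1" "x \<noteq> 1" for v x :: complex and N
  proof -
    have "(\<Sum>n<N. Re (v * x ^ n)) = Re (v * ((x ^ N - 1) / (x - 1)))"
    proof -
      have "(\<Sum>n<N. Re (v * x ^ n)) = Re (\<Sum>n<N. v * x ^ n)" by (rule Re_sum[symmetric])
      also have "(\<Sum>n<N. v * x ^ n) = v * (\<Sum>n<N. x ^ n)" by (rule sum_distrib_left[symmetric])
      also have "(\<Sum>n<N. x ^ n) = (x ^ N - 1) / (x - 1)" using x(2) by (rule geometric_sum)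
      finally show ?thesis .
    qed
    moreover have "cmod (v * ((x ^ N - 1) / (x - 1))) \<le> 2 * cmod v / cmod (x - 1)"
    proof -
      have "cmod (x ^ N - 1) \<le> 2" using norm_triangle_ineq4[of "x ^ N" 1] x(1) by (simp add: norm_power)
      hence "cmod v * cmod (x ^ N - 1) / cmod (x - 1) \<le> cmod v * 2 / cmod (x - 1)"
        by (intro divide_right_mono mult_left_mono) auto
      thus ?thesis by (simp add: norm_mult norm_divide mult.commute)
    qed
    ultimately show ?thesis using abs_Re_le_cmod order_trans by metis
  qed
  have up: "y n \<le> C' * (1 / cmod b) ^ n" for n
  proof -
    have "w * b ^ n = of_real (cmod b ^ n) * (w * \<xi> ^ n)"
      unfolding \<xi>_def using b0 by (simp add: power_divide)
    moreover have "Re (of_real r * v) = r * Re v" for r v by simp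
    ultimately have "cmod b ^ n * y n \<le> C" using bound[of n] unfolding y_def by metis
    also have "C \<le> C'" unfolding C'_def by simp
    finally have "y n \<le> C' / cmod b ^ n" using b0 by (simp add: field_simps)
    thus ?thesis by (simp add: power_one_over divide_inverse power_inverse)
  qed
  have ybd: "\<bar>y n\<bar> \<le> M" for n
    using abs_Re_le_cmod[of "w * \<xi> ^ n"] nxi unfolding y_def M_def by (simp add: norm_mult norm_power)
  \<comment> \<open>A number \<open>y \<le> p\<close> with \<open>p \<ge> 0\<close> satisfies
    \<open>|y| \<le> 2 * p - y\<close>. Here the bounds \<open>p\<close> are summable and the sums
    of \<open>y\<close> are bounded, so the sums of squares stay bounded.\<close>
  have sq_up: "(y n)\<^sup>2 \<le> M * (2 * C' * (1 / cmod b) ^ n - y n)" for n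
  proof -
    have "(y n)\<^sup>2 = \<bar>y n\<bar> * \<bar>y n\<bar>" by (simp add: power2_eq_square)
    also have "\<dots> \<le> M * \<bar>y n\<bar>" using ybd by (intro mult_right_mono) auto
    also have "\<bar>y n\<bar> \<le> 2 * C' * (1 / cmod b) ^ n - y n"
    proof -
      have "0 \<le> C' * (1 / cmod b) ^ n" unfolding C'_def by simp
      thus ?thesis using up[of n] by (simp add: abs_if)
    qed
    finally show ?thesis using M by (simp add: mult_left_mono)
  qed
  \<comment> \<open>From \<open>(Re v)^2 = |v|^2 / 2 + Re (v^2) / 2\<close>; the first summand makes
    the sums of squares grow linearly.\<close>
  have sq_low: "(y n)\<^sup>2 = M\<^sup>2 / 2 + Re (w\<^sup>2 / 2 * (\<xi>\<^sup>2) ^ n)" for n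
  proof -
    define v where "v = w * \<xi> ^ n"
    have "cmod v = M" unfolding v_def M_def using nxi by (simp add: norm_mult norm_power)
    hence "(Re v)\<^sup>2 + (Im v)\<^sup>2 = M\<^sup>2" by (metis cmod_power2)
    hence "(Re v)\<^sup>2 = M\<^sup>2 / 2 + ((Re v)\<^sup>2 - (Im v)\<^sup>2) / 2" by (simp add: field_simps)
    moreover have "w\<^sup>2 / 2 * (\<xi>\<^sup>2) ^ n = v\<^sup>2 / 2"
      unfolding v_def by (simp add: power_mult_distrib flip: power_mult) (simp add: mult.commute)
    moreover have "Re (v\<^sup>2 / 2) = ((Re v)\<^sup>2 - (Im v)\<^sup>2) / 2" by (simp add: Re_power2)
    ultimately show ?thesis unfolding y_def v_def[symmetric] by presburger
  qed
  define q where "q = 1 / cmod b"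
  have q: "0 < q" "q < 1" unfolding q_def using b by (auto simp: divide_less_eq)
  define A1 where "A1 = 2 * cmod w / cmod (\<xi> - 1)"
  define A2 where "A2 = 2 * cmod (w\<^sup>2 / 2) / cmod (\<xi>\<^sup>2 - 1)"
  have bd: "real N * (M\<^sup>2 / 2) \<le> M * (2 * C' * (1 / (1 - q)) + A1) + A2" for N
  proof -
    have "real N * (M\<^sup>2 / 2) + (\<Sum>n<N. Re (w\<^sup>2 / 2 * (\<xi>\<^sup>2) ^ n)) = (\<Sum>n<N. (y n)\<^sup>2)"
      unfolding sq_low by (simp add: sum.distrib)
    also have "\<dots> \<le> (\<Sum>n<N. M * (2 * C' * q ^ n - y n))" unfolding q_def by (intro sum_mono sq_up)
    also have "\<dots> = M * (2 * C' * (\<Sum>n<N. q ^ n) - (\<Sum>n<N. y n))"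
      by (simp only: sum_distrib_left[symmetric] sum_subtractf)
    also have "\<dots> \<le> M * (2 * C' * (1 / (1 - q)) + A1)"
    proof -
      have "(\<Sum>n<N. q ^ n) \<le> (\<Sum>n. q ^ n)" using q by (intro sum_le_suminf summable_geometric) auto
      also have "\<dots> = 1 / (1 - q)" using q by (intro suminf_geometric) auto
      finally have "2 * C' * (\<Sum>n<N. q ^ n) \<le> 2 * C' * (1 / (1 - q))"
        unfolding C'_def by (intro mult_left_mono) auto
      moreover have "- (\<Sum>n<N. y n) \<le> A1" using geo[OF nxi xi1, of w N] unfolding y_def A1_def by linarith
      ultimately show ?thesis using M by (intro mult_left_mono) auto
    qed
    finally have "real N * (M\<^sup>2 / 2) + (\<Sum>n<N. Re (w\<^sup>2 / 2 * (\<xi>\<^sup>2) ^ n)) \<le> M * (2 * C' * (1 / (1 - q)) + A1)" .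
    moreover have "cmod (\<xi>\<^sup>2) = 1" using nxi by (simp add: norm_power)
    from geo[OF this xi2, of "w\<^sup>2 / 2" N]
    have "\<bar>\<Sum>n<N. Re (w\<^sup>2 / 2 * (\<xi>\<^sup>2) ^ n)\<bar> \<le> A2" unfolding A2_def .
    ultimately show ?thesis by linarith
  qed
  obtain N :: nat where "(M * (2 * C' * (1 / (1 - q)) + A1) + A2) / (M\<^sup>2 / 2) < real N"
    using reals_Archimedean2 by blast
  hence "M * (2 * C' * (1 / (1 - q)) + A1) + A2 < real N * (M\<^sup>2 / 2)" using M by (subst (asm) pos_divide_less_eq) auto
  thus False using bd[of N] by simp
qed

lemma decompose_position:
  assumes "j < length ((subst_word \<sigma> ^^ k) w)"
  shows "\<exists>p c s j'. w = p @ [c] @ s \<and> j' < length ((subst_word \<sigma> ^^ k) [c]) \<and> j = length ((subst_word \<sigma> ^^ k) p) + j'"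
  using assms
proof (induction w arbitrary: j)
  case (Cons a w)
  let ?f = "subst_word \<sigma> ^^ k"
  have len: "length (?f (a # w)) = length (?f [a]) + length (?f w)" using subst_pow_Cons[of k \<sigma> a w] by simp
  show ?case
  proof (cases "j < length (?f [a])")
    case True thus ?thesis by (intro exI[of _ "[]"] exI[of _ a] exI[of _ w] exI[of _ j]) simp
  next
    case False
    hence "j - length (?f [a]) < length (?f w)" using Cons.prems len by simp
    then obtain p c s j' where "w = p @ [c] @ s" "j' < length (?f [c])" "j - length (?f [a]) = length (?f p) + j'"
      using Cons.IH by blast
    thus ?thesis using False subst_pow_Cons[of k \<sigma> a p]
      by (intro exI[of _ "a # p"] exI[of _ c] exI[of _ s] exI[of _ j']) auto
  qed
qed simp

section \<open>Prefix values, optimal paths and periodic paths\<close>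

context eigen_subst
begin

text \<open>Locating the position \<open>j\<close> in \<open>\<sigma>^k(c)\<close> yields the first
  \<open>k\<close> digits of a sequence. Multiplied by \<open>\<beta>^k\<close>, they contribute
  exactly the value of the prefix; the arbitrary further digits contribute at most
  \<open>radius\<close>.\<close>

lemma position_value:
  assumes "j < length ((subst_word \<sigma> ^^ k) [c])"
  shows "\<exists>y\<in>S c. cmod (\<beta> ^ k * \<zeta> y - wv (take j ((subst_word \<sigma> ^^ k) [c]))) \<le> radius"
  using assms
proof (induction k arbitrary: c j)
  case 0
  obtain y where "y \<in> S c" using S_nonempty by blast
  thus ?case using zeta_bound 0 by (intro bexI[of _ y]) auto
next
  case (Suc k)
  let ?f = "subst_word \<sigma> ^^ k"
  have w: "(subst_word \<sigma> ^^ Suc k) [c] = ?f (\<sigma> c)" by (simp only: subst_pow_Suc subst_word_simps append_Nil2)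
  obtain p b s j' where d: "\<sigma> c = p @ [b] @ s" "j' < length (?f [b])" "j = length (?f p) + j'"
    using decompose_position[of j k \<sigma> "\<sigma> c"] Suc.prems unfolding w by blast
  obtain y' where y': "y' \<in> S b" "cmod (\<beta> ^ k * \<zeta> y' - wv (take j' (?f [b]))) \<le> radius"
    using Suc.IH d(2) by blast
  define y where "y = case_nat (p, b, s) y'"
  have y: "y \<in> S c" unfolding y_def by (rule cons_in_S[OF d(1) y'(1)])
  have "\<beta> ^ Suc k * \<zeta> y = \<beta> ^ k * (wv p + \<zeta> y')"
    using beta_zeta[OF y] by (simp add: y_def mult.assoc mult.left_commute)
  moreover have "take j (?f (\<sigma> c)) = ?f p @ take j' (?f [b])"
    unfolding d(1,3) using d(2) subst_pow_Cons[of k \<sigma> b s] by simp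
  ultimately have "\<beta> ^ Suc k * \<zeta> y - wv (take j (?f (\<sigma> c))) = \<beta> ^ k * \<zeta> y' - wv (take j' (?f [b]))"
    by (simp add: wv_subst_pow distrib_left)
  thus ?case unfolding w using y y'(2) by (intro bexI[of _ y]) auto
qed

lemma minimizer_shift_iterate:
  assumes "minimizer (z * \<beta> ^ N) a x" "m < N"
  shows "minimizer (z * \<beta> ^ (N - Suc m)) (fst (snd (x m))) (\<lambda>i. x (i + Suc m))"
  using assms(2)
proof (induction m)
  case 0
  hence "\<beta> ^ N = \<beta> ^ (N - 1) * \<beta>" by (simp add: power_eq_if mult.commute)
  thus ?case using minimizer_shift[of "z * \<beta> ^ (N - 1)" a x] assms(1) by (simp add: mult.assoc)
next
  case (Suc m)
  hence "N - Suc m = Suc (N - Suc (Suc m))" by simp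
  hence "z * \<beta> ^ (N - Suc m) = z * \<beta> ^ (N - Suc (Suc m)) * \<beta>" by (simp add: mult.assoc mult.commute)
  hence "minimizer (z * \<beta> ^ (N - Suc (Suc m)) * \<beta>) (fst (snd (x m))) (\<lambda>i. x (i + Suc m))"
    using Suc.IH Suc.prems by (metis Suc_lessD)
  from minimizer_shift[OF this] show ?case by simp
qed

text \<open>\<open>X k\<close> is the splitting at level \<open>k\<close>; \<open>X 0\<close> plays no role.\<close>

lemma optimal_path_exists:
  "\<exists>X. \<forall>k. \<exists>x. minimizer (z * \<beta> ^ k) (fst (snd (X (Suc k)))) x \<and> (\<forall>i<k. x i = X (k - i))"
proof -
  \<comment> \<open>\<open>undefined\<close> stands for some fixed letter at the top of the finite
    paths.\<close>
  obtain x where x: "\<And>N. minimizer (z * \<beta> ^ N) undefined (x N)"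
    using choice[of "\<lambda>N x. minimizer (z * \<beta> ^ N) undefined x"] minimizer_exists by blast
  \<comment> \<open>Digits are numbered from the bottom, so that level \<open>k\<close> keeps the
    index \<open>k\<close> while the depth \<open>N\<close> grows. For \<open>k > N\<close> the
    truncated subtraction gives some splitting, which disappears in the limit.\<close>
  define u where "u N k = x N (N - k)" for N k
  have "u N k \<in> splits" for N k using S_splits x unfolding u_def minimizer_def by blast
  then obtain r X where r: "strict_mono r" "\<And>k. \<forall>\<^sub>F n in sequentially. u (r n) k = X k"
    using finite_valued_subsequence[OF finite_splits, of u] by metis
  have "\<exists>x. minimizer (z * \<beta> ^ k) (fst (snd (X (Suc k)))) x \<and> (\<forall>i<k. x i = X (k - i))" for k
  proof -
    have "\<forall>\<^sub>F n in sequentially. \<forall>i\<in>{..Suc k}. u (r n) i = X i"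
      using r(2) by (intro eventually_ball_finite) auto
    moreover have "\<forall>\<^sub>F n in sequentially. Suc k \<le> r n"
      using filterlim_subseq[OF r(1)] unfolding filterlim_at_top by blast
    ultimately have "\<forall>\<^sub>F n in sequentially. (\<forall>i\<in>{..Suc k}. u (r n) i = X i) \<and> Suc k \<le> r n"
      by (rule eventually_conj)
    from eventually_happens'[OF sequentially_bot this]
    obtain n where n: "\<And>i. i \<le> Suc k \<Longrightarrow> u (r n) i = X i" "Suc k \<le> r n" by auto
    define N where "N = r n"
    define m where "m = N - Suc k"
    have m: "m < N" "N - Suc m = k" using n(2) unfolding m_def N_def by auto
    from minimizer_shift_iterate[OF x m(1)]
    have "minimizer (z * \<beta> ^ k) (fst (snd (x N m))) (\<lambda>i. x N (i + Suc m))" unfolding m(2) .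
    moreover have "x N m = X (Suc k)" using n(1)[of "Suc k"] unfolding u_def m_def N_def by simp
    moreover have "x N (i + Suc m) = X (k - i)" if "i < k" for i
    proof -
      have "N - (k - i) = i + Suc m" using that n(2) unfolding m_def N_def by simp
      thus ?thesis using n(1)[of "k - i"] unfolding u_def N_def by simp
    qed
    ultimately show ?thesis by auto
  qed
  thus ?thesis by blast
qed

text \<open>From period to period the increments have ratio \<open>b = \<beta>^q\<close>, so
  \<open>P (K + n * q)\<close> is affine in \<open>b^n\<close>. The bound \<open>C\<close> excludes
  a nonzero coefficient by \<open>rotation_unbounded_above\<close>, since the positive powers of
  \<open>b / |b|\<close> are again different from 1.\<close>

lemma periodic_partial_sums:
  assumes irr: "\<And>n::nat. n > 0 \<Longrightarrow> (\<beta> / of_real (cmod \<beta>)) ^ n \<noteq> 1" and "z \<noteq> 0"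
    and P: "\<And>k. P (Suc k) = P k + \<beta> ^ k * g k" and bound: "\<And>k. Re (z * P k) \<le> C"
    and per: "q > 0" "\<And>k. k \<ge> K \<Longrightarrow> g (k + q) = g k"
  shows "P (K + n * q) = P K"
proof -
  define D where "D = (\<Sum>i<q. \<beta> ^ i * g (K + i))"
  define b where "b = \<beta> ^ q"
  have b: "cmod b > 1" unfolding b_def using beta per(1) by (simp add: norm_power one_less_power)
  have "b \<noteq> 1" using b by auto
  have Psum: "P (k + m) = P k + \<beta> ^ k * (\<Sum>i<m. \<beta> ^ i * g (k + i))" for k m
    by (induction m) (auto simp: P power_add algebra_simps)
  have gper: "g (K + i + n * q) = g (K + i)" for i n
  proof (induction n)
    case (Suc n) thus ?case using per(2)[of "K + i + n * q"] by (simp add: algebra_simps)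
  qed simp
  have Pstep: "P (K + Suc n * q) = P (K + n * q) + \<beta> ^ K * b ^ n * D" for n
  proof -
    have "P (K + Suc n * q) = P (K + n * q + q)" by (simp add: algebra_simps)
    also have "\<dots> = P (K + n * q) + \<beta> ^ (K + n * q) * (\<Sum>i<q. \<beta> ^ i * g (K + n * q + i))" by (rule Psum)
    also have "(\<Sum>i<q. \<beta> ^ i * g (K + n * q + i)) = D"
      unfolding D_def using gper by (intro sum.cong) (auto simp: algebra_simps)
    also have "\<beta> ^ (K + n * q) = \<beta> ^ K * b ^ n" unfolding b_def by (simp add: power_add power_mult mult.commute flip: power_mult)
    finally show ?thesis .
  qed
  have closed: "P (K + n * q) = P K + \<beta> ^ K * D * ((b ^ n - 1) / (b - 1))" for n
  proof (induction n)
    case (Suc n)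
    have "(b ^ Suc n - 1) / (b - 1) = (b ^ n - 1) / (b - 1) + b ^ n"
      using \<open>b \<noteq> 1\<close> by (simp add: field_simps)
    thus ?case unfolding Pstep Suc by (simp add: algebra_simps)
  qed simp
  define w where "w = z * \<beta> ^ K * D / (b - 1)"
  have "w = 0"
  proof (rule rotation_unbounded_above[OF b])
    show "(b / of_real (cmod b)) ^ n \<noteq> 1" if "n > 0" for n
    proof -
      have "(b / of_real (cmod b)) ^ n = (\<beta> / of_real (cmod \<beta>)) ^ (q * n)"
        unfolding b_def by (simp add: norm_power power_divide power_mult)
      thus ?thesis using irr[of "q * n"] that per(1) by simp
    qed
    show "Re (w * b ^ n) \<le> C - Re (z * P K) + Re w" for n
    proof -
      have "z * P (K + n * q) = z * P K + (w * b ^ n - w)"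
        unfolding closed w_def by (simp add: diff_divide_distrib ring_distribs mult_ac)
      hence "Re (z * P K) + Re (w * b ^ n) - Re w \<le> C" using bound[of "K + n * q"] by simp
      thus ?thesis by simp
    qed
  qed
  hence "D = 0" unfolding w_def using \<open>z \<noteq> 0\<close> beta_nz \<open>b \<noteq> 1\<close> by simp
  thus ?thesis using closed by simp
qed

text \<open>\<open>P\<close> is constant along an arithmetic progression of levels, whereas
  \<open>R\<close> would recur along it and demand arbitrarily negative values. Applied to prefixes
  and, with the opposite sign, to suffixes.\<close>

lemma periodic_growth_impossible:
  assumes irr: "\<And>n::nat. n > 0 \<Longrightarrow> (\<beta> / of_real (cmod \<beta>)) ^ n \<noteq> 1" and "z \<noteq> 0"
    and P: "\<And>k. P (Suc k) = P k + \<beta> ^ k * g k" and bound: "\<And>k. Re (z * P k) \<le> C"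
    and per: "q > 0" "\<And>k. k \<ge> K \<Longrightarrow> g (k + q) = g k" "\<And>k. k \<ge> K \<Longrightarrow> R (k + q) = R k"
    and "\<kappa> > 0" and R: "\<And>k. k \<ge> k0 \<Longrightarrow> R k \<Longrightarrow> Re (z * P (Suc k)) \<le> C - \<kappa> * real (Suc k)"
    and k: "k \<ge> K" "k \<ge> k0"
  shows "\<not> R k"
proof
  assume Rk: "R k"
  have Rn: "R (k + n * q)" for n
  proof (induction n)
    case (Suc n) thus ?case using per(3)[of "k + n * q"] k(1) by (simp add: algebra_simps)
  qed (use Rk in simp)
  have const: "P (Suc k + n * q) = P (Suc k)" for n
    by (rule periodic_partial_sums[OF irr \<open>z \<noteq> 0\<close> P bound per(1)]) (use per(2) k(1) in auto)
  have le: "Re (z * P (Suc k)) \<le> C - \<kappa> * real n" for n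
  proof -
    have "Re (z * P (Suc (k + n * q))) \<le> C - \<kappa> * real (Suc (k + n * q))" using R[OF _ Rn] k(2) by simp
    hence 1: "Re (z * P (Suc k)) \<le> C - \<kappa> * real (Suc (k + n * q))" using const[of n] by simp
    have "n * 1 \<le> n * q" using per(1) by (intro mult_le_mono) auto
    hence "n \<le> Suc (k + n * q)" unfolding mult_1_right by linarith
    hence "\<kappa> * real n \<le> \<kappa> * real (Suc (k + n * q))" using \<open>\<kappa> > 0\<close>
      by (intro mult_left_mono) (simp_all only: of_nat_le_iff less_imp_le)
    thus ?thesis using 1 by linarith
  qed
  obtain n :: nat where "(C - Re (z * P (Suc k))) / \<kappa> < real n" using reals_Archimedean2 by blast
  hence "C - Re (z * P (Suc k)) < \<kappa> * real n" using \<open>\<kappa> > 0\<close> by (simp add: pos_divide_less_eq mult.commute)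
  thus False using le[of n] by linarith
qed

end

text \<open>The slope of the gap \<open>\<kappa> k\<close> is chosen to beat the block length, at most \<open>exp ((\<kappa> - 1) k)\<close>.\<close>

locale optimal_path = growing_iet T I \<alpha> \<sigma> + eigen_subst \<sigma> \<beta> \<Gamma>
  for T :: "real \<Rightarrow> real" and I :: "'a::finite \<Rightarrow> real set" and \<alpha> \<sigma> \<beta> \<Gamma> +
  fixes z :: complex and \<kappa> :: real and X :: "nat \<Rightarrow> 'a list \<times> 'a \<times> 'a list"
  assumes irr: "\<And>n::nat. n > 0 \<Longrightarrow> (\<beta> / of_real (cmod \<beta>)) ^ n \<noteq> 1"
    and z_nz: "z \<noteq> 0"
    and kappa: "\<kappa> = ln (real (Max (range (\<lambda>a. length (\<sigma> a))))) + 1"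
    and eventually_not_bad: "\<forall>\<^sub>F k in sequentially. \<not> bad (\<kappa> * real k) k z"
    and path: "\<And>k. \<exists>x. minimizer (z * \<beta> ^ k) (fst (snd (X (Suc k)))) x \<and> (\<forall>i<k. x i = X (k - i))"
begin

text \<open>The index is shifted: \<open>X (Suc k)\<close> splits
  \<open>\<sigma> (lev (Suc k))\<close> and has \<open>lev k\<close> in the middle
  (\<open>split_lev\<close>).\<close>

definition lev :: "nat \<Rightarrow> 'a" where "lev k = fst (snd (X (Suc k)))"
definition pr :: "nat \<Rightarrow> 'a list" where "pr k = fst (X (Suc k))"
definition sf :: "nat \<Rightarrow> 'a list" where "sf k = snd (snd (X (Suc k)))"
definition block :: "nat \<Rightarrow> 'a list" where "block k = (sub ^^ k) [lev k]"
text \<open>Collects the bounded errors: one \<open>radius\<close> for the optimal sequence, one for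
  its competitor, and two letters that enter at the last position of a block.\<close>

definition C :: real where "C = 2 * cmod z * radius + 2 * cmod z * Max (range (\<lambda>a. cmod (\<Gamma> $ a)))"

text \<open>The words around the marked letter \<open>lev 0\<close> in \<open>block k\<close>
  (\<open>block_eq\<close>). Both only grow outwards, so that the blocks converge to a word around
  that letter.\<close>

primrec pre :: "nat \<Rightarrow> 'a list" where
  "pre 0 = []" | "pre (Suc k) = (sub ^^ k) (pr k) @ pre k"
primrec suf :: "nat \<Rightarrow> 'a list" where
  "suf 0 = []" | "suf (Suc k) = suf k @ (sub ^^ k) (sf k)"

lemma X_Suc: "X (Suc k) = (pr k, lev k, sf k)"
  by (simp add: pr_def lev_def sf_def)

lemma split_lev: "\<sigma> (lev (Suc k)) = pr k @ [lev k] @ sf k"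
proof -
  obtain x where x: "minimizer (z * \<beta> ^ Suc k) (lev (Suc k)) x" "\<forall>i<Suc k. x i = X (Suc k - i)"
    using path[of "Suc k"] unfolding lev_def by blast
  have "x \<in> S (lev (Suc k))" using x(1) unfolding minimizer_def by blast
  moreover have "x 0 = X (Suc k)" using x(2) by simp
  ultimately show ?thesis unfolding S_iff X_Suc by simp
qed

lemma block_Suc: "block (Suc k) = (sub ^^ k) (pr k) @ block k @ (sub ^^ k) (sf k)"
  unfolding block_def by (simp only: subst_pow_Suc subst_word_simps append_Nil2 split_lev subst_pow_append)

lemma block_eq: "block k = pre k @ [lev 0] @ suf k"
proof (induction k)
  case 0 show ?case by (simp add: block_def)
next
  case (Suc k) thus ?case unfolding block_Suc by simp
qed

lemma length_block: "length (block k) = length (pre k) + 1 + length (suf k)"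
  unfolding block_eq by simp

lemma kappa_pos: "\<kappa> \<ge> 1"
proof -
  define L where "L = Max (range (\<lambda>a. length (\<sigma> a)))"
  have "length (\<sigma> undefined) \<le> L" unfolding L_def by (intro Max_ge) auto
  moreover have "length (\<sigma> undefined) \<noteq> 0" using sigma_nonempty by simp
  ultimately have "real L \<ge> 1" by linarith
  thus ?thesis unfolding kappa L_def by (simp add: ln_ge_zero)
qed

lemma C_bounds: "2 * cmod z * radius \<le> C"
    "2 * cmod z * radius + cmod z * cmod (\<Gamma> $ a) + cmod z * cmod (\<Gamma> $ b) \<le> C"
proof -
  define G where "G = Max (range (\<lambda>a. cmod (\<Gamma> $ a)))"
  have G: "cmod (\<Gamma> $ a) \<le> G" for a unfolding G_def by (intro Max_ge) auto
  have le: "cmod z * cmod (\<Gamma> $ a) \<le> cmod z * G" for a using G by (intro mult_left_mono) auto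
  have "0 \<le> cmod z * cmod (\<Gamma> $ a)" by simp
  thus "2 * cmod z * radius \<le> C"
    "2 * cmod z * radius + cmod z * cmod (\<Gamma> $ a) + cmod z * cmod (\<Gamma> $ b) \<le> C"
    using le[of a] le[of b] unfolding C_def G_def[symmetric] by linarith+
qed

text \<open>The \<open>k\<close> digits shared with the path contribute exactly the value of
  \<open>pre k\<close>; the remaining ones are the error.\<close>

lemma path_value:
  assumes "x \<in> S (lev k)" "\<forall>i<k. x i = X (k - i)"
  shows "cmod (\<beta> ^ k * \<zeta> x - wv (pre k)) \<le> radius"
  using assms
proof (induction k arbitrary: x)
  case 0 thus ?case using zeta_bound by simp
next
  case (Suc k)
  have x0: "x 0 = (pr k, lev k, sf k)" using Suc.prems(2) X_Suc by simp
  have "(\<lambda>i. x (Suc i)) \<in> S (lev k)" using shift_in_S[OF Suc.prems(1)] x0 by simp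
  moreover have "\<forall>i<k. x (Suc i) = X (k - i)" using Suc.prems(2) by simp
  ultimately have "cmod (\<beta> ^ k * \<zeta> (\<lambda>i. x (Suc i)) - wv (pre k)) \<le> radius" by (rule Suc.IH)
  moreover have "\<beta> ^ Suc k * \<zeta> x = \<beta> ^ k * (wv (pr k) + \<zeta> (\<lambda>i. x (Suc i)))"
    using beta_zeta[OF Suc.prems(1)] x0 by (simp add: mult.assoc mult.left_commute)
  hence "\<beta> ^ Suc k * \<zeta> x - wv (pre (Suc k)) = \<beta> ^ k * \<zeta> (\<lambda>i. x (Suc i)) - wv (pre k)"
    by (simp add: wv_subst_pow distrib_left)
  ultimately show ?case by (simp only:)
qed

lemma Re_close:
  assumes "cmod (u - v) \<le> radius" shows "\<bar>Re (z * u) - Re (z * v)\<bar> \<le> cmod z * radius"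
proof -
  have "\<bar>Re (z * u) - Re (z * v)\<bar> = \<bar>Re (z * (u - v))\<bar>" by (simp add: right_diff_distrib)
  also have "\<dots> \<le> cmod z * cmod (u - v)" using abs_Re_le_cmod[of "z * (u - v)"] by (simp add: norm_mult)
  also have "\<dots> \<le> cmod z * radius" using assms by (intro mult_left_mono) auto
  finally show ?thesis .
qed

lemma position_lower_bound:
  assumes "j < length (block k)"
  shows "Re (z * wv (pre k)) - C \<le> Re (z * wv (take j (block k)))"
    "Re (z * wv (pre k)) - 2 * cmod z * radius \<le> Re (z * wv (take j (block k)))"
proof -
  obtain x where x: "minimizer (z * \<beta> ^ k) (lev k) x" "\<forall>i<k. x i = X (k - i)"
    using path[of k] unfolding lev_def by blast
  have xS: "x \<in> S (lev k)" using x(1) unfolding minimizer_def by blast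
  obtain y where y: "y \<in> S (lev k)" "cmod (\<beta> ^ k * \<zeta> y - wv (take j (block k))) \<le> radius"
    using position_value assms unfolding block_def by blast
  have "Re (z * \<beta> ^ k * \<zeta> x) \<le> Re (z * \<beta> ^ k * \<zeta> y)" using x(1) y(1) unfolding minimizer_def by blast
  hence "Re (z * (\<beta> ^ k * \<zeta> x)) \<le> Re (z * (\<beta> ^ k * \<zeta> y))" by (simp only: mult.assoc)
  thus "Re (z * wv (pre k)) - 2 * cmod z * radius \<le> Re (z * wv (take j (block k)))"
    using Re_close[OF path_value[OF xS x(2)]] Re_close[OF y(2)] by linarith
  thus "Re (z * wv (pre k)) - C \<le> Re (z * wv (take j (block k)))" using C_bounds(1) by linarith
qed

text \<open>A position outside the central subblock has a digit sequence whose first digit is not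
  \<open>X (Suc k)\<close>. The optimal sequence is a near minimizer, so by \<open>nb\<close> the
  other one is not; what remains is to pass from sequences to words, at the cost of two errors
  \<open>radius\<close>.\<close>

lemma position_gap:
  assumes nb: "\<not> bad (\<kappa> * real (Suc k)) (Suc k) z" and j: "j < length (block (Suc k))"
    and out: "j < length ((sub ^^ k) (pr k)) \<or> length ((sub ^^ k) (pr k)) + length (block k) \<le> j"
  shows "Re (z * wv (pre (Suc k))) + \<kappa> * real (Suc k) - 2 * cmod z * radius \<le> Re (z * wv (take j (block (Suc k))))"
proof -
  have w: "block (Suc k) = (sub ^^ k) (\<sigma> (lev (Suc k)))"
    unfolding block_def by (simp only: subst_pow_Suc subst_word_simps append_Nil2)
  obtain p c s j' where d: "\<sigma> (lev (Suc k)) = p @ [c] @ s" "j' < length ((sub ^^ k) [c])"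
      "j = length ((sub ^^ k) p) + j'"
    using decompose_position[of j k \<sigma> "\<sigma> (lev (Suc k))"] j unfolding w by blast
  have ne: "(p, c, s) \<noteq> X (Suc k)"
  proof
    assume "(p, c, s) = X (Suc k)"
    hence "p = pr k" "c = lev k" unfolding X_Suc by auto
    thus False using out d(2,3) unfolding block_def by auto
  qed
  obtain y' where y': "y' \<in> S c" "cmod (\<beta> ^ k * \<zeta> y' - wv (take j' ((sub ^^ k) [c]))) \<le> radius"
    using position_value[OF d(2)] by blast
  define y where "y = case_nat (p, c, s) y'"
  have y: "y \<in> S (lev (Suc k))" unfolding y_def by (rule cons_in_S[OF d(1) y'(1)])
  have "\<beta> ^ Suc k * \<zeta> y = \<beta> ^ k * (wv p + \<zeta> y')"
    using beta_zeta[OF y] by (simp add: y_def mult.assoc mult.left_commute)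
  moreover have "take j (block (Suc k)) = (sub ^^ k) p @ take j' ((sub ^^ k) [c])"
    unfolding w d(1,3) using d(2) subst_pow_Cons[of k \<sigma> c s] by simp
  ultimately have "\<beta> ^ Suc k * \<zeta> y - wv (take j (block (Suc k))) = \<beta> ^ k * \<zeta> y' - wv (take j' ((sub ^^ k) [c]))"
    by (simp add: wv_subst_pow distrib_left)
  hence y2: "cmod (\<beta> ^ Suc k * \<zeta> y - wv (take j (block (Suc k)))) \<le> radius" using y'(2) by simp
  obtain x where x: "minimizer (z * \<beta> ^ Suc k) (lev (Suc k)) x" "\<forall>i<Suc k. x i = X (Suc k - i)"
    using path[of "Suc k"] unfolding lev_def by blast
  have xS: "x \<in> S (lev (Suc k))" and xmin: "\<And>x'. x' \<in> S (lev (Suc k)) \<Longrightarrow> Re (z * \<beta> ^ Suc k * \<zeta> x) \<le> Re (z * \<beta> ^ Suc k * \<zeta> x')"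
    using x(1) unfolding minimizer_def by blast+
  have "x 0 = X (Suc k)" using x(2) by simp
  hence ne0: "x 0 \<noteq> y 0" using ne unfolding y_def by simp
  have k0: "0 \<le> \<kappa> * real (Suc k)" using kappa_pos by simp
  have "near_min (\<kappa> * real (Suc k)) (z * \<beta> ^ Suc k) (lev (Suc k)) x"
    unfolding near_min_def using xS xmin k0 by (meson add_increasing2)
  hence "\<not> near_min (\<kappa> * real (Suc k)) (z * \<beta> ^ Suc k) (lev (Suc k)) y"
    using nb ne0 unfolding bad_def by blast
  then obtain x' where "x' \<in> S (lev (Suc k))"
     "Re (z * \<beta> ^ Suc k * \<zeta> x') + \<kappa> * real (Suc k) < Re (z * \<beta> ^ Suc k * \<zeta> y)"
    using y unfolding near_min_def by (meson not_le)
  hence "Re (z * \<beta> ^ Suc k * \<zeta> x) + \<kappa> * real (Suc k) \<le> Re (z * \<beta> ^ Suc k * \<zeta> y)"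
    using xmin[of x'] by linarith
  hence "Re (z * (\<beta> ^ Suc k * \<zeta> x)) + \<kappa> * real (Suc k) \<le> Re (z * (\<beta> ^ Suc k * \<zeta> y))" by (simp only: mult.assoc)
  thus ?thesis using Re_close[OF path_value[OF xS x(2)]] Re_close[OF y2] by linarith
qed

text \<open>Turns bounds on prefix values into bounds on the value of the suffix: after the last
  position only one letter is left.\<close>

lemma last_position_value:
  "Re (z * wv (take (length (block k) - 1) (block k))) =
     Re (z * wv (pre k)) + Re (z * wv (suf k)) + Re (z * \<Gamma> $ lev 0) - Re (z * \<Gamma> $ last (block k))"
proof -
  have ne: "block k \<noteq> []" unfolding block_eq by simp
  have "block k = take (length (block k) - 1) (block k) @ [last (block k)]"
    using append_butlast_last_id[OF ne] by (simp only: butlast_conv_take)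
  hence "wv (block k) = wv (take (length (block k) - 1) (block k)) + \<Gamma> $ last (block k)"
    by (metis word_value_append word_value_Cons word_value_Nil add_0_right)
  moreover have "wv (block k) = wv (pre k) + \<Gamma> $ lev 0 + wv (suf k)" unfolding block_eq by simp
  ultimately have "wv (take (length (block k) - 1) (block k)) = wv (pre k) + \<Gamma> $ lev 0 + wv (suf k) - \<Gamma> $ last (block k)"
    by (simp add: algebra_simps)
  thus ?thesis by (simp only: distrib_left right_diff_distrib plus_complex.sel minus_complex.sel)
qed

lemma Re_letter: "\<bar>Re (z * \<Gamma> $ a)\<bar> \<le> cmod z * cmod (\<Gamma> $ a)"
  using abs_Re_le_cmod[of "z * \<Gamma> $ a"] by (simp add: norm_mult)

text \<open>Otherwise \<open>\<sigma>^m(lev (K + m))\<close> has length 1, so \<open>T\<close> maps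
  \<open>\<alpha>^m * t\<close> to \<open>\<alpha>^m * T t\<close> for \<open>t\<close> in that
  interval. Some points near 0 are then moved by at most \<open>\<alpha>^m\<close>, so the
  translation at 0 vanishes.\<close>

lemma not_all_levels_trivial: "\<not> (\<forall>k\<ge>K. \<sigma> (lev (Suc k)) = [lev k])"
proof
  assume triv: "\<forall>k\<ge>K. \<sigma> (lev (Suc k)) = [lev k]"
  have one: "(sub ^^ m) [lev (K + m)] = [lev K]" for m
  proof (induction m)
    case (Suc m)
    have "(sub ^^ Suc m) [lev (K + Suc m)] = (sub ^^ m) (\<sigma> (lev (Suc (K + m))))"
      by (simp only: subst_pow_Suc subst_word_simps append_Nil2 add_Suc_right)
    thus ?case using triv Suc by simp
  qed simp
  define a where "a = letter 0"
  have a: "0 \<in> I a" unfolding a_def by (rule letter_in) simp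
  have a0: "lend a \<le> 0" "0 < rend a" using a by (auto simp: I_iff)
  have small: "\<bar>shift a\<bar> \<le> \<alpha> ^ m" if m: "\<alpha> ^ m < rend a" for m
  proof -
    define t where "t = lend (lev (K + m))"
    have t: "t \<in> I (lev (K + m))" "t \<in> {0..<1}" unfolding t_def using lend_in I_subset by blast+
    have "T (\<alpha> ^ m * t) = \<alpha> ^ m * T t" using tower_itinerary(2)[OF t(1), of m] one[of m] by simp
    moreover have "\<alpha> ^ m * t \<in> I a" using scale_in[OF t(2), of m] m a0 by (auto simp: I_iff)
    hence "T (\<alpha> ^ m * t) = \<alpha> ^ m * t + shift a" by (rule T_on_I)
    ultimately have "shift a = \<alpha> ^ m * T t - \<alpha> ^ m * t" by simp
    thus ?thesis using scale_in[OF t(2), of m] scale_in[OF T_in[OF t(2)], of m]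
      by (simp only: atLeastLessThan_iff) linarith
  qed
  have "shift a = 0"
  proof (rule ccontr)
    assume "shift a \<noteq> 0"
    hence "min (rend a) \<bar>shift a\<bar> > 0" using a0 by simp
    from eventually_happens'[OF sequentially_bot eventually_power_less[OF this]]
    obtain m where "\<alpha> ^ m < min (rend a) \<bar>shift a\<bar>" by blast
    thus False using small[of m] by simp
  qed
  hence "T 0 = 0" using T_on_I[OF a] by simp
  thus False using fixed_0_impossible by simp
qed

text \<open>A nonempty \<open>pr k\<close> puts position 0, of value 0, outside the central
  subblock, so \<open>position_gap\<close> pushes the value of \<open>pre (Suc k)\<close> below
  \<open>C - \<kappa> * (k + 1)\<close>. A nonempty \<open>sf k\<close> acts in the same way through
  the last position. Neither can recur on a periodic path, so from some level on all splittings
  would be trivial.\<close>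

lemma not_eventually_periodic:
  assumes q: "q > 0" and per: "\<And>k. k \<ge> K \<Longrightarrow> lev (k + q) = lev k \<and> X (Suc (k + q)) = X (Suc k)"
  shows False
proof -
  obtain k0 where k0: "\<And>k. k \<ge> k0 \<Longrightarrow> \<not> bad (\<kappa> * real k) k z"
    using eventually_not_bad unfolding eventually_sequentially by blast
  have prper: "pr (k + q) = pr k" and sfper: "sf (k + q) = sf k" if "k \<ge> K" for k
    using per[OF that] unfolding pr_def sf_def by auto
  have kp: "\<kappa> > 0" using kappa_pos by simp
  have bpos: "0 < length (block k)" for k unfolding length_block by simp
  have lenpos: "length w \<le> length ((sub ^^ k) w)" for w k by (rule length_sub_pow_ge)
  have pr: "pr k = []" if "k \<ge> K" "k \<ge> k0" for k
  proof -
    have "\<not> (\<lambda>k. pr k \<noteq> []) k"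
    proof (rule periodic_growth_impossible[where P = "\<lambda>k. wv (pre k)" and g = "\<lambda>k. wv (pr k)" and C = C
        and R = "\<lambda>k. pr k \<noteq> []", OF irr z_nz _ _ q _ _ kp _ that])
      show "wv (pre (Suc k)) = wv (pre k) + \<beta> ^ k * wv (pr k)" for k by (simp add: wv_subst_pow)
      show "Re (z * wv (pre k)) \<le> C" for k using position_lower_bound(1)[OF bpos[of k]] by simp
      show "Re (z * wv (pre (Suc k))) \<le> C - \<kappa> * real (Suc k)" if k: "k0 \<le> k" "pr k \<noteq> []" for k
      proof -
        have "0 < length (pr k)" using k(2) by simp
        hence "0 < length ((sub ^^ k) (pr k))" using lenpos order_less_le_trans by blast
        hence "Re (z * wv (pre (Suc k))) + \<kappa> * real (Suc k) - 2 * cmod z * radius \<le> Re (z * wv (take 0 (block (Suc k))))"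
          using k0[of "Suc k"] k(1) bpos by (intro position_gap) auto
        hence "Re (z * wv (pre (Suc k))) + \<kappa> * real (Suc k) - 2 * cmod z * radius \<le> 0" by simp
        thus ?thesis using C_bounds(1) by linarith
      qed
    qed (use prper in auto)
    thus ?thesis by simp
  qed
  have sf: "sf k = []" if "k \<ge> K" "k \<ge> k0" for k
  proof -
    have "\<not> (\<lambda>k. sf k \<noteq> []) k"
    proof (rule periodic_growth_impossible[where P = "\<lambda>k. - wv (suf k)" and g = "\<lambda>k. - wv (sf k)" and C = C
        and R = "\<lambda>k. sf k \<noteq> []", OF irr z_nz _ _ q _ _ kp _ that])
      show "- wv (suf (Suc k)) = - wv (suf k) + \<beta> ^ k * - wv (sf k)" for k by (simp add: wv_subst_pow)
      have last: "Re (z * - wv (suf k)) \<le> C - x"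
        if "Re (z * wv (pre k)) + x - 2 * cmod z * radius \<le> Re (z * wv (take (length (block k) - 1) (block k)))" for k x
      proof -
        have "Re (z * - wv (suf k)) = - Re (z * wv (suf k))" by simp
        thus ?thesis using that unfolding last_position_value
          using C_bounds(2)[of "lev 0" "last (block k)"] Re_letter[of "lev 0"] Re_letter[of "last (block k)"]
          by linarith
      qed
      show "Re (z * - wv (suf k)) \<le> C" for k
        using last[of k 0] position_lower_bound(2)[of "length (block k) - 1" k] bpos[of k] by simp
      show "Re (z * - wv (suf (Suc k))) \<le> C - \<kappa> * real (Suc k)" if k: "k0 \<le> k" "sf k \<noteq> []" for k
      proof (rule last, rule position_gap)
        have "0 < length (sf k)" using k(2) by simp
        hence "0 < length ((sub ^^ k) (sf k))" using lenpos order_less_le_trans by blast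
        thus "length (block (Suc k)) - 1 < length ((sub ^^ k) (pr k)) \<or>
            length ((sub ^^ k) (pr k)) + length (block k) \<le> length (block (Suc k)) - 1"
          unfolding block_Suc length_append by linarith
      qed (use k0[of "Suc k"] k(1) bpos[of "Suc k"] in auto)
    qed (use sfper in auto)
    thus ?thesis by simp
  qed
  have "\<forall>k\<ge>max K k0. \<sigma> (lev (Suc k)) = [lev k]" using split_lev pr sf by simp
  thus False using not_all_levels_trivial by blast
qed

end

section \<open>Two-sided orbits\<close>

context iet
begin

lemma Tinv_pow_T_pow: "t \<in> {0..<1} \<Longrightarrow> (Tinv ^^ n) ((T ^^ n) t) = t"
proof (induction n)
  case (Suc n)
  have "(Tinv ^^ Suc n) ((T ^^ Suc n) t) = (Tinv ^^ n) (Tinv (T ((T ^^ n) t)))" by (simp add: funpow_swap1)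
  thus ?case using Suc Tinv_T[OF T_pow_in[OF Suc.prems, of n]] by simp
qed simp

lemma int_iterate_add_nat: "t \<in> {0..<1} \<Longrightarrow> int_iterate T (n + int j) t = (T ^^ j) (int_iterate T n t)"
proof (induction j)
  case (Suc j)
  have "n + int (Suc j) = (n + int j) + 1" by simp
  thus ?case using int_iterate_add_1[OF Suc.prems, of "n + int j"] Suc by (simp only: funpow.simps o_apply)
qed simp

lemma int_iterate_neg_nat: "int_iterate T (- int n) t = (Tinv ^^ n) t"
proof (cases "n = 0")
  case False
  hence "\<not> 0 \<le> - int n" by simp
  thus ?thesis unfolding int_iterate_def Tinv_def by simp
qed (simp add: int_iterate_def)

lemma int_iterate_neg: "t \<in> {0..<1} \<Longrightarrow> int_iterate T (- int j) ((T ^^ j) t) = t"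
  unfolding int_iterate_neg_nat by (rule Tinv_pow_T_pow)

end

lemma (in growing_iet) orbit_dense:
  assumes "t \<in> {0..<1}" "0 \<le> x" "x < y" "y \<le> 1"
  shows "\<exists>n. int_iterate T n t \<in> {x..<y}"
proof -
  obtain n where "(T ^^ n) t \<in> {x..<y} \<or> (Tinv ^^ n) t \<in> {x..<y}" using minimal[OF assms] by blast
  moreover have "(T ^^ n) t = int_iterate T (int n) t" by (simp add: int_iterate_def)
  moreover have "(Tinv ^^ n) t = int_iterate T (- int n) t" by (rule int_iterate_neg_nat[symmetric])
  ultimately show ?thesis by metis
qed

text \<open>A coincidence makes the two-sided orbit finite, and a finite set misses an interval to
  the right of its maximum, contrary to \<open>minimal\<close>.\<close>

lemma (in growing_iet) orbit_inj:
  assumes t: "t \<in> {0..<1}"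
  shows "inj (\<lambda>n. int_iterate T n t)"
proof -
  have False if mn: "m < n" "int_iterate T m t = int_iterate T n t" for m n
  proof -
    define q where "q = nat (n - m)"
    define b where "b = int_iterate T m t"
    have b: "b \<in> {0..<1}" unfolding b_def by (rule int_iterate_in[OF t])
    have q: "q > 0" "(T ^^ q) b = b"
      using mn int_iterate_add_nat[OF t, of m q] unfolding q_def b_def by auto
    define P where "P = (\<lambda>i. (T ^^ i) b) ` {..<q}"
    have fwd: "(T ^^ i) b \<in> P" for i
      using funpow_mod_eq[OF q(2), of i] q(1) unfolding P_def by (metis imageI lessThan_iff mod_less_divisor)
    have per: "(T ^^ (q * i)) b = b" for i using funpow_mod_eq[OF q(2), of "q * i"] by simp
    have bwd: "(Tinv ^^ i) b \<in> P" for i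
    proof -
      have "q * i = i + (q * i - i)" using q(1) by simp
      hence "(T ^^ i) ((T ^^ (q * i - i)) b) = b" using per[of i] by (metis funpow_add o_apply)
      hence "(Tinv ^^ i) b = (T ^^ (q * i - i)) b" using Tinv_pow_T_pow[OF T_pow_in[OF b]] by metis
      thus ?thesis using fwd by simp
    qed
    have P: "finite P" "P \<noteq> {}" using q(1) unfolding P_def by auto
    have "P \<subseteq> {0..<1}" unfolding P_def using T_pow_in[OF b] by blast
    hence P1: "Max P \<in> {0..<1}" using Max_in[OF P] by blast
    define x where "x = (Max P + 1) / 2"
    have x: "0 \<le> x" "x < 1" "Max P < x" using P1 unfolding x_def by auto
    obtain i where "(T ^^ i) b \<in> {x..<1} \<or> (Tinv ^^ i) b \<in> {x..<1}" using minimal[OF b x(1,2)] by blast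
    then obtain y where "y \<in> P" "x \<le> y" using fwd bwd by auto
    thus False using Max_ge[OF P(1), of y] x(3) by simp
  qed
  thus ?thesis by (metis (mono_tags, lifting) injI linorder_neq_iff)
qed

lemma mono_unbounded:
  fixes f :: "nat \<Rightarrow> nat"
  assumes "\<And>k. f k \<le> f (Suc k)" "\<And>K. \<exists>k\<ge>K. f k < f (Suc k)"
  shows "\<exists>k. M \<le> f k"
proof (induction M)
  case (Suc M)
  then obtain k where k: "M \<le> f k" by blast
  obtain k' where k': "k' \<ge> k" "f k' < f (Suc k')" using assms(2) by blast
  have "f k \<le> f k'" using lift_Suc_mono_le[of f, OF assms(1) k'(1)] .
  thus ?case using k k' by (intro exI[of _ "Suc k'"]) simp
qed auto

section \<open>The base point as a common point of nested intervals\<close>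

context optimal_path
begin

lemma pre_length_mono: "length (pre k) \<le> length (pre (Suc k))"
  and suf_length_mono: "length (suf k) \<le> length (suf (Suc k))" by simp_all

text \<open>The translation by which \<open>T ^^ length (pre k)\<close> acts on all of
  \<open>\<alpha>^k * I (lev k)\<close> (\<open>base_eq\<close>), read off at the left end. The
  image is the interval \<open>[lo k,hi k)\<close>.\<close>

definition base :: "nat \<Rightarrow> real" where
  "base k = (T ^^ length (pre k)) (\<alpha> ^ k * lend (lev k)) - \<alpha> ^ k * lend (lev k)"
definition step_shift :: "nat \<Rightarrow> real" where
  "step_shift k = (T ^^ length (pr k)) (\<alpha> * lend (lev (Suc k))) - \<alpha> * lend (lev (Suc k))"

lemma block_itinerary:
  "t \<in> I (lev k) \<Longrightarrow> itinerary (length (block k)) (\<alpha> ^ k * t) = block k"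
  "t \<in> I (lev k) \<Longrightarrow> (T ^^ length (block k)) (\<alpha> ^ k * t) = \<alpha> ^ k * T t"
  unfolding block_def by (fact tower_itinerary)+

lemma block_prefix_itinerary:
  "t \<in> I (lev k) \<Longrightarrow> j \<le> length (block k) \<Longrightarrow> itinerary j (\<alpha> ^ k * t) = take j (block k)"
  using block_itinerary(1) take_itinerary by metis

lemma base_eq: assumes "t \<in> I (lev k)" shows "(T ^^ length (pre k)) (\<alpha> ^ k * t) = \<alpha> ^ k * t + base k"
proof -
  have "t \<in> {0..<1}" "lend (lev k) \<in> {0..<1}" using assms lend_in I_subset by blast+
  moreover have "length (pre k) \<le> length (block k)" unfolding length_block by simp
  ultimately show ?thesis
    using same_itinerary_translation[of "\<alpha> ^ k * t" "\<alpha> ^ k * lend (lev k)" "length (pre k)"]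
      block_prefix_itinerary[OF assms] block_prefix_itinerary[OF lend_in] scale_in_unit
    unfolding base_def by simp
qed

lemma step_itinerary:
  assumes "t \<in> I (lev (Suc k))"
  shows "itinerary (length (pr k)) (\<alpha> * t) = pr k" "(T ^^ length (pr k)) (\<alpha> * t) \<in> I (lev k)"
proof -
  have "take (length (pr k)) (itinerary (length (\<sigma> (lev (Suc k)))) (\<alpha> * t)) = itinerary (length (pr k)) (\<alpha> * t)"
    by (rule take_itinerary) (simp add: split_lev)
  thus "itinerary (length (pr k)) (\<alpha> * t) = pr k"
    unfolding itinerary_scaled_letter[OF assms] by (simp add: split_lev)
  show "(T ^^ length (pr k)) (\<alpha> * t) \<in> I (lev k)"
    using return_letters[OF assms, of "length (pr k)"] by (simp add: split_lev)
qed

lemma step_shift_eq: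
  assumes "t \<in> I (lev (Suc k))" shows "(T ^^ length (pr k)) (\<alpha> * t) = \<alpha> * t + step_shift k"
proof -
  have "t \<in> {0..<1}" "lend (lev (Suc k)) \<in> {0..<1}" using assms lend_in I_subset by blast+
  thus ?thesis
    using same_itinerary_translation[of "\<alpha> * t" "\<alpha> * lend (lev (Suc k))" "length (pr k)"]
      step_itinerary(1)[OF assms] step_itinerary(1)[OF lend_in] scale1
    unfolding step_shift_def by simp
qed

lemma pre_Suc_iterate:
  assumes "t \<in> I (lev (Suc k))"
  shows "(T ^^ length (pre (Suc k))) (\<alpha> ^ Suc k * t) =
    (T ^^ length (pre k)) (\<alpha> ^ k * (T ^^ length (pr k)) (\<alpha> * t))"
proof -
  have t: "\<alpha> * t \<in> {0..<1}" using assms I_subset scale1 by blast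
  have "(T ^^ length ((sub ^^ k) (pr k))) (\<alpha> ^ k * (\<alpha> * t)) = \<alpha> ^ k * (T ^^ length (pr k)) (\<alpha> * t)"
    using scaled_itinerary_pow[OF t, of k "length (pr k)"] step_itinerary(1)[OF assms] by simp
  moreover have "\<alpha> ^ Suc k * t = \<alpha> ^ k * (\<alpha> * t)" by simp
  moreover have "(T ^^ length (pre (Suc k))) x = (T ^^ length (pre k)) ((T ^^ length ((sub ^^ k) (pr k))) x)" for x
    using funpow_add[of "length (pre k)" "length ((sub ^^ k) (pr k))" T] by (simp add: add.commute)
  ultimately show ?thesis by (simp only:)
qed

lemma base_Suc: "base (Suc k) = \<alpha> ^ k * step_shift k + base k"
proof -
  define t where "t = lend (lev (Suc k))"
  have t: "t \<in> I (lev (Suc k))" unfolding t_def by (rule lend_in)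
  have "\<alpha> ^ Suc k * t + base (Suc k) = \<alpha> ^ k * (T ^^ length (pr k)) (\<alpha> * t) + base k"
    using base_eq[OF t] pre_Suc_iterate[OF t] base_eq[OF step_itinerary(2)[OF t]] by simp
  thus ?thesis unfolding step_shift_eq[OF t] by (simp add: algebra_simps)
qed

definition lo :: "nat \<Rightarrow> real" where "lo k = \<alpha> ^ k * lend (lev k) + base k"
definition hi :: "nat \<Rightarrow> real" where "hi k = \<alpha> ^ k * rend (lev k) + base k"

lemma step_bounds:
  "lend (lev k) \<le> \<alpha> * lend (lev (Suc k)) + step_shift k"
  "\<alpha> * rend (lev (Suc k)) + step_shift k \<le> rend (lev k)"
proof -
  have in_I: "\<alpha> * t + step_shift k \<in> I (lev k)" if "t \<in> I (lev (Suc k))" for t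
    using step_itinerary(2)[OF that] step_shift_eq[OF that] by simp
  show "lend (lev k) \<le> \<alpha> * lend (lev (Suc k)) + step_shift k" using in_I[OF lend_in] by (simp add: I_iff)
  show "\<alpha> * rend (lev (Suc k)) + step_shift k \<le> rend (lev k)"
  proof (rule ccontr)
    assume "\<not> ?thesis"
    hence "(rend (lev k) - step_shift k) / \<alpha> < rend (lev (Suc k))" using alpha by (simp add: field_simps)
    hence "max (lend (lev (Suc k))) ((rend (lev k) - step_shift k) / \<alpha>) \<in> I (lev (Suc k))"
      using lend_less_rend by (simp add: I_iff)
    from in_I[OF this]
    have "\<alpha> * max (lend (lev (Suc k))) ((rend (lev k) - step_shift k) / \<alpha>) < rend (lev k) - step_shift k"
      by (simp add: I_iff)
    moreover have "\<alpha> * ((rend (lev k) - step_shift k) / \<alpha>) \<le> \<alpha> * max (lend (lev (Suc k))) ((rend (lev k) - step_shift k) / \<alpha>)"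
      using alpha by (intro mult_left_mono) auto
    ultimately show False using alpha by simp
  qed
qed

lemma lo_mono: "lo k \<le> lo (Suc k)" and hi_mono: "hi (Suc k) \<le> hi k"
proof -
  have "\<alpha> ^ k * lend (lev k) \<le> \<alpha> ^ k * (\<alpha> * lend (lev (Suc k)) + step_shift k)"
    using step_bounds(1) alpha by (intro mult_left_mono) auto
  thus "lo k \<le> lo (Suc k)" unfolding lo_def base_Suc by (simp add: algebra_simps)
  have "\<alpha> ^ k * (\<alpha> * rend (lev (Suc k)) + step_shift k) \<le> \<alpha> ^ k * rend (lev k)"
    using step_bounds(2) alpha by (intro mult_left_mono) auto
  thus "hi (Suc k) \<le> hi k" unfolding hi_def base_Suc by (simp add: algebra_simps)
qed

lemma lo_less_hi: "lo k < hi k"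
  unfolding lo_def hi_def using lend_less_rend alpha by simp

text \<open>Two pieces with the same right end overlap. A common point lies on floor
  \<open>length (pr k)\<close> of one first-return tower and on floor \<open>length (pr k')\<close>
  of another; if these numbers differed, the orbit in the tower of the higher floor would meet
  \<open>[0,\<alpha>)\<close> before its first return.\<close>

lemma right_aligned_determines:
  assumes "\<alpha> * rend (lev (Suc k)) + step_shift k = rend (lev k)"
    "\<alpha> * rend (lev (Suc k')) + step_shift k' = rend (lev k')" "lev k = lev k'"
  shows "lev (Suc k) = lev (Suc k') \<and> X (Suc k) = X (Suc k')"
proof -
  have main: "lev (Suc k) = lev (Suc k') \<and> X (Suc k) = X (Suc k')"
    if a: "\<alpha> * rend (lev (Suc k)) + step_shift k = rend (lev k)"
    "\<alpha> * rend (lev (Suc k')) + step_shift k' = rend (lev k')" "lev k = lev k'"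
    "length (pr k) \<le> length (pr k')" for k k'
  proof -
    define s where "s = max (\<alpha> * lend (lev (Suc k)) + step_shift k) (\<alpha> * lend (lev (Suc k')) + step_shift k')"
    define t where "t = (s - step_shift k) / \<alpha>"
    define t' where "t' = (s - step_shift k') / \<alpha>"
    have al: "\<alpha> * lend b < \<alpha> * rend b" for b using lend_less_rend alpha by simp
    have sr: "s < rend (lev k)" using al[of "lev (Suc k)"] al[of "lev (Suc k')"] a(1,2,3) unfolding s_def by simp
    have "s - step_shift k < \<alpha> * rend (lev (Suc k))" "\<alpha> * lend (lev (Suc k)) \<le> s - step_shift k"
      using sr a(1) unfolding s_def by auto
    hence t: "t \<in> I (lev (Suc k))" unfolding t_def using alpha
      by (simp add: I_iff pos_le_divide_eq pos_divide_less_eq mult.commute)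
    have "s - step_shift k' < \<alpha> * rend (lev (Suc k'))" "\<alpha> * lend (lev (Suc k')) \<le> s - step_shift k'"
      using sr a(2,3) unfolding s_def by auto
    hence t': "t' \<in> I (lev (Suc k'))" unfolding t'_def using alpha
      by (simp add: I_iff pos_le_divide_eq pos_divide_less_eq mult.commute)
    have "\<alpha> * t + step_shift k = s" "\<alpha> * t' + step_shift k' = s"
      unfolding t_def t'_def using alpha by simp_all
    hence st: "(T ^^ length (pr k)) (\<alpha> * t) = s" "(T ^^ length (pr k')) (\<alpha> * t') = s"
      using step_shift_eq[OF t] step_shift_eq[OF t'] by (simp_all only:)
    have t01: "\<alpha> * t \<in> {0..<\<alpha>}" "\<alpha> * t \<in> {0..<1}" "\<alpha> * t' \<in> {0..<1}"
      using t t' I_subset scale1 by blast+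
    define d where "d = length (pr k') - length (pr k)"
    have "(T ^^ length (pr k')) x = (T ^^ length (pr k)) ((T ^^ d) x)" for x
      using funpow_add[of "length (pr k)" d T] a(4) unfolding d_def by simp
    hence "(T ^^ length (pr k)) ((T ^^ d) (\<alpha> * t')) = (T ^^ length (pr k)) (\<alpha> * t)" using st by simp
    hence dt: "(T ^^ d) (\<alpha> * t') = \<alpha> * t" using T_pow_inj T_pow_in t01 by blast
    have "d = 0"
    proof (rule ccontr)
      assume "d \<noteq> 0"
      hence "length (\<sigma> (lev (Suc k'))) \<le> d" using first_return_properties(3)[OF t', of d] dt t01(1) by simp
      thus False unfolding d_def split_lev by simp
    qed
    hence "t = t'" using dt alpha by simp
    hence l: "lev (Suc k) = lev (Suc k')" using t t' I_unique by blast
    have len: "length (pr k) = length (pr k')" using \<open>d = 0\<close> a(4) unfolding d_def by simp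
    have "pr k @ [lev k] @ sf k = pr k' @ [lev k'] @ sf k'" using split_lev l by metis
    hence "pr k = pr k'" "sf k = sf k'" using len by auto
    thus ?thesis using l a(3) unfolding X_Suc by simp
  qed
  show ?thesis
  proof (cases "length (pr k) \<le> length (pr k')")
    case True thus ?thesis using main[OF assms] by simp
  next
    case False
    hence "length (pr k') \<le> length (pr k)" by simp
    from main[OF assms(2,1) assms(3)[symmetric] this] show ?thesis by simp
  qed
qed

text \<open>Two levels carry the same letter, and from there on
  \<open>right_aligned_determines\<close> repeats the path.\<close>

lemma not_eventually_right_aligned: "\<not> (\<forall>k\<ge>K. hi (Suc k) = hi k)"
proof
  assume h: "\<forall>k\<ge>K. hi (Suc k) = hi k"
  have al: "\<alpha> * rend (lev (Suc k)) + step_shift k = rend (lev k)" if "k \<ge> K" for k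
  proof -
    have "\<alpha> ^ k * (\<alpha> * rend (lev (Suc k)) + step_shift k) = \<alpha> ^ k * rend (lev k)"
      using h that unfolding hi_def base_Suc by (simp add: algebra_simps)
    thus ?thesis using alpha by simp
  qed
  have "\<not> inj_on lev {K..}"
    using finite_imageD[of lev "{K..}"] infinite_Ici by (metis finite)
  then obtain k k' where kk: "K \<le> k" "k < k'" "lev k = lev k'"
    unfolding inj_on_def by (metis atLeast_iff linorder_neq_iff)
  have both: "lev (k + i) = lev (k' + i) \<and> X (Suc (k + i)) = X (Suc (k' + i))" for i
  proof (induction i)
    case 0 thus ?case using right_aligned_determines[OF al al, of k k'] kk by simp
  next
    case (Suc i)
    have "lev (Suc (k + i)) = lev (Suc (k' + i))"
      using right_aligned_determines[OF al al, of "k + i" "k' + i"] kk Suc by simp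
    thus ?case using right_aligned_determines[OF al al, of "Suc (k + i)" "Suc (k' + i)"] kk by simp
  qed
  show False
  proof (rule not_eventually_periodic[of "k' - k" k])
    show "0 < k' - k" using kk by simp
    fix j assume "j \<ge> k"
    then obtain i where "j = k + i" using le_Suc_ex by blast
    thus "lev (j + (k' - k)) = lev j \<and> X (Suc (j + (k' - k))) = X (Suc j)"
      using both[of i] kk by (simp add: add.commute)
  qed
qed

text \<open>The intervals \<open>[lo k, hi k)\<close> are nested; their intersection could only be empty if they
  eventually shared their right end point.\<close>

lemma base_point_exists: "\<exists>t0\<in>{0..<1}. \<forall>k. \<exists>t\<in>I (lev k). (T ^^ length (pre k)) (\<alpha> ^ k * t) = t0"
proof -
  have inc: "incseq lo" and dec: "decseq hi" using lo_mono hi_mono by (simp_all add: incseq_Suc_iff decseq_Suc_iff)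
  have lohi: "lo m \<le> hi n" for m n
    using incseqD[OF inc, of m "max m n"] decseqD[OF dec, of n "max m n"] lo_less_hi[of "max m n"] by simp
  define y where "y = Sup (range lo)"
  have bdd: "bdd_above (range lo)" using lohi[of _ 0] by (auto intro!: bdd_aboveI)
  have ylo: "lo k \<le> y" for k unfolding y_def using bdd by (intro cSup_upper) auto
  have yhi: "y \<le> hi k" for k unfolding y_def using lohi by (intro cSup_least) auto
  have "y < hi k" for k
  proof (rule ccontr)
    assume "\<not> y < hi k"
    hence "hi k = y" using yhi[of k] by simp
    hence "hi m = y" if "m \<ge> k" for m using decseqD[OF dec that] yhi[of m] by simp
    hence "\<forall>m\<ge>k. hi (Suc m) = hi m" by simp
    thus False using not_eventually_right_aligned by blast
  qed
  hence t: "\<exists>t\<in>I (lev k). (T ^^ length (pre k)) (\<alpha> ^ k * t) = y" for k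
  proof -
    define t where "t = (y - base k) / \<alpha> ^ k"
    have "y - base k < \<alpha> ^ k * rend (lev k)" "\<alpha> ^ k * lend (lev k) \<le> y - base k"
      using ylo[of k] \<open>y < hi k\<close> unfolding lo_def hi_def by auto
    hence "t \<in> I (lev k)" unfolding t_def using alpha
      by (simp add: I_iff pos_le_divide_eq pos_divide_less_eq mult.commute)
    moreover have "\<alpha> ^ k * t + base k = y" unfolding t_def using alpha by simp
    hence "(T ^^ length (pre k)) (\<alpha> ^ k * t) = y"
      using base_eq[OF \<open>t \<in> I (lev k)\<close>] by (simp only:)
    ultimately show ?thesis by blast
  qed
  then obtain t where t0: "t \<in> I (lev 0)" "(T ^^ length (pre 0)) (\<alpha> ^ 0 * t) = y" by blast
  have "t = y" using t0(2) by simp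
  hence "y \<in> {0..<1}" using t0(1) I_subset by blast
  thus ?thesis using t by blast
qed

lemma eventually_constant_point:
  assumes "\<And>k. k \<ge> K \<Longrightarrow> \<alpha> ^ k * s k = c" "\<And>k. s k \<in> {0..<1}" "k \<ge> K"
  shows "s k = 0"
proof -
  have "c \<ge> 0" using assms(1)[of K] assms(2)[of K] alpha by auto
  moreover have "\<not> c > 0"
  proof
    assume "c > 0"
    hence "\<forall>\<^sub>F k in sequentially. \<alpha> ^ k < c \<and> k \<ge> K"
      by (intro eventually_conj eventually_power_less eventually_ge_at_top)
    from eventually_happens'[OF sequentially_bot this] obtain k where "\<alpha> ^ k < c" "k \<ge> K" by blast
    thus False using assms(1)[of k] scale_in[OF assms(2)[of k], of k] by simp
  qed
  ultimately have "c = 0" by simp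
  thus ?thesis using assms(1)[OF assms(3)] alpha by simp
qed

text \<open>Makes the blocks grow on both sides of the base point. If the prefixes stop,
  \<open>\<alpha>^k * \<tau> k\<close> becomes constant and hence 0; if the suffixes stop, the same
  happens to \<open>\<alpha>^k * T (\<tau> k)\<close>. In either case \<open>lev\<close> is
  eventually constant and the path has period 1.\<close>

lemma infinitely_many_nonempty:
  assumes t0: "t0 \<in> {0..<1}" and \<tau>: "\<And>k. \<tau> k \<in> I (lev k)" "\<And>k. (T ^^ length (pre k)) (\<alpha> ^ k * \<tau> k) = t0"
  shows "\<exists>k\<ge>K. pr k \<noteq> []" "\<exists>k\<ge>K. sf k \<noteq> []"
proof -
  have tau01: "\<tau> k \<in> {0..<1}" for k using \<tau>(1) I_subset by blast
  have const: "lev (k + 1) = lev k \<and> X (Suc (k + 1)) = X (Suc k)"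
    if "lev k = b" "lev (Suc k) = b" "lev (Suc (Suc k)) = b"
      "(pr k = [] \<and> pr (Suc k) = []) \<or> (sf k = [] \<and> sf (Suc k) = [])" for k b
    using split_lev[of k] split_lev[of "Suc k"] that unfolding X_Suc by auto
  show "\<exists>k\<ge>K. pr k \<noteq> []"
  proof (rule ccontr)
    assume "\<not> ?thesis"
    hence e: "pr k = []" if "k \<ge> K" for k using that by blast
    have pK: "pre k = pre K" if "k \<ge> K" for k using that
      by (induction k rule: dec_induct) (auto simp: e)
    have "(T ^^ length (pre K)) (\<alpha> ^ k * \<tau> k) = (T ^^ length (pre K)) (\<alpha> ^ K * \<tau> K)" if "k \<ge> K" for k
      using \<tau>(2)[of k] \<tau>(2)[of K] unfolding pK[OF that] by (simp only:)
    hence c: "\<alpha> ^ k * \<tau> k = \<alpha> ^ K * \<tau> K" if "k \<ge> K" for k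
      using T_pow_inj scale_in_unit[OF tau01] that by blast
    have "\<tau> k = 0" if "k \<ge> K" for k
      by (rule eventually_constant_point[of K \<tau> "\<alpha> ^ K * \<tau> K", OF c tau01 that])
    hence l: "lev k = letter 0" if "k \<ge> K" for k using letter_eq[OF \<tau>(1)[of k]] that by simp
    show False
      by (rule not_eventually_periodic[of 1 K]) (use const[of _ "letter 0"] l e in auto)
  qed
  show "\<exists>k\<ge>K. sf k \<noteq> []"
  proof (rule ccontr)
    assume "\<not> ?thesis"
    hence e: "sf k = []" if "k \<ge> K" for k using that by blast
    have s: "suf k = suf K" if "k \<ge> K" for k using that
      by (induction k rule: dec_induct) (auto simp: e)
    have "\<alpha> ^ k * T (\<tau> k) = (T ^^ (1 + length (suf k))) t0" for k
    proof -
      have "\<alpha> ^ k * T (\<tau> k) = (T ^^ (1 + length (suf k) + length (pre k))) (\<alpha> ^ k * \<tau> k)"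
        using block_itinerary(2)[OF \<tau>(1)[of k]] unfolding length_block by (simp add: add.commute)
      thus ?thesis using \<tau>(2)[of k] by (simp only: funpow_add o_apply)
    qed
    hence c: "\<alpha> ^ k * T (\<tau> k) = (T ^^ (1 + length (suf K))) t0" if "k \<ge> K" for k using s[OF that] by simp
    have "T (\<tau> k) = 0" if "k \<ge> K" for k
      by (rule eventually_constant_point[of K "\<lambda>k. T (\<tau> k)", OF c T_in[OF tau01] that])
    hence "\<tau> k = Tinv 0" if "k \<ge> K" for k using Tinv_T[OF tau01[of k]] that by simp
    hence l: "lev k = letter (Tinv 0)" if "k \<ge> K" for k using letter_eq[OF \<tau>(1)[of k]] that by simp
    show False
      by (rule not_eventually_periodic[of 1 K]) (use const[of _ "letter (Tinv 0)"] l e in auto)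
  qed
qed

text \<open>For negative \<open>n\<close> the Birkhoff sum is minus the sum over the
  \<open>-n\<close> steps from \<open>T^n t\<close> back to \<open>t\<close>, which cancels the sign
  in the exponent.\<close>

definition weight :: "real \<Rightarrow> int \<Rightarrow> real" where
  "weight t n = (if 0 \<le> n then exp (- Re (z * wv (itinerary (nat n) t)))
     else exp (Re (z * wv (itinerary (nat (- n)) (int_iterate T n t)))))"

lemma weight_step:
  assumes t: "t \<in> {0..<1}"
  shows "weight t (n + 1) = exp (- Re (z * \<Gamma> $ letter (int_iterate T n t))) * weight t n"
proof (cases "0 \<le> n")
  case True
  hence "nat (n + 1) = nat n + 1" by simp
  hence "itinerary (nat (n + 1)) t = itinerary (nat n) t @ [letter (int_iterate T n t)]"
    using True by (simp add: itinerary_add itinerary_def int_iterate_def)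
  thus ?thesis using True unfolding weight_def by (simp add: distrib_left mult_exp_exp)
next
  case False
  define i where "i = nat (- (n + 1))"
  have i: "nat (- n) = Suc i" using False unfolding i_def by simp
  have "itinerary (nat (- n)) (int_iterate T n t) = letter (int_iterate T n t) # itinerary i (int_iterate T (n + 1) t)"
    unfolding i itinerary_Suc int_iterate_add_1[OF t] ..
  hence w: "weight t n = exp (Re (z * \<Gamma> $ letter (int_iterate T n t)) + Re (z * wv (itinerary i (int_iterate T (n + 1) t))))"
    using False unfolding weight_def by (simp add: distrib_left)
  have "weight t (n + 1) = exp (Re (z * wv (itinerary i (int_iterate T (n + 1) t))))"
    using False unfolding weight_def i_def by (cases "n = -1") auto
  thus ?thesis unfolding w by (simp add: mult_exp_exp)
qed

text \<open>The times at which the orbit of the base point runs through \<open>block k\<close>; time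
  0 reads the marked letter \<open>lev 0\<close>.\<close>

definition window :: "nat \<Rightarrow> int set" where
  "window k = {- int (length (pre k))..<int (length (block k)) - int (length (pre k))}"

text \<open>At the start of the block the weight is \<open>exp (Re (z * wv (pre k)))\<close>, and
  \<open>weight_step\<close> multiplies it by one factor for each letter read.\<close>

lemma weight_in_window:
  assumes t0: "t0 \<in> {0..<1}" and \<tau>: "t \<in> I (lev k)" "(T ^^ length (pre k)) (\<alpha> ^ k * t) = t0"
    and j: "j \<le> length (block k)"
  shows "weight t0 (int j - int (length (pre k))) =
    exp (Re (z * wv (pre k)) - Re (z * wv (take j (block k))))"
proof -
  define b where "b = \<alpha> ^ k * t"
  define p where "p = length (pre k)"
  have b: "b \<in> {0..<1}" unfolding b_def using \<tau>(1) I_subset scale_in_unit by blast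
  have orb: "int_iterate T (- int p) t0 = b"
    using int_iterate_neg[OF b, of p] \<tau>(2) unfolding b_def p_def by simp
  have orb': "int_iterate T (int i - int p) t0 = (T ^^ i) b" for i
    using int_iterate_add_nat[OF t0, of "- int p" i] orb by (simp add: add.commute)
  have it: "itinerary i b = take i (block k)" if "i \<le> length (block k)" for i
    unfolding b_def using block_prefix_itinerary[OF \<tau>(1) that] .
  have "weight t0 (- int p) = exp (Re (z * wv (pre k)))"
  proof (cases "p = 0")
    case True thus ?thesis unfolding weight_def p_def by simp
  next
    case False
    have "itinerary p b = pre k" using it[of p] unfolding p_def length_block by (simp add: block_eq)
    thus ?thesis using False orb unfolding weight_def by simp
  qed
  moreover have "weight t0 (int i - int p) = weight t0 (- int p) * exp (- Re (z * wv (itinerary i b)))" for i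
  proof (induction i)
    case (Suc i)
    have eq: "int (Suc i) - int p = int i - int p + 1" by simp
    have "weight t0 (int (Suc i) - int p) = exp (- Re (z * \<Gamma> $ letter ((T ^^ i) b))) * weight t0 (int i - int p)"
      by (simp only: eq weight_step[OF t0] orb')
    moreover have "itinerary (Suc i) b = itinerary i b @ [letter ((T ^^ i) b)]"
      by (simp add: itinerary_def)
    ultimately show ?case unfolding Suc by (simp add: distrib_left mult_exp_exp)
  qed simp
  ultimately show ?thesis using it[OF j] unfolding p_def[symmetric] by (simp add: mult_exp_exp)
qed

lemma window_Suc_weight:
  assumes t0: "t0 \<in> {0..<1}" and \<tau>: "\<And>k. \<tau> k \<in> I (lev k)" "\<And>k. (T ^^ length (pre k)) (\<alpha> ^ k * \<tau> k) = t0"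
    and nb: "\<not> bad (\<kappa> * real (Suc k)) (Suc k) z" and n: "n \<in> window (Suc k) - window k"
  shows "weight t0 n \<le> exp (C - \<kappa> * real (Suc k))"
proof -
  define j where "j = nat (n + int (length (pre (Suc k))))"
  have nj: "n = int j - int (length (pre (Suc k)))" "j < length (block (Suc k))"
    using n unfolding window_def j_def by auto
  have "j < length ((sub ^^ k) (pr k)) \<or> length ((sub ^^ k) (pr k)) + length (block k) \<le> j"
    using n unfolding nj(1) window_def by auto
  from position_gap[OF nb nj(2) this]
  have "Re (z * wv (pre (Suc k))) - Re (z * wv (take j (block (Suc k)))) \<le> C - \<kappa> * real (Suc k)"
    using C_bounds(1) by linarith
  thus ?thesis using weight_in_window[OF t0 \<tau>(1) \<tau>(2), of j "Suc k"] nj by simp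
qed

lemma window_mono: "window k \<subseteq> window (Suc k)"
  unfolding window_def block_Suc by auto

lemma card_window: "real (card (window k)) \<le> exp ((\<kappa> - 1) * real k)"
proof -
  define L where "L = Max (range (\<lambda>a. length (\<sigma> a)))"
  have L: "length (\<sigma> a) \<le> L" for a unfolding L_def by (intro Max_ge) auto
  have "length (\<sigma> undefined) > 0" using sigma_nonempty by blast
  hence L0: "real L > 0" using L[of undefined] by linarith
  have "length (sub w) \<le> L * length w" for w
  proof (induction w)
    case (Cons a w) thus ?case using L[of a] by simp
  qed simp
  hence "length ((sub ^^ k) w) \<le> L ^ k * length w" for w
  proof (induction k)
    case (Suc k)
    have "length ((sub ^^ Suc k) w) \<le> L * length ((sub ^^ k) w)" using Suc.prems by simp
    also have "\<dots> \<le> L * (L ^ k * length w)" using Suc by (intro mult_left_mono) auto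
    finally show ?case by (simp add: mult.assoc)
  qed simp
  from this[of "[lev k]"] have "card (window k) \<le> L ^ k" unfolding window_def block_def by simp
  hence "real (card (window k)) \<le> real L ^ k" by (metis of_nat_le_iff of_nat_power)
  also have "real L ^ k = exp (ln (real L) * real k)" using L0 by (simp add: exp_of_nat2_mult)
  finally show ?thesis unfolding kappa L_def by simp
qed

text \<open>The part that is new in the window of level \<open>k + 1\<close> has at most
  \<open>exp ((\<kappa> - 1) * (k + 1))\<close> elements of weight at most
  \<open>exp (C - \<kappa> * (k + 1))\<close>, a total of at most
  \<open>exp C * exp (-1)^(k + 1)\<close>. As the windows exhaust the integers, the geometric bound
  on their sums bounds all finite sums.\<close>

lemma weight_summable:
  assumes t0: "t0 \<in> {0..<1}" and \<tau>: "\<And>k. \<tau> k \<in> I (lev k)" "\<And>k. (T ^^ length (pre k)) (\<alpha> ^ k * \<tau> k) = t0"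
  shows "weight t0 summable_on UNIV"
proof -
  obtain k0 where k0: "\<And>k. k \<ge> k0 \<Longrightarrow> \<not> bad (\<kappa> * real k) k z"
    using eventually_not_bad unfolding eventually_sequentially by blast
  have fin: "finite (window k)" for k unfolding window_def by simp
  have wpos: "weight t0 n \<ge> 0" for n unfolding weight_def by simp
  have step: "sum (weight t0) (window (Suc k)) \<le> sum (weight t0) (window k) + exp C * exp (-1) ^ Suc k"
    if k: "k \<ge> k0" for k
  proof -
    have "sum (weight t0) (window (Suc k)) = sum (weight t0) (window (Suc k) - window k) + sum (weight t0) (window k)"
      using sum.subset_diff[OF window_mono fin] .
    also have "sum (weight t0) (window (Suc k) - window k) \<le> real (card (window (Suc k) - window k)) * exp (C - \<kappa> * real (Suc k))"
      using k0[of "Suc k"] k by (intro sum_bounded_above window_Suc_weight[OF t0 \<tau>]) auto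
    also have "\<dots> \<le> exp ((\<kappa> - 1) * real (Suc k)) * exp (C - \<kappa> * real (Suc k))"
    proof (rule mult_right_mono)
      have "card (window (Suc k) - window k) \<le> card (window (Suc k))" by (rule card_mono[OF fin]) auto
      thus "real (card (window (Suc k) - window k)) \<le> exp ((\<kappa> - 1) * real (Suc k))"
        using card_window[of "Suc k"] by linarith
    qed simp
    also have "\<dots> = exp C * exp (-1) ^ Suc k"
    proof -
      have "(\<kappa> - 1) * real (Suc k) + (C - \<kappa> * real (Suc k)) = C + real (Suc k) * (-1)" by (simp add: algebra_simps)
      thus ?thesis by (simp only: mult_exp_exp flip: exp_of_nat_mult)
    qed
    finally show ?thesis by simp
  qed
  define q where "q = exp (-1 :: real)"
  have q: "0 < q" "q < 1" unfolding q_def by auto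
  define M where "M = sum (weight t0) (window k0) + exp C * (1 / (1 - q))"
  have "sum (weight t0) (window (k0 + i)) \<le> sum (weight t0) (window k0) + exp C * (\<Sum>m<i. q ^ m)" for i
  proof (induction i)
    case (Suc i)
    have "q ^ Suc (k0 + i) \<le> q ^ i" using q by (intro power_decreasing) auto
    hence "exp C * q ^ Suc (k0 + i) \<le> exp C * q ^ i" by (intro mult_left_mono) auto
    hence "sum (weight t0) (window (k0 + Suc i)) \<le> sum (weight t0) (window (k0 + i)) + exp C * q ^ i"
      using step[of "k0 + i", OF le_add1] unfolding q_def add_Suc_right by linarith
    thus ?case using Suc by (simp add: distrib_left)
  qed simp
  moreover have "(\<Sum>m<i. q ^ m) \<le> 1 / (1 - q)" for i
  proof -
    have "(\<Sum>m<i. q ^ m) \<le> (\<Sum>m. q ^ m)" using q by (intro sum_le_suminf summable_geometric) auto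
    thus ?thesis using suminf_geometric[of q] q by simp
  qed
  ultimately have bound: "sum (weight t0) (window (k0 + i)) \<le> M" for i
    unfolding M_def by (meson add_left_mono exp_ge_zero mult_left_mono order_trans)
  have lenpos: "length w \<le> length ((sub ^^ k) w)" for w k by (rule length_sub_pow_ge)
  have pre_unb: "\<exists>k. N \<le> length (pre k)" for N
  proof (rule mono_unbounded[of "\<lambda>k. length (pre k)", OF pre_length_mono])
    fix K
    obtain k where k: "k \<ge> K" "pr k \<noteq> []" using infinitely_many_nonempty(1)[OF t0 \<tau>] by blast
    have "0 < length ((sub ^^ k) (pr k))" using k(2) lenpos[of "pr k" k] order_less_le_trans by blast
    thus "\<exists>k\<ge>K. length (pre k) < length (pre (Suc k))" using k by auto
  qed
  have suf_unb: "\<exists>k. N \<le> length (suf k)" for N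
  proof (rule mono_unbounded[of "\<lambda>k. length (suf k)", OF suf_length_mono])
    fix K
    obtain k where k: "k \<ge> K" "sf k \<noteq> []" using infinitely_many_nonempty(2)[OF t0 \<tau>] by blast
    have "0 < length ((sub ^^ k) (sf k))" using k(2) lenpos[of "sf k" k] order_less_le_trans by blast
    thus "\<exists>k\<ge>K. length (suf k) < length (suf (Suc k))" using k by auto
  qed
  have wm: "window a \<subseteq> window b" if "a \<le> b" for a b
    using lift_Suc_mono_le[of window, OF window_mono that] .
  have cover: "\<exists>i. F \<subseteq> window (k0 + i)" if F: "finite F" for F
  proof -
    define N where "N = nat (Max (insert 0 (abs ` F))) + 1"
    have N: "\<bar>n\<bar> < int N" if "n \<in> F" for n
    proof -
      have "\<bar>n\<bar> \<le> Max (insert 0 (abs ` F))" using F that by (intro Max_ge) auto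
      thus ?thesis unfolding N_def by linarith
    qed
    obtain k1 k2 where k12: "N \<le> length (pre k1)" "N \<le> length (suf k2)" using pre_unb suf_unb by metis
    define i where "i = max k1 k2"
    have le: "k1 \<le> k0 + i" "k2 \<le> k0 + i" unfolding i_def by auto
    have "length (pre k1) \<le> length (pre (k0 + i))"
      by (rule lift_Suc_mono_le[of "\<lambda>k. length (pre k)", OF pre_length_mono le(1)])
    moreover have "length (suf k2) \<le> length (suf (k0 + i))"
      by (rule lift_Suc_mono_le[of "\<lambda>k. length (suf k)", OF suf_length_mono le(2)])
    ultimately have "n \<in> window (k0 + i)" if "n \<in> F" for n
      using N[OF that] k12 unfolding window_def length_block by auto
    thus ?thesis by blast
  qed
  show ?thesis
  proof (rule nonneg_bdd_above_summable_on)
    show "bdd_above (sum (weight t0) ` {F. F \<subseteq> UNIV \<and> finite F})"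
    proof (rule bdd_aboveI[of _ M])
      fix x assume "x \<in> sum (weight t0) ` {F. F \<subseteq> UNIV \<and> finite F}"
      then obtain F where F: "finite F" "x = sum (weight t0) F" by blast
      obtain i where "F \<subseteq> window (k0 + i)" using cover F by blast
      hence "x \<le> sum (weight t0) (window (k0 + i))" unfolding F(2) using wpos by (intro sum_mono2 fin) auto
      thus "x \<le> M" using bound[of i] by linarith
    qed
  qed (use wpos in auto)
qed

theorem slopes_realized:
  "\<exists>f J h. affine_interval_exchange f J (\<chi> a. exp (- Re (z * \<Gamma> $ a))) \<and>
        semi_conjugacy h f T \<and> (\<forall>a. h ` J a = I a) \<and> (\<exists>W. wandering_interval f W)"
proof -
  obtain t0 where t0: "t0 \<in> {0..<1}" "\<forall>k. \<exists>t\<in>I (lev k). (T ^^ length (pre k)) (\<alpha> ^ k * t) = t0"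
    using base_point_exists by blast
  then obtain \<tau> where \<tau>: "\<And>k. \<tau> k \<in> I (lev k)" "\<And>k. (T ^^ length (pre k)) (\<alpha> ^ k * \<tau> k) = t0"
    by metis
  show ?thesis
    by (rule denjoy_construction[OF t0(1) orbit_inj[OF t0(1)] orbit_dense[OF t0(1)] _
          weight_summable[OF t0(1) \<tau>] weight_step[OF t0(1)]]) (auto simp: weight_def)
qed

end

section \<open>From the eigenvector to the hypotheses of the construction\<close>

lemma word_value_count: "word_value \<gamma> w = (\<Sum>b\<in>UNIV. of_nat (count_list w b) * \<gamma> $ b)"
proof (induction w)
  case (Cons a w)
  have "(\<Sum>b\<in>UNIV. of_nat (count_list (a # w) b) * \<gamma> $ b) =
    (\<Sum>b\<in>UNIV. (if a = b then \<gamma> $ b else 0) + of_nat (count_list w b) * \<gamma> $ b)"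
    by (intro sum.cong) (auto simp: distrib_right)
  thus ?case using Cons by (simp add: sum.distrib)
qed simp

theorem theoremA:
  fixes T :: "real \<Rightarrow> real" and I :: "'a::finite \<Rightarrow> real set" and \<alpha> :: real
    and \<sigma> :: "'a \<Rightarrow> 'a list" and \<beta> :: complex and \<Gamma> :: "complex^'a"
  assumes "interval_exchange T I"
    and "self_similar T \<alpha>"
    and "associated_substitution T I \<alpha> \<sigma>"
    and "cmod \<beta> > 1"
    and "\<forall>n::nat. n > 0 \<longrightarrow> (\<beta> / complex_of_real (cmod \<beta>)) ^ n \<noteq> 1"
    and "is_eigenvector (substitution_matrix \<sigma>) \<Gamma> \<beta>"
    and "unique_representation_property \<sigma> \<beta> \<Gamma>"
  shows "AE z in (lborel :: complex measure).
    let \<gamma> = z *s \<Gamma> in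
      \<exists>f J h. affine_interval_exchange f J (\<chi> a. exp (- Re (\<gamma> $ a))) \<and>
        semi_conjugacy h f T \<and> (\<forall>a. h ` J a = I a) \<and>
        (\<exists>W. wandering_interval f W)"
proof -
  interpret self_similar_iet T I \<alpha> \<sigma> using assms(1-3) by unfold_locales
  interpret eigen_subst \<sigma> \<beta> \<Gamma>
  proof
    show "\<sigma> a \<noteq> []" for a by (rule sigma_nonempty)
    show "1 < cmod \<beta>" by (rule assms(4))
    fix a
    have "(substitution_matrix \<sigma> *v \<Gamma>) $ a = (\<beta> *s \<Gamma>) $ a"
      using assms(6) unfolding is_eigenvector_def by simp
    thus "word_value \<Gamma> (\<sigma> a) = \<beta> * \<Gamma> $ a"
      unfolding word_value_count by (simp add: matrix_vector_mult_def substitution_matrix_def)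
  qed
  \<comment> \<open>The word \<open>\<sigma>^n(a)\<close> has the value
    \<open>\<beta>^n * \<Gamma> $ a\<close>, whose modulus is at most \<open>G\<close> times its
    length; so a letter with \<open>\<Gamma> $ a \<noteq> 0\<close> grows.\<close>
  have growth: "\<exists>a. \<forall>q. \<forall>\<^sub>F n in sequentially. q < length ((sub ^^ n) [a])"
  proof -
    have "\<Gamma> \<noteq> 0" using assms(6) unfolding is_eigenvector_def by blast
    then obtain a where a: "\<Gamma> $ a \<noteq> 0" by (metis vec_eq_iff zero_index)
    define G where "G = Max (range (\<lambda>b. cmod (\<Gamma> $ b)))"
    have G: "cmod (\<Gamma> $ b) \<le> G" for b unfolding G_def by (intro Max_ge) auto
    have Gpos: "G > 0" using G[of a] a by (smt (verit) zero_less_norm_iff)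
    have wv_le: "cmod (wv w) \<le> real (length w) * G" for w
    proof (induction w)
      case (Cons b w)
      have "cmod (wv (b # w)) \<le> cmod (\<Gamma> $ b) + cmod (wv w)" by (simp add: norm_triangle_ineq)
      thus ?case using Cons G[of b] by (simp add: distrib_right)
    qed simp
    have "\<forall>\<^sub>F n in sequentially. q < length ((sub ^^ n) [a])" for q
    proof -
      have "filterlim (\<lambda>n. \<beta> ^ n) at_infinity sequentially"
        using assms(4) by (rule filterlim_realpow_sequentially_gt1)
      hence "\<forall>\<^sub>F n in sequentially. real q * G / cmod (\<Gamma> $ a) < cmod \<beta> ^ n"
        unfolding filterlim_at_infinity_conv_norm_at_top filterlim_at_top_dense norm_power by blast
      thus ?thesis
      proof eventually_elim
        case (elim n)
        have "real q * G < cmod \<beta> ^ n * cmod (\<Gamma> $ a)" using elim a by (simp add: pos_divide_less_eq)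
        also have "\<dots> = cmod (wv ((sub ^^ n) [a]))" by (simp add: wv_subst_pow norm_mult norm_power)
        also have "\<dots> \<le> real (length ((sub ^^ n) [a])) * G" by (rule wv_le)
        finally show ?case using Gpos by simp
      qed
    qed
    thus ?thesis by blast
  qed
  interpret growing_iet T I \<alpha> \<sigma> by unfold_locales (rule growth)
  define \<kappa> where "\<kappa> = ln (real (Max (range (\<lambda>a. length (\<sigma> a))))) + 1"
  have "length (\<sigma> undefined) \<le> Max (range (\<lambda>a. length (\<sigma> a)))" by (intro Max_ge) auto
  moreover have "length (\<sigma> undefined) \<noteq> 0" using sigma_nonempty by simp
  ultimately have "real (Max (range (\<lambda>a. length (\<sigma> a)))) \<ge> 1" by linarith
  hence "\<kappa> \<ge> 0" unfolding \<kappa>_def using ln_ge_zero by fastforce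
  from AE_eventually_not_bad[OF assms(7) this] show ?thesis
  proof eventually_elim
    case (elim z)
    obtain X where X: "\<And>k. \<exists>x. minimizer (z * \<beta> ^ k) (fst (snd (X (Suc k)))) x \<and> (\<forall>i<k. x i = X (k - i))"
      using optimal_path_exists by blast
    interpret optimal_path T I \<alpha> \<sigma> \<beta> \<Gamma> z \<kappa> X
      by unfold_locales (use assms(5) elim X \<kappa>_def in auto)
    show ?case using slopes_realized by (simp add: Let_def)
  qed
qed

end
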